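(* Let $M$ be an invariant submanifold of a manifold endowed with a metric mixed 3-structure $(\overline{M},(\varphi_\alpha,\xi_\alpha,\eta_\alpha)_{\alpha=1,2,3},\overline{g})$, such that the structure vector fields $\xi_1,\xi_2,\xi_3$ are normal to $M$. If $\overline{M}$ is mixed 3-cosymplectic, then $M$ is a para-hyper-Kähler manifold (with the induced metric $g$ and the structure $J_\alpha=\varphi_\alpha|_{M}$, $\alpha=1,2,3$), totally geodesically immersed in $\overline{M}$.
   Context: Set $\tau_1=\tau_2=-1$, $\tau_3=1$. A mixed 3-structure on a smooth manifold $\overline{M}$ is a triple $(\varphi_\alpha,\xi_\alpha,\eta_\alpha)$, $\alpha=1,2,3$, where $\varphi_\alpha$ is a $(1,1)$-tensor field, $\xi_\alpha$ a vector field, $\eta_\alpha$ a 1-form, such that $\varphi_\alpha^2=\tau_\alpha(-I+\eta_\alpha\otimes\xi_\alpha)$, $\eta_\alpha(\xi_\alpha)=1$ (hence $\varphi_\alpha\xi_\alpha=0$, $\eta_\alpha\circ\varphi_\alpha=0$), and for every even permutation $(\alpha,\beta,\gamma)$ of $(1,2,3)$: $\eta_\alpha(\xi_\beta)=\eta_\beta(\xi_\alpha)=0$; $\varphi_\alpha(\xi_\beta)=\tau_\beta\xi_\gamma$, $\varphi_\beta(\xi_\alpha)=-\tau_\alpha\xi_\gamma$; $\eta_\alpha\circ\varphi_\beta=-\eta_\beta\circ\varphi_\alpha=\tau_\gamma\eta_\gamma$; $\varphi_\alpha\varphi_\beta-\tau_\alpha\eta_\beta\otimes\xi_\alpha=-\varphi_\beta\varphi_\alpha+\tau_\beta\eta_\alpha\otimes\xi_\beta=\tau_\gamma\varphi_\gamma$.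 It is a metric mixed 3-structure if in addition there is given a semi-Riemannian metric $\overline{g}$ with $\overline{g}(\varphi_\alpha X,\varphi_\alpha Y)=\tau_\alpha[\overline{g}(X,Y)-\varepsilon_\alpha\eta_\alpha(X)\eta_\alpha(Y)]$ for all $X,Y$ and $\alpha=1,2,3$, where $\varepsilon_\alpha=\overline{g}(\xi_\alpha,\xi_\alpha)=\pm1$. Consequently $\eta_\alpha(X)=\varepsilon_\alpha\overline{g}(X,\xi_\alpha)$ and $\overline{g}(\varphi_\alpha X,Y)=-\overline{g}(X,\varphi_\alpha Y)$. The structure is mixed 3-cosymplectic if $\overline\nabla\varphi_\alpha=0$ for $\alpha=1,2,3$, where $\overline\nabla$ is the Levi-Civita connection of $\overline g$ (it follows that $\overline\nabla\xi_\alpha=0$). All submanifolds $M$ are immersed and non-degenerate (the restriction $g$ of $\overline g$ to $TM$ is non-degenerate). $M$ is invariant if $\varphi_\alpha(T_pM)\subset T_pM$ for all $p\in M$, $\alpha=1,2,3$; the structure vector fields are normal to $M$ if $\xi_{\alpha,p}\in T_pM^\perp$ for all $p\in M$, $\alpha=1,2,3$. Totally geodesic means vanishing second fundamental form. An almost para-hypercomplex structure on $M$ is a triple $H=(J_1,J_2,J_3)$ of $(1,1)$-tensor fields with $J_1^2=J_2^2=Id$, $J_1,J_2\neq\pm Id$, $J_3^2=-Id$, $J_1J_2=-J_2J_1=J_3$. With a semi-Riemannian metric $g$ satisfying $g(J_1X,J_1Y)=g(J_2X,J_2Y)=-g(J_3X,J_3Y)=-g(X,Y)$, $(M,g,H)$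 is almost para-hyperhermitian; it is para-hyper-Kähler if moreover $J_1,J_2,J_3$ are parallel for the Levi-Civita connection of $g$. *)

theory Defs
  imports "HOL-Analysis.Analysis"
begin

section \<open>Smooth manifolds\<close>

text \<open>\<open>Ck_on k S f\<close> and \<open>smooth_on S f\<close> are only used for open \<open>S\<close>.\<close>

fun Ck_on :: "nat \<Rightarrow> 'a::euclidean_space set \<Rightarrow> ('a \<Rightarrow> 'b::real_normed_vector) \<Rightarrow> bool" where
  "Ck_on 0 S f \<longleftrightarrow> continuous_on S f"
| "Ck_on (Suc k) S f \<longleftrightarrow>
     (\<forall>x\<in>S. f differentiable (at x)) \<and> (\<forall>v. Ck_on k S (\<lambda>x. frechet_derivative f (at x) v))"

definition smooth_on :: "'a::euclidean_space set \<Rightarrow> ('a \<Rightarrow> 'b::real_normed_vector) \<Rightarrow> bool" where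
  "smooth_on S f \<longleftrightarrow> (\<forall>k. Ck_on k S f)"

text \<open>A chart is a pair of its domain and its coordinate map; the values of the coordinate map
  outside the domain are irrelevant.\<close>

type_synonym ('p, 'e) chart = "'p set \<times> ('p \<Rightarrow> 'e)"

definition chart_inv :: "('p, 'e) chart \<Rightarrow> 'e \<Rightarrow> 'p" where
  "chart_inv c = inv_into (fst c) (snd c)"

text \<open>A manifold is a Hausdorff second countable type together with a smooth atlas covering it.
  All manifolds are therefore nonempty and of dimension \<open>DIM('e) \<ge> 1\<close>.\<close>

definition smooth_atlas ::
    "('p::{t2_space,second_countable_topology}, 'e::euclidean_space) chart set \<Rightarrow> bool" where
  "smooth_atlas A \<longleftrightarrow>
     (\<Union>c\<in>A. fst c) = UNIV \<and>
     (\<forall>c\<in>A. open (fst c) \<and> open (snd c ` fst c) \<and>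
        homeomorphism (fst c) (snd c ` fst c) (snd c) (chart_inv c)) \<and>
     (\<forall>c\<in>A. \<forall>d\<in>A. smooth_on (snd c ` (fst c \<inter> fst d)) (snd d \<circ> chart_inv c))"

text \<open>Every point \<open>p\<close> has a preferred chart \<open>chart_at A p\<close>. The tangent space at \<open>p\<close> is
  identified with the model space \<open>'e\<close>: a vector of type \<open>'e\<close> stands for the tangent vector at
  \<open>p\<close> having these components in the preferred chart at \<open>p\<close>. The preferred chart jumps from
  point to point, so smoothness of a vector field must be tested on its components
  \<open>components_in A c p (X p)\<close> in a fixed chart \<open>c\<close>, not on \<open>X\<close> itself.\<close>

definition chart_at :: "('p, 'e) chart set \<Rightarrow> 'p \<Rightarrow> ('p, 'e) chart" where
  "chart_at A p = (SOME c. c \<in> A \<and> p \<in> fst c)"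

definition components_in ::
    "('p, 'e::euclidean_space) chart set \<Rightarrow> ('p, 'e) chart \<Rightarrow> 'p \<Rightarrow> 'e \<Rightarrow> 'e" where
  "components_in A c p =
     frechet_derivative (snd c \<circ> chart_inv (chart_at A p)) (at (snd (chart_at A p) p))"

definition smooth_fun_on ::
    "('p, 'e::euclidean_space) chart set \<Rightarrow> 'p set \<Rightarrow> ('p \<Rightarrow> real) \<Rightarrow> bool" where
  "smooth_fun_on A U f \<longleftrightarrow> (\<forall>c\<in>A. smooth_on (snd c ` (U \<inter> fst c)) (f \<circ> chart_inv c))"

text \<open>The derivative \<open>v(f)\<close> of a function \<open>f\<close> along a tangent vector \<open>v\<close> at \<open>p\<close>.\<close>

definition vderiv ::
    "('p, 'e::euclidean_space) chart set \<Rightarrow> 'p \<Rightarrow> 'e \<Rightarrow> ('p \<Rightarrow> real) \<Rightarrow> real" where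
  "vderiv A p v f =
     frechet_derivative (f \<circ> chart_inv (chart_at A p)) (at (snd (chart_at A p) p)) v"

definition smooth_vector_field_on ::
    "('p, 'e::euclidean_space) chart set \<Rightarrow> 'p set \<Rightarrow> ('p \<Rightarrow> 'e) \<Rightarrow> bool" where
  "smooth_vector_field_on A U X \<longleftrightarrow>
     (\<forall>c\<in>A. smooth_on (snd c ` (U \<inter> fst c))
        (\<lambda>x. components_in A c (chart_inv c x) (X (chart_inv c x))))"

definition one_form ::
    "('p::topological_space, 'e::euclidean_space) chart set \<Rightarrow> ('p \<Rightarrow> 'e \<Rightarrow> real) \<Rightarrow> bool" where
  "one_form A \<eta> \<longleftrightarrow>
     (\<forall>p. linear (\<eta> p)) \<and>
     (\<forall>U X. open U \<longrightarrow> smooth_vector_field_on A U X \<longrightarrow> smooth_fun_on A U (\<lambda>p. \<eta> p (X p)))"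

definition endo_field ::
    "('p::topological_space, 'e::euclidean_space) chart set \<Rightarrow> ('p \<Rightarrow> 'e \<Rightarrow> 'e) \<Rightarrow> bool" where
  "endo_field A \<phi> \<longleftrightarrow>
     (\<forall>p. linear (\<phi> p)) \<and>
     (\<forall>U X. open U \<longrightarrow> smooth_vector_field_on A U X \<longrightarrow>
        smooth_vector_field_on A U (\<lambda>p. \<phi> p (X p)))"

section \<open>Semi-Riemannian metrics and the Levi-Civita connection\<close>

definition nondegenerate_form :: "('e::euclidean_space \<Rightarrow> 'e \<Rightarrow> real) \<Rightarrow> bool" where
  "nondegenerate_form b \<longleftrightarrow> (\<forall>v. (\<forall>w. b v w = 0) \<longrightarrow> v = 0)"

definition form_index :: "('e::euclidean_space \<Rightarrow> 'e \<Rightarrow> real) \<Rightarrow> nat" where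
  "form_index b = Max {dim V |V. subspace V \<and> (\<forall>v\<in>V. v \<noteq> 0 \<longrightarrow> b v v < 0)}"

definition semi_riemannian_metric ::
    "('p::topological_space, 'e::euclidean_space) chart set \<Rightarrow> ('p \<Rightarrow> 'e \<Rightarrow> 'e \<Rightarrow> real) \<Rightarrow> bool" where
  "semi_riemannian_metric A g \<longleftrightarrow>
     (\<forall>p. bilinear (g p) \<and> (\<forall>v w. g p v w = g p w v) \<and> nondegenerate_form (g p)) \<and>
     (\<exists>\<nu>. \<forall>p. form_index (g p) = \<nu>) \<and>
     (\<forall>U X Y. open U \<longrightarrow> smooth_vector_field_on A U X \<longrightarrow> smooth_vector_field_on A U Y \<longrightarrow>
        smooth_fun_on A U (\<lambda>p. g p (X p) (Y p)))"

text \<open>A connection \<open>\<nabla>\<close> is given by the covariant derivatives \<open>\<nabla> p v Y\<close> of vector fields \<open>Y\<close>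
  defined and smooth on some open neighbourhood of \<open>p\<close>, in the direction of a tangent vector
  \<open>v\<close> at \<open>p\<close>. The value depends only on the germ of \<open>Y\<close> at \<open>p\<close>; nothing is said about
  \<open>\<nabla> p v Y\<close> if \<open>Y\<close> is not smooth near \<open>p\<close>.\<close>

type_synonym ('p, 'e) connection = "'p \<Rightarrow> 'e \<Rightarrow> ('p \<Rightarrow> 'e) \<Rightarrow> 'e"

definition affine_connection ::
    "('p::topological_space, 'e::euclidean_space) chart set \<Rightarrow> ('p, 'e) connection \<Rightarrow> bool" where
  "affine_connection A nabla \<longleftrightarrow>
     (\<forall>U Y. open U \<longrightarrow> smooth_vector_field_on A U Y \<longrightarrow>
        (\<forall>p\<in>U. linear (\<lambda>v. nabla p v Y)) \<and>
        (\<forall>Z. smooth_vector_field_on A U Z \<longrightarrow>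
           (\<forall>p\<in>U. \<forall>v. nabla p v (\<lambda>q. Y q + Z q) = nabla p v Y + nabla p v Z)) \<and>
        (\<forall>f. smooth_fun_on A U f \<longrightarrow>
           (\<forall>p\<in>U. \<forall>v. nabla p v (\<lambda>q. f q *\<^sub>R Y q) =
              vderiv A p v f *\<^sub>R Y p + f p *\<^sub>R nabla p v Y)) \<and>
        (\<forall>Z. (\<forall>q\<in>U. Z q = Y q) \<longrightarrow> (\<forall>p\<in>U. \<forall>v. nabla p v Z = nabla p v Y)) \<and>
        (\<forall>X. smooth_vector_field_on A U X \<longrightarrow>
           smooth_vector_field_on A U (\<lambda>p. nabla p (X p) Y)))"

text \<open>\<open>\<nabla>\<^sub>X Y - \<nabla>\<^sub>Y X = [X, Y]\<close>, where the Lie bracket is the commutator of \<open>X\<close> and \<open>Y\<close> acting as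
  derivations on functions.\<close>

definition torsion_free ::
    "('p::topological_space, 'e::euclidean_space) chart set \<Rightarrow> ('p, 'e) connection \<Rightarrow> bool" where
  "torsion_free A nabla \<longleftrightarrow>
     (\<forall>U X Y f. open U \<longrightarrow> smooth_vector_field_on A U X \<longrightarrow> smooth_vector_field_on A U Y \<longrightarrow>
        smooth_fun_on A U f \<longrightarrow>
        (\<forall>p\<in>U. vderiv A p (nabla p (X p) Y - nabla p (Y p) X) f =
           vderiv A p (X p) (\<lambda>q. vderiv A q (Y q) f) - vderiv A p (Y p) (\<lambda>q. vderiv A q (X q) f)))"

definition metric_connection ::
    "('p::topological_space, 'e::euclidean_space) chart set \<Rightarrow> ('p \<Rightarrow> 'e \<Rightarrow> 'e \<Rightarrow> real) \<Rightarrow>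
     ('p, 'e) connection \<Rightarrow> bool" where
  "metric_connection A g nabla \<longleftrightarrow>
     (\<forall>U Y Z. open U \<longrightarrow> smooth_vector_field_on A U Y \<longrightarrow> smooth_vector_field_on A U Z \<longrightarrow>
        (\<forall>p\<in>U. \<forall>v. vderiv A p v (\<lambda>q. g q (Y q) (Z q)) =
           g p (nabla p v Y) (Z p) + g p (Y p) (nabla p v Z)))"

text \<open>By the fundamental theorem of semi-Riemannian geometry there is such a connection, and its
  values \<open>\<nabla> p v Y\<close> for \<open>Y\<close> smooth near \<open>p\<close> are unique.\<close>

definition levi_civita ::
    "('p::topological_space, 'e::euclidean_space) chart set \<Rightarrow> ('p \<Rightarrow> 'e \<Rightarrow> 'e \<Rightarrow> real) \<Rightarrow>
     ('p, 'e) connection \<Rightarrow> bool" where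
  "levi_civita A g nabla \<longleftrightarrow>
     affine_connection A nabla \<and> torsion_free A nabla \<and> metric_connection A g nabla"

definition cov_deriv_endo ::
    "('p, 'e::euclidean_space) connection \<Rightarrow> ('p \<Rightarrow> 'e \<Rightarrow> 'e) \<Rightarrow> 'p \<Rightarrow> 'e \<Rightarrow> ('p \<Rightarrow> 'e) \<Rightarrow> 'e" where
  "cov_deriv_endo nabla \<phi> p v Y = nabla p v (\<lambda>q. \<phi> q (Y q)) - \<phi> p (nabla p v Y)"

definition parallel_endo ::
    "('p::topological_space, 'e::euclidean_space) chart set \<Rightarrow> ('p, 'e) connection \<Rightarrow>
     ('p \<Rightarrow> 'e \<Rightarrow> 'e) \<Rightarrow> bool" where
  "parallel_endo A nabla \<phi> \<longleftrightarrow>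
     (\<forall>U Y. open U \<longrightarrow> smooth_vector_field_on A U Y \<longrightarrow>
        (\<forall>p\<in>U. \<forall>v. cov_deriv_endo nabla \<phi> p v Y = 0))"

section \<open>Mixed 3-structures\<close>

text \<open>The families \<open>\<phi>\<close>, \<open>\<xi>\<close>, \<open>\<eta>\<close>, \<open>J\<close> are indexed by natural numbers; only the indices
  \<open>1, 2, 3\<close> matter.\<close>

definition tau :: "nat \<Rightarrow> real" where
  "tau \<alpha> = (if \<alpha> = 3 then 1 else - 1)"

definition even_triples :: "(nat \<times> nat \<times> nat) set" where
  "even_triples = {(1, 2, 3), (2, 3, 1), (3, 1, 2)}"

definition mixed_3_structure ::
    "('p::topological_space, 'e::euclidean_space) chart set \<Rightarrow> (nat \<Rightarrow> 'p \<Rightarrow> 'e \<Rightarrow> 'e) \<Rightarrow>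
     (nat \<Rightarrow> 'p \<Rightarrow> 'e) \<Rightarrow> (nat \<Rightarrow> 'p \<Rightarrow> 'e \<Rightarrow> real) \<Rightarrow> bool" where
  "mixed_3_structure A \<phi> \<xi> \<eta> \<longleftrightarrow>
     (\<forall>\<alpha>\<in>{1, 2, 3}.
        endo_field A (\<phi> \<alpha>) \<and> smooth_vector_field_on A UNIV (\<xi> \<alpha>) \<and> one_form A (\<eta> \<alpha>) \<and>
        (\<forall>p v. \<phi> \<alpha> p (\<phi> \<alpha> p v) = tau \<alpha> *\<^sub>R (- v + \<eta> \<alpha> p v *\<^sub>R \<xi> \<alpha> p)) \<and>
        (\<forall>p. \<eta> \<alpha> p (\<xi> \<alpha> p) = 1)) \<and>
     (\<forall>(\<alpha>, \<beta>, \<gamma>)\<in>even_triples. \<forall>p.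
        \<eta> \<alpha> p (\<xi> \<beta> p) = 0 \<and> \<eta> \<beta> p (\<xi> \<alpha> p) = 0 \<and>
        \<phi> \<alpha> p (\<xi> \<beta> p) = tau \<beta> *\<^sub>R \<xi> \<gamma> p \<and>
        \<phi> \<beta> p (\<xi> \<alpha> p) = - tau \<alpha> *\<^sub>R \<xi> \<gamma> p \<and>
        (\<forall>v. \<eta> \<alpha> p (\<phi> \<beta> p v) = tau \<gamma> * \<eta> \<gamma> p v \<and>
             - \<eta> \<beta> p (\<phi> \<alpha> p v) = tau \<gamma> * \<eta> \<gamma> p v \<and>
             \<phi> \<alpha> p (\<phi> \<beta> p v) - (tau \<alpha> * \<eta> \<beta> p v) *\<^sub>R \<xi> \<alpha> p = tau \<gamma> *\<^sub>R \<phi> \<gamma> p v \<and>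
             - \<phi> \<beta> p (\<phi> \<alpha> p v) + (tau \<beta> * \<eta> \<alpha> p v) *\<^sub>R \<xi> \<beta> p = tau \<gamma> *\<^sub>R \<phi> \<gamma> p v))"

definition metric_mixed_3_structure ::
    "('p::topological_space, 'e::euclidean_space) chart set \<Rightarrow> (nat \<Rightarrow> 'p \<Rightarrow> 'e \<Rightarrow> 'e) \<Rightarrow>
     (nat \<Rightarrow> 'p \<Rightarrow> 'e) \<Rightarrow> (nat \<Rightarrow> 'p \<Rightarrow> 'e \<Rightarrow> real) \<Rightarrow> ('p \<Rightarrow> 'e \<Rightarrow> 'e \<Rightarrow> real) \<Rightarrow> bool" where
  "metric_mixed_3_structure A \<phi> \<xi> \<eta> g \<longleftrightarrow>
     mixed_3_structure A \<phi> \<xi> \<eta> \<and> semi_riemannian_metric A g \<and>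
     (\<forall>\<alpha>\<in>{1, 2, 3}. \<forall>p.
        g p (\<xi> \<alpha> p) (\<xi> \<alpha> p) \<in> {1, - 1} \<and>
        (\<forall>v w. g p (\<phi> \<alpha> p v) (\<phi> \<alpha> p w) =
           tau \<alpha> * (g p v w - g p (\<xi> \<alpha> p) (\<xi> \<alpha> p) * \<eta> \<alpha> p v * \<eta> \<alpha> p w)))"

definition mixed_3_cosymplectic ::
    "('p::topological_space, 'e::euclidean_space) chart set \<Rightarrow> (nat \<Rightarrow> 'p \<Rightarrow> 'e \<Rightarrow> 'e) \<Rightarrow>
     (nat \<Rightarrow> 'p \<Rightarrow> 'e) \<Rightarrow> (nat \<Rightarrow> 'p \<Rightarrow> 'e \<Rightarrow> real) \<Rightarrow> ('p \<Rightarrow> 'e \<Rightarrow> 'e \<Rightarrow> real) \<Rightarrow>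
     ('p, 'e) connection \<Rightarrow> bool" where
  "mixed_3_cosymplectic A \<phi> \<xi> \<eta> g nabla \<longleftrightarrow>
     metric_mixed_3_structure A \<phi> \<xi> \<eta> g \<and> levi_civita A g nabla \<and>
     (\<forall>\<alpha>\<in>{1, 2, 3}. parallel_endo A nabla (\<phi> \<alpha>))"

section \<open>Para-hyper-Kaehler manifolds\<close>

definition almost_para_hypercomplex ::
    "('p::topological_space, 'e::euclidean_space) chart set \<Rightarrow> (nat \<Rightarrow> 'p \<Rightarrow> 'e \<Rightarrow> 'e) \<Rightarrow> bool" where
  "almost_para_hypercomplex A J \<longleftrightarrow>
     (\<forall>\<alpha>\<in>{1, 2, 3}. endo_field A (J \<alpha>)) \<and>
     (\<forall>\<alpha>\<in>{1, 2}. (\<forall>p v. J \<alpha> p (J \<alpha> p v) = v) \<and> J \<alpha> \<noteq> (\<lambda>p v. v) \<and> J \<alpha> \<noteq> (\<lambda>p v. - v)) \<and>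
     (\<forall>p v. J 3 p (J 3 p v) = - v) \<and>
     (\<forall>p v. J 1 p (J 2 p v) = J 3 p v \<and> - J 2 p (J 1 p v) = J 3 p v)"

definition almost_para_hyperhermitian ::
    "('p::topological_space, 'e::euclidean_space) chart set \<Rightarrow> ('p \<Rightarrow> 'e \<Rightarrow> 'e \<Rightarrow> real) \<Rightarrow>
     (nat \<Rightarrow> 'p \<Rightarrow> 'e \<Rightarrow> 'e) \<Rightarrow> bool" where
  "almost_para_hyperhermitian A g J \<longleftrightarrow>
     almost_para_hypercomplex A J \<and> semi_riemannian_metric A g \<and>
     (\<forall>p v w. g p (J 1 p v) (J 1 p w) = - g p v w \<and>
              g p (J 2 p v) (J 2 p w) = - g p v w \<and>
              - g p (J 3 p v) (J 3 p w) = - g p v w)"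

definition para_hyper_kaehler ::
    "('p::topological_space, 'e::euclidean_space) chart set \<Rightarrow> ('p \<Rightarrow> 'e \<Rightarrow> 'e \<Rightarrow> real) \<Rightarrow>
     (nat \<Rightarrow> 'p \<Rightarrow> 'e \<Rightarrow> 'e) \<Rightarrow> bool" where
  "para_hyper_kaehler A g J \<longleftrightarrow>
     almost_para_hyperhermitian A g J \<and>
     (\<exists>nabla. levi_civita A g nabla \<and> (\<forall>\<alpha>\<in>{1, 2, 3}. parallel_endo A nabla (J \<alpha>)))"

section \<open>Immersed submanifolds\<close>

definition smooth_map ::
    "('p::topological_space, 'm::euclidean_space) chart set \<Rightarrow>
     ('q::topological_space, 'n::euclidean_space) chart set \<Rightarrow> ('p \<Rightarrow> 'q) \<Rightarrow> bool" where
  "smooth_map A B f \<longleftrightarrow>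
     continuous_on UNIV f \<and>
     (\<forall>c\<in>A. \<forall>d\<in>B. smooth_on (snd c ` (fst c \<inter> f -` fst d)) (snd d \<circ> f \<circ> chart_inv c))"

definition tangent_map ::
    "('p, 'm::euclidean_space) chart set \<Rightarrow> ('q, 'n::euclidean_space) chart set \<Rightarrow>
     ('p \<Rightarrow> 'q) \<Rightarrow> 'p \<Rightarrow> 'm \<Rightarrow> 'n" where
  "tangent_map A B f p =
     frechet_derivative (snd (chart_at B (f p)) \<circ> f \<circ> chart_inv (chart_at A p))
       (at (snd (chart_at A p) p))"

definition immersion ::
    "('p::topological_space, 'm::euclidean_space) chart set \<Rightarrow>
     ('q::topological_space, 'n::euclidean_space) chart set \<Rightarrow> ('p \<Rightarrow> 'q) \<Rightarrow> bool" where
  "immersion A B f \<longleftrightarrow> smooth_map A B f \<and> (\<forall>p. inj (tangent_map A B f p))"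

definition induced_metric ::
    "('p, 'm::euclidean_space) chart set \<Rightarrow> ('q, 'n::euclidean_space) chart set \<Rightarrow>
     ('p \<Rightarrow> 'q) \<Rightarrow> ('q \<Rightarrow> 'n \<Rightarrow> 'n \<Rightarrow> real) \<Rightarrow> 'p \<Rightarrow> 'm \<Rightarrow> 'm \<Rightarrow> real" where
  "induced_metric A B f g p v w = g (f p) (tangent_map A B f p v) (tangent_map A B f p w)"

definition nondegenerate_submanifold ::
    "('p::topological_space, 'm::euclidean_space) chart set \<Rightarrow>
     ('q::topological_space, 'n::euclidean_space) chart set \<Rightarrow>
     ('p \<Rightarrow> 'q) \<Rightarrow> ('q \<Rightarrow> 'n \<Rightarrow> 'n \<Rightarrow> real) \<Rightarrow> bool" where
  "nondegenerate_submanifold A B f g \<longleftrightarrow>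
     immersion A B f \<and> (\<forall>p. nondegenerate_form (induced_metric A B f g p))"

text \<open>The tangent space of the submanifold at \<open>p\<close>, as a subspace of the ambient tangent space.\<close>

definition tangent_image ::
    "('p, 'm::euclidean_space) chart set \<Rightarrow> ('q, 'n::euclidean_space) chart set \<Rightarrow>
     ('p \<Rightarrow> 'q) \<Rightarrow> 'p \<Rightarrow> 'n set" where
  "tangent_image A B f p = range (tangent_map A B f p)"

definition normal_space ::
    "('p, 'm::euclidean_space) chart set \<Rightarrow> ('q, 'n::euclidean_space) chart set \<Rightarrow>
     ('p \<Rightarrow> 'q) \<Rightarrow> ('q \<Rightarrow> 'n \<Rightarrow> 'n \<Rightarrow> real) \<Rightarrow> 'p \<Rightarrow> 'n set" where
  "normal_space A B f g p = {w. \<forall>t\<in>tangent_image A B f p. g (f p) w t = 0}"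

definition invariant_submanifold ::
    "('p, 'm::euclidean_space) chart set \<Rightarrow> ('q, 'n::euclidean_space) chart set \<Rightarrow>
     ('p \<Rightarrow> 'q) \<Rightarrow> (nat \<Rightarrow> 'q \<Rightarrow> 'n \<Rightarrow> 'n) \<Rightarrow> bool" where
  "invariant_submanifold A B f \<phi> \<longleftrightarrow>
     (\<forall>\<alpha>\<in>{1, 2, 3}. \<forall>p. \<phi> \<alpha> (f p) ` tangent_image A B f p \<subseteq> tangent_image A B f p)"

definition structure_fields_normal ::
    "('p, 'm::euclidean_space) chart set \<Rightarrow> ('q, 'n::euclidean_space) chart set \<Rightarrow>
     ('p \<Rightarrow> 'q) \<Rightarrow> (nat \<Rightarrow> 'q \<Rightarrow> 'n) \<Rightarrow> ('q \<Rightarrow> 'n \<Rightarrow> 'n \<Rightarrow> real) \<Rightarrow> bool" where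
  "structure_fields_normal A B f \<xi> g \<longleftrightarrow>
     (\<forall>\<alpha>\<in>{1, 2, 3}. \<forall>p. \<xi> \<alpha> (f p) \<in> normal_space A B f g p)"

text \<open>The restriction of an endomorphism field to the submanifold, transported to the tangent
  spaces of the submanifold along the injective tangent map.\<close>

definition restrict_endo ::
    "('p, 'm::euclidean_space) chart set \<Rightarrow> ('q, 'n::euclidean_space) chart set \<Rightarrow>
     ('p \<Rightarrow> 'q) \<Rightarrow> ('q \<Rightarrow> 'n \<Rightarrow> 'n) \<Rightarrow> 'p \<Rightarrow> 'm \<Rightarrow> 'm" where
  "restrict_endo A B f \<phi> p v = inv (tangent_map A B f p) (\<phi> (f p) (tangent_map A B f p v))"

definition normal_part ::
    "('p, 'm::euclidean_space) chart set \<Rightarrow> ('q, 'n::euclidean_space) chart set \<Rightarrow>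
     ('p \<Rightarrow> 'q) \<Rightarrow> ('q \<Rightarrow> 'n \<Rightarrow> 'n \<Rightarrow> real) \<Rightarrow> 'p \<Rightarrow> 'n \<Rightarrow> 'n" where
  "normal_part A B f g p w =
     (THE n. n \<in> normal_space A B f g p \<and> w - n \<in> tangent_image A B f p)"

text \<open>The second fundamental form \<open>h(v, Y)\<close> at \<open>p\<close> is the normal part of the ambient covariant
  derivative of a local extension \<open>Y'\<close> of the vector field \<open>Y\<close>. Local extensions exist near every
  point, as an immersion is locally an embedding, and \<open>h(v, Y)\<close> does not depend on the choice.\<close>

definition local_extension ::
    "('p::topological_space, 'm::euclidean_space) chart set \<Rightarrow>
     ('q::topological_space, 'n::euclidean_space) chart set \<Rightarrow>
     ('p \<Rightarrow> 'q) \<Rightarrow> 'p \<Rightarrow> ('p \<Rightarrow> 'm) \<Rightarrow> ('q \<Rightarrow> 'n) \<Rightarrow> bool" where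
  "local_extension A B f p Y Y' \<longleftrightarrow>
     (\<exists>U W. open U \<and> p \<in> U \<and> open W \<and> f ` U \<subseteq> W \<and>
        smooth_vector_field_on A U Y \<and> smooth_vector_field_on B W Y' \<and>
        (\<forall>q\<in>U. Y' (f q) = tangent_map A B f q (Y q)))"

definition second_fundamental_form ::
    "('p, 'm::euclidean_space) chart set \<Rightarrow> ('q, 'n::euclidean_space) chart set \<Rightarrow>
     ('p \<Rightarrow> 'q) \<Rightarrow> ('q \<Rightarrow> 'n \<Rightarrow> 'n \<Rightarrow> real) \<Rightarrow> ('q, 'n) connection \<Rightarrow>
     'p \<Rightarrow> 'm \<Rightarrow> ('q \<Rightarrow> 'n) \<Rightarrow> 'n" where
  "second_fundamental_form A B f g nabla p v Y' =
     normal_part A B f g p (nabla (f p) (tangent_map A B f p v) Y')"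

definition totally_geodesic ::
    "('p::topological_space, 'm::euclidean_space) chart set \<Rightarrow>
     ('q::topological_space, 'n::euclidean_space) chart set \<Rightarrow>
     ('p \<Rightarrow> 'q) \<Rightarrow> ('q \<Rightarrow> 'n \<Rightarrow> 'n \<Rightarrow> real) \<Rightarrow> ('q, 'n) connection \<Rightarrow> bool" where
  "totally_geodesic A B f g nabla \<longleftrightarrow>
     (\<forall>p v Y Y'. local_extension A B f p Y Y' \<longrightarrow>
        second_fundamental_form A B f g nabla p v Y' = 0)"

end

theory Submission
  imports Defs
begin

text \<open>Vector fields along the immersion \<open>f\<close> are differentiated by the pullback of the ambient Levi-Civita
  connection. Its part \<open>B(X, Y) = \<nabla>\<^sub>X (df Y)\<close> transversal to \<open>M\<close> is symmetric because \<open>\<nabla>\<close> is torsion free,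
  and \<open>B(X, J\<^sub>\<alpha> Y) = \<phi>\<^sub>\<alpha> B(X, Y)\<close> because \<open>\<phi>\<^sub>\<alpha>\<close> is parallel. Hence \<open>\<phi>\<^sub>1\<close> and \<open>\<phi>\<^sub>2\<close> commute on \<open>B(X, Y)\<close>.
  As \<open>\<eta>\<^sub>\<alpha>\<close> vanishes on \<open>B(X, Y)\<close>, they also anticommute there with product \<open>\<phi>\<^sub>3\<close>, which is invertible on
  the kernel of \<open>\<eta>\<^sub>3\<close>; so \<open>B(X, Y) = 0\<close>. Then the pullback connection restricts to the Levi-Civita
  connection of \<open>M\<close>, and the \<open>J\<^sub>\<alpha>\<close> are parallel for it. The induced metric has constant index \<open>dim M / 2\<close>
  since \<open>J\<^sub>1\<close> is an anti-isometry.\<close>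

section \<open>Smooth functions on open sets\<close>

text \<open>The fields \<open>Y\<close> live on \<open>M\<close> only, while \<open>nabla\<close>
  accepts fields on open sets of the ambient manifold. So \<open>cov\<close> expands a field along
  \<open>f\<close> in an ambient coordinate frame and applies the Leibniz rule; that any other
  expansion gives the same result is \<open>cov_combination\<close>. The vanishing of
  \<open>B\<close> is shown modulo \<open>range (df p)\<close>, which each
  \<open>\<phi> \<alpha>\<close> preserves, so an orthogonal splitting enters only when the second
  fundamental form is evaluated. That \<open>\<eta> \<alpha>\<close> vanishes on \<open>B\<close>
  follows by computing \<open>\<phi> \<alpha>\<close> applied twice in two ways, in
  \<open>eta_cov\<close>. Two obstacles shape the rest. Tangent vectors are coded by preferred
  charts that jump from point to point, so they are handled as derivations of coordinate functions.
  And \<open>J\<close> and the induced connection arise by inverting \<open>df\<close> pointwise, so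
  their smoothness rests on a regularity result for linear systems with smooth, injective
  coefficients.\<close>

lemma frechet_derivative_eq:
  "(f has_derivative f') (at x) \<Longrightarrow> frechet_derivative f (at x) = f'"
  using frechet_derivative_at by metis

text \<open>Openness turns agreement on \<open>S\<close> into agreement near each point of
  \<open>S\<close>, so the derivatives agree as well.\<close>

lemma Ck_on_cong_imp:
  assumes "open S" "\<And>x. x \<in> S \<Longrightarrow> f x = g x" "Ck_on k S f"
  shows "Ck_on k S g"
  using assms(2,3)
proof (induction k arbitrary: f g)
  case 0
  then show ?case by (metis Ck_on.simps(1) continuous_on_cong)
next
  case (Suc k)
  have d: "(g has_derivative frechet_derivative f (at x)) (at x)" if "x \<in> S" for x
    using Suc.prems that assms(1)
    by (intro has_derivative_transform_within_open[of f "frechet_derivative f (at x)" x UNIV S g])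
      (auto simp: frechet_derivative_works[symmetric])
  have "Ck_on k S (\<lambda>x. frechet_derivative g (at x) v)" for v
    using Suc.prems(2) by (intro Suc.IH[of "\<lambda>x. frechet_derivative f (at x) v" "\<lambda>x. frechet_derivative g (at x) v"])
      (auto simp: frechet_derivative_eq[OF d])
  with d show ?case using Ck_on.simps(2)[of k S g] differentiableI by blast
qed

lemma Ck_on_cong:
  assumes "open S" "\<And>x. x \<in> S \<Longrightarrow> f x = g x"
  shows "Ck_on k S f \<longleftrightarrow> Ck_on k S g"
  using Ck_on_cong_imp[of S f g k] Ck_on_cong_imp[of S g f k] assms by auto

text \<open>Lets a derivative produced by differentiation rules stand in for
  \<open>frechet_derivative\<close>, in terms of which \<open>Ck_on\<close> is phrased.\<close>

lemma Ck_on_SucI: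
  assumes "open S" "\<And>x. x \<in> S \<Longrightarrow> (f has_derivative f' x) (at x)"
    and "\<And>v. Ck_on k S (\<lambda>x. f' x v)"
  shows "Ck_on (Suc k) S f"
proof -
  have "Ck_on k S (\<lambda>x. frechet_derivative f (at x) v)" for v
    by (rule Ck_on_cong_imp[OF assms(1) _ assms(3)[of v]])
      (simp add: frechet_derivative_eq[OF assms(2)])
  with assms(2) show ?thesis using Ck_on.simps(2)[of k S f] differentiableI by blast
qed

lemma Ck_on_SucD: "Ck_on (Suc k) S f \<Longrightarrow> Ck_on k S f"
proof (induction k arbitrary: f)
  case 0
  then have "\<forall>x\<in>S. f differentiable (at x)" using Ck_on.simps(2)[of 0 S f] by blast
  then have "continuous_on S f"
    by (intro continuous_at_imp_continuous_on ballI differentiable_imp_continuous_within) blast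
  then show ?case by simp
next
  case (Suc k)
  then have "\<forall>v. Ck_on (Suc k) S (\<lambda>x. frechet_derivative f (at x) v)" "\<forall>x\<in>S. f differentiable (at x)"
    using Ck_on.simps(2)[of "Suc k" S f] by blast+
  then show ?case using Suc.IH Ck_on.simps(2)[of k S f] by blast
qed

lemma Ck_on_subset: "Ck_on k S f \<Longrightarrow> T \<subseteq> S \<Longrightarrow> Ck_on k T f"
  by (induction k arbitrary: f) (auto intro: continuous_on_subset)

lemma Ck_on_local:
  assumes "\<And>x. x \<in> S \<Longrightarrow> \<exists>T. open T \<and> x \<in> T \<and> Ck_on k T f"
  shows "Ck_on k S f"
  using assms
proof (induction k arbitrary: f)
  case 0
  then show ?case
    by (metis Ck_on.simps(1) continuous_at_imp_continuous_on continuous_on_eq_continuous_at)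
next
  case (Suc k)
  then have "\<forall>x\<in>S. f differentiable (at x)" by fastforce
  moreover have "Ck_on k S (\<lambda>x. frechet_derivative f (at x) v)" for v
    using Suc.prems by (intro Suc.IH) fastforce
  ultimately show ?case by simp
qed

lemma Ck_on_const: "Ck_on k S (\<lambda>x. c)"
  by (induction k arbitrary: c) auto

lemma Ck_on_add:
  assumes "open S" "Ck_on k S f" "Ck_on k S g"
  shows "Ck_on k S (\<lambda>x. f x + g x)"
  using assms(2,3)
proof (induction k arbitrary: f g)
  case 0
  then show ?case by (auto intro: continuous_on_add)
next
  case (Suc k)
  have d: "((\<lambda>x. f x + g x) has_derivative
      (\<lambda>v. frechet_derivative f (at x) v + frechet_derivative g (at x) v)) (at x)" if "x \<in> S" for x
    using Suc.prems that by (auto intro!: has_derivative_add simp: frechet_derivative_works[symmetric])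
  show ?case
    using Suc.prems
    by (intro Ck_on_SucI[OF assms(1) d] Suc.IH) auto
qed

text \<open>The product rule leaves one undifferentiated factor in each term, so \<open>f\<close>
  and \<open>g\<close> are first lowered to class \<open>k\<close>. A general bounded bilinear
  product covers multiplication and scaling at once.\<close>

lemma Ck_on_bilinear:
  assumes "bounded_bilinear pr" "open S" "Ck_on k S f" "Ck_on k S g"
  shows "Ck_on k S (\<lambda>x. pr (f x) (g x))"
  using assms(3,4)
proof (induction k arbitrary: f g)
  case 0
  then show ?case using bounded_bilinear.continuous_on[OF assms(1)] by auto
next
  case (Suc k)
  have d: "((\<lambda>x. pr (f x) (g x)) has_derivative
      (\<lambda>v. pr (f x) (frechet_derivative g (at x) v) + pr (frechet_derivative f (at x) v) (g x))) (at x)"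
    if "x \<in> S" for x
    using Suc.prems that
    by (auto intro!: bounded_bilinear.FDERIV[OF assms(1)] simp: frechet_derivative_works[symmetric])
  have "Ck_on k S f" "Ck_on k S g" using Suc.prems Ck_on_SucD by auto
  then show ?case
    using Suc.prems
    by (intro Ck_on_SucI[OF assms(2) d] Ck_on_add assms(2) Suc.IH) auto
qed

lemma Ck_on_linear:
  assumes "bounded_linear L" "open S" "Ck_on k S f"
  shows "Ck_on k S (\<lambda>x. L (f x))"
  using assms(3)
proof (induction k arbitrary: f)
  case 0
  then show ?case using bounded_linear.continuous_on[OF assms(1)] by auto
next
  case (Suc k)
  have d: "((\<lambda>x. L (f x)) has_derivative (\<lambda>v. L (frechet_derivative f (at x) v))) (at x)"
    if "x \<in> S" for x
    using Suc.prems that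
    by (auto intro!: bounded_linear.has_derivative[OF assms(1)] simp: frechet_derivative_works[symmetric])
  show ?case
    using Suc.prems
    by (intro Ck_on_SucI[OF assms(2) d] Suc.IH) auto
qed

lemma Ck_on_sum:
  assumes "open S" "\<And>i. i \<in> I \<Longrightarrow> Ck_on k S (f i)"
  shows "Ck_on k S (\<lambda>x. \<Sum>i\<in>I. f i x)"
  using assms(2)
proof (induction I rule: infinite_finite_induct)
  case (insert i I)
  then show ?case by (auto intro!: Ck_on_add assms(1))
qed (auto simp: Ck_on_const)

text \<open>\<open>Ck_on\<close> controls derivatives in fixed directions only. This expansion turns
  a derivative in a varying direction into a finite sum of fixed-direction derivatives with scalar
  coefficients.\<close>

lemma linear_basis_expand:
  fixes L :: "'a::euclidean_space \<Rightarrow> 'b::real_vector"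
  assumes "linear L"
  shows "L w = (\<Sum>i\<in>Basis. (w \<bullet> i) *\<^sub>R L i)"
proof -
  have "L w = L (\<Sum>i\<in>Basis. (w \<bullet> i) *\<^sub>R i)" by (simp add: euclidean_representation)
  then show ?thesis by (simp add: linear_sum[OF assms] linear_scale[OF assms])
qed

lemma frechet_derivative_basis_expand:
  fixes w :: "'a::euclidean_space"
  assumes "f differentiable (at x)"
  shows "frechet_derivative f (at x) w = (\<Sum>i\<in>Basis. (w \<bullet> i) *\<^sub>R frechet_derivative f (at x) i)"
  using assms frechet_derivative_works has_derivative_linear by (intro linear_basis_expand) blast

text \<open>The chain rule evaluates the derivative of \<open>g\<close> in a direction that moves
  with \<open>x\<close>. Expanded in the basis it becomes a sum of products to which the induction
  hypothesis applies with a partial derivative of \<open>g\<close> in place of \<open>g\<close>;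
  hence \<open>g\<close> is arbitrary in the induction.\<close>

lemma Ck_on_compose:
  fixes f :: "'a::euclidean_space \<Rightarrow> 'b::euclidean_space"
  assumes "open S" "open T" "f ` S \<subseteq> T" "Ck_on k S f" "Ck_on k T g"
  shows "Ck_on k S (\<lambda>x. g (f x))"
  using assms(4,5)
proof (induction k arbitrary: g)
  case 0
  then show ?case using assms(3) by (auto intro!: continuous_on_compose2[of T g S f])
next
  case (Suc k)
  have d: "((\<lambda>x. g (f x)) has_derivative
      (\<lambda>v. frechet_derivative g (at (f x)) (frechet_derivative f (at x) v))) (at x)"
    if "x \<in> S" for x
    using Suc.prems that assms(3)
    by (intro has_derivative_compose[of f _ x UNIV g]) (auto simp: frechet_derivative_works[symmetric])
  have e: "frechet_derivative g (at (f x)) (frechet_derivative f (at x) v) =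
      (\<Sum>i\<in>Basis. (frechet_derivative f (at x) v \<bullet> i) *\<^sub>R frechet_derivative g (at (f x)) i)"
    if "x \<in> S" for x v
    using that Suc.prems assms(3) by (intro frechet_derivative_basis_expand) auto
  have fk: "Ck_on k S f" using Suc.prems(1) by (rule Ck_on_SucD)
  have "Ck_on k S (\<lambda>x. \<Sum>i\<in>Basis. (frechet_derivative f (at x) v \<bullet> i) *\<^sub>R
          frechet_derivative g (at (f x)) i)" for v
    using Suc.prems fk
    by (intro Ck_on_sum assms(1) Ck_on_bilinear[OF bounded_bilinear_scaleR]
        Ck_on_linear[OF bounded_linear_inner_left] Suc.IH) auto
  then have "Ck_on k S (\<lambda>x. frechet_derivative g (at (f x)) (frechet_derivative f (at x) v))" for v
    by (rule Ck_on_cong_imp[OF assms(1), rotated]) (simp add: e)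
  then show ?case
    by (intro Ck_on_SucI[OF assms(1) d])
qed

section \<open>Closure properties of smooth functions\<close>

lemma smooth_on_cong_imp:
  "open S \<Longrightarrow> (\<And>x. x \<in> S \<Longrightarrow> f x = g x) \<Longrightarrow> smooth_on S f \<Longrightarrow> smooth_on S g"
  unfolding smooth_on_def using Ck_on_cong_imp by blast

lemma smooth_on_subset: "smooth_on S f \<Longrightarrow> T \<subseteq> S \<Longrightarrow> smooth_on T f"
  unfolding smooth_on_def using Ck_on_subset by blast

lemma smooth_on_local:
  "(\<And>x. x \<in> S \<Longrightarrow> \<exists>T. open T \<and> x \<in> T \<and> smooth_on T f) \<Longrightarrow> smooth_on S f"
  unfolding smooth_on_def by (intro allI Ck_on_local) blast

lemma smooth_on_const: "smooth_on S (\<lambda>x. c)"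
  by (simp add: smooth_on_def Ck_on_const)

lemma smooth_on_add:
  "open S \<Longrightarrow> smooth_on S f \<Longrightarrow> smooth_on S g \<Longrightarrow> smooth_on S (\<lambda>x. f x + g x)"
  by (simp add: smooth_on_def Ck_on_add)

lemma smooth_on_bilinear:
  "bounded_bilinear pr \<Longrightarrow> open S \<Longrightarrow> smooth_on S f \<Longrightarrow> smooth_on S g \<Longrightarrow>
    smooth_on S (\<lambda>x. pr (f x) (g x))"
  by (simp add: smooth_on_def Ck_on_bilinear)

lemmas smooth_on_mult = smooth_on_bilinear[OF bounded_bilinear_mult]

lemma smooth_on_linear:
  "bounded_linear L \<Longrightarrow> open S \<Longrightarrow> smooth_on S f \<Longrightarrow> smooth_on S (\<lambda>x. L (f x))"
  by (simp add: smooth_on_def Ck_on_linear)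

lemma smooth_on_sum:
  "open S \<Longrightarrow> (\<And>i. i \<in> I \<Longrightarrow> smooth_on S (f i)) \<Longrightarrow> smooth_on S (\<lambda>x. \<Sum>i\<in>I. f i x)"
  by (simp add: smooth_on_def Ck_on_sum)

lemma smooth_on_compose:
  fixes f :: "'a::euclidean_space \<Rightarrow> 'b::euclidean_space"
  shows "open S \<Longrightarrow> open T \<Longrightarrow> f ` S \<subseteq> T \<Longrightarrow> smooth_on S f \<Longrightarrow> smooth_on T g \<Longrightarrow>
    smooth_on S (\<lambda>x. g (f x))"
  by (simp add: smooth_on_def Ck_on_compose)

lemma smooth_on_differentiable: "smooth_on S f \<Longrightarrow> x \<in> S \<Longrightarrow> f differentiable (at x)"
  unfolding smooth_on_def using Ck_on.simps(2)[of 0 S f] by blast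

lemma smooth_on_has_derivative:
  "smooth_on S f \<Longrightarrow> x \<in> S \<Longrightarrow> (f has_derivative frechet_derivative f (at x)) (at x)"
  using smooth_on_differentiable frechet_derivative_works by blast

lemma smooth_on_frechet_derivative:
  "smooth_on S f \<Longrightarrow> smooth_on S (\<lambda>x. frechet_derivative f (at x) v)"
  unfolding smooth_on_def using Ck_on.simps(2)[of _ S f] by blast

lemma smooth_on_componentwise:
  fixes f :: "'a::euclidean_space \<Rightarrow> 'b::euclidean_space"
  assumes "open S"
  shows "smooth_on S f \<longleftrightarrow> (\<forall>i\<in>Basis. smooth_on S (\<lambda>x. f x \<bullet> i))"
proof
  assume "\<forall>i\<in>Basis. smooth_on S (\<lambda>x. f x \<bullet> i)"
  then have "smooth_on S (\<lambda>x. \<Sum>i\<in>Basis. (f x \<bullet> i) *\<^sub>R i)"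
    by (intro smooth_on_sum assms smooth_on_bilinear[OF bounded_bilinear_scaleR] smooth_on_const) auto
  then show "smooth_on S f" by (simp add: euclidean_representation)
qed (auto intro!: smooth_on_linear[OF bounded_linear_inner_left] assms)

text \<open>The second difference of \<open>f\<close> over a small parallelogram with sides along
  \<open>u\<close> and \<open>v\<close> is symmetric in \<open>u\<close> and \<open>v\<close>. Two
  uses of the mean value theorem make it \<open>h * h\<close> times a mixed derivative at a point of
  the parallelogram, in either order, and the mixed derivatives are continuous at
  \<open>x\<close>.\<close>

lemma symmetric_second_derivative:
  fixes f :: "'a::euclidean_space \<Rightarrow> real"
  assumes "open S" "x \<in> S" "smooth_on S f"
  shows "frechet_derivative (\<lambda>y. frechet_derivative f (at y) u) (at x) v =
         frechet_derivative (\<lambda>y. frechet_derivative f (at y) v) (at x) u"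
proof -
  let ?D = "\<lambda>g w y. frechet_derivative g (at y) w"
  have mvt: "\<exists>s t. 0 < s \<and> s < h \<and> 0 < t \<and> t < h \<and>
      f (x + h *\<^sub>R u + h *\<^sub>R v) - f (x + h *\<^sub>R u) - f (x + h *\<^sub>R v) + f x =
      h * h * ?D (?D f u) v (x + s *\<^sub>R u + t *\<^sub>R v)"
    if h: "h > 0" and in_S: "\<And>s t. 0 \<le> s \<Longrightarrow> s \<le> h \<Longrightarrow> 0 \<le> t \<Longrightarrow> t \<le> h \<Longrightarrow> x + s *\<^sub>R u + t *\<^sub>R v \<in> S"
    for h :: real and u v :: 'a
  proof -
    have line: "((\<lambda>s. F (z + s *\<^sub>R w)) has_real_derivative ?D F w (z + s *\<^sub>R w)) (at s)"
      if "smooth_on S F" "z + s *\<^sub>R w \<in> S" for F :: "'a \<Rightarrow> real" and z w s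
    proof -
      have w: "((\<lambda>s. z + s *\<^sub>R w) has_derivative (\<lambda>t. t *\<^sub>R w)) (at s)"
        by (auto intro!: derivative_eq_intros)
      have "((\<lambda>s. F (z + s *\<^sub>R w)) has_derivative (\<lambda>t. ?D F (t *\<^sub>R w) (z + s *\<^sub>R w))) (at s)"
        by (rule has_derivative_compose[OF w smooth_on_has_derivative[OF that]])
      moreover have "(\<lambda>t. ?D F (t *\<^sub>R w) (z + s *\<^sub>R w)) = (*) (?D F w (z + s *\<^sub>R w))"
        using linear_scale[OF has_derivative_linear[OF smooth_on_has_derivative[OF that]]]
        by (auto simp: mult.commute)
      ultimately show ?thesis unfolding has_field_derivative_def by metis
    qed
    \<comment> \<open>The increment of \<open>G\<close> is the second difference. The mean value
      theorem is applied to \<open>G\<close> in direction \<open>u\<close>, then to the resulting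
      first derivative in direction \<open>v\<close>.\<close>
    define G where "G s = f (x + h *\<^sub>R v + s *\<^sub>R u) - f (x + s *\<^sub>R u)" for s
    have "(G has_real_derivative ?D f u (x + h *\<^sub>R v + s *\<^sub>R u) - ?D f u (x + s *\<^sub>R u)) (at s)"
      if "0 \<le> s" "s \<le> h" for s
      unfolding G_def using in_S[of s h] in_S[of s 0] that h
      by (intro DERIV_diff line assms(3)) (auto simp: ac_simps)
    from MVT2[of 0 h G, OF h this] obtain s where s: "0 < s" "s < h"
      and eq1: "G h - G 0 = h * (?D f u (x + h *\<^sub>R v + s *\<^sub>R u) - ?D f u (x + s *\<^sub>R u))" by auto
    have "((\<lambda>t. ?D f u (x + s *\<^sub>R u + t *\<^sub>R v)) has_real_derivative
        ?D (?D f u) v (x + s *\<^sub>R u + t *\<^sub>R v)) (at t)" if "0 \<le> t" "t \<le> h" for t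
      using in_S[of s t] s that by (intro line smooth_on_frechet_derivative assms(3)) auto
    from MVT2[of 0 h _, OF h this] obtain t where t: "0 < t" "t < h"
      and eq2: "?D f u (x + s *\<^sub>R u + h *\<^sub>R v) - ?D f u (x + s *\<^sub>R u) =
          h * ?D (?D f u) v (x + s *\<^sub>R u + t *\<^sub>R v)" by auto
    have "f (x + h *\<^sub>R u + h *\<^sub>R v) - f (x + h *\<^sub>R u) - f (x + h *\<^sub>R v) + f x = G h - G 0"
      by (simp add: G_def algebra_simps)
    also have "\<dots> = h * (h * ?D (?D f u) v (x + s *\<^sub>R u + t *\<^sub>R v))"
      using eq1 eq2 by (simp add: algebra_simps)
    finally show ?thesis using s t by (metis mult.assoc)
  qed
  have cont: "isCont (?D (?D f u) v) x" for u v
    using smooth_on_differentiable[OF smooth_on_frechet_derivative[OF smooth_on_frechet_derivative[OF assms(3)]] assms(2)]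
    by (rule differentiable_imp_continuous_within)
  have close: "\<bar>?D (?D f u) v x - ?D (?D f v) u x\<bar> < e" if "e > 0" for e
  proof -
    obtain d1 where d1: "d1 > 0" "\<And>y. dist y x < d1 \<Longrightarrow> dist (?D (?D f u) v y) (?D (?D f u) v x) < e/2"
      using cont[of u v, unfolded continuous_at_eps_delta, rule_format, of "e/2"] \<open>e > 0\<close> by auto
    obtain d2 where d2: "d2 > 0" "\<And>y. dist y x < d2 \<Longrightarrow> dist (?D (?D f v) u y) (?D (?D f v) u x) < e/2"
      using cont[of v u, unfolded continuous_at_eps_delta, rule_format, of "e/2"] \<open>e > 0\<close> by auto
    obtain d3 where d3: "d3 > 0" "ball x d3 \<subseteq> S" using assms(1,2) openE by blast
    define d where "d = min d1 (min d2 d3)"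
    \<comment> \<open>By the triangle inequality the parallelogram then stays within distance
      \<open>d\<close> of \<open>x\<close>; the summand 1 keeps the denominator positive when
      \<open>u\<close> and \<open>v\<close> vanish.\<close>
    define h where "h = d / (norm u + norm v + 1)"
    have pos: "d > 0" "h > 0" using d1 d2 d3
      by (auto simp: d_def h_def intro!: divide_pos_pos add_nonneg_pos)
    have near: "dist (x + s *\<^sub>R u + t *\<^sub>R v) x < d" if "0 \<le> s" "s \<le> h" "0 \<le> t" "t \<le> h" for s t
    proof -
      have "dist (x + s *\<^sub>R u + t *\<^sub>R v) x \<le> s * norm u + t * norm v"
        using that norm_triangle_ineq[of "s *\<^sub>R u" "t *\<^sub>R v"] by (simp add: dist_norm)
      also have "\<dots> \<le> h * norm u + h * norm v" using that by (intro add_mono mult_right_mono) auto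
      also have "\<dots> < h * (norm u + norm v + 1)" using pos by (simp add: algebra_simps)
      also have "\<dots> = d" using norm_ge_zero[of u] norm_ge_zero[of v] unfolding h_def
        by (simp add: add_nonneg_pos less_imp_neq[symmetric])
      finally show ?thesis .
    qed
    have in_S: "x + s *\<^sub>R u + t *\<^sub>R v \<in> S" if "0 \<le> s" "s \<le> h" "0 \<le> t" "t \<le> h" for s t
      using near[OF that] d3 by (auto simp: d_def dist_commute)
    obtain s t where st: "0 < s" "s < h" "0 < t" "t < h"
      and 1: "f (x + h *\<^sub>R u + h *\<^sub>R v) - f (x + h *\<^sub>R u) - f (x + h *\<^sub>R v) + f x =
      h * h * ?D (?D f u) v (x + s *\<^sub>R u + t *\<^sub>R v)"
      using mvt[of h u v, OF pos(2) in_S] by blast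
    have in_S': "x + s *\<^sub>R v + t *\<^sub>R u \<in> S" if "0 \<le> s" "s \<le> h" "0 \<le> t" "t \<le> h" for s t
      using in_S[of t s] that by (simp add: algebra_simps)
    obtain s' t' where st': "0 < s'" "s' < h" "0 < t'" "t' < h"
      and 2: "f (x + h *\<^sub>R v + h *\<^sub>R u) - f (x + h *\<^sub>R v) - f (x + h *\<^sub>R u) + f x =
      h * h * ?D (?D f v) u (x + s' *\<^sub>R v + t' *\<^sub>R u)"
      using mvt[of h v u, OF pos(2) in_S'] by blast
    have "f (x + h *\<^sub>R v + h *\<^sub>R u) - f (x + h *\<^sub>R v) - f (x + h *\<^sub>R u) + f x =
      f (x + h *\<^sub>R u + h *\<^sub>R v) - f (x + h *\<^sub>R u) - f (x + h *\<^sub>R v) + f x"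
      by (simp add: ac_simps)
    with 1 2 pos have "?D (?D f u) v (x + s *\<^sub>R u + t *\<^sub>R v) = ?D (?D f v) u (x + s' *\<^sub>R v + t' *\<^sub>R u)"
      by simp
    moreover have "dist (?D (?D f u) v (x + s *\<^sub>R u + t *\<^sub>R v)) (?D (?D f u) v x) < e/2"
      using near[of s t] st by (intro d1) (auto simp: d_def)
    moreover have "dist (?D (?D f v) u (x + s' *\<^sub>R v + t' *\<^sub>R u)) (?D (?D f v) u x) < e/2"
      using near[of t' s'] st' by (intro d2) (auto simp: d_def ac_simps)
    ultimately show ?thesis unfolding dist_real_def by linarith
  qed
  \<comment> \<open>If the two values differed, their distance taken as \<open>e\<close> would be
    smaller than itself.\<close>
  show ?thesis
    using close[of "\<bar>?D (?D f u) v x - ?D (?D f v) u x\<bar>"] by (cases "?D (?D f u) v x = ?D (?D f v) u x") auto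
qed

text \<open>Near \<open>x\<close> the norm of \<open>b y\<close> is bounded by a multiple of
  \<open>norm (y - x)\<close> and \<open>a y\<close> tends to 0, so the product is of smaller order
  than \<open>norm (y - x)\<close>. Below, \<open>a\<close> is a component of a solution that is so
  far known only to be continuous.\<close>

lemma has_derivative_scaleR_vanishing:
  fixes a :: "'a::real_normed_vector \<Rightarrow> real" and b :: "'a \<Rightarrow> 'b::real_normed_vector"
  assumes "isCont a x" "a x = 0" "(b has_derivative b') (at x)" "b x = 0"
  shows "((\<lambda>y. a y *\<^sub>R b y) has_derivative (\<lambda>_. 0)) (at x)"
proof -
  have bl: "bounded_linear b'" using assms(3) by (rule has_derivative_bounded_linear)
  obtain K where K: "\<And>h. norm (b' h) \<le> norm h * K" using bounded_linear.bounded[OF bl] by blast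
  let ?o = "\<lambda>y. norm (b y - b x - b' (y - x)) / norm (y - x)"
  have o: "(?o \<longlongrightarrow> 0) (at x)" using assms(3) by (simp add: has_derivative_iff_norm)
  have a0: "(a \<longlongrightarrow> 0) (at x)" using assms(1,2) by (simp add: isCont_def)
  have "((\<lambda>y. \<bar>a y\<bar> * (?o y + K)) \<longlongrightarrow> 0 * (0 + K)) (at x)"
    by (intro tendsto_intros o tendsto_rabs_zero a0)
  then have lim: "((\<lambda>y. \<bar>a y\<bar> * (?o y + K)) \<longlongrightarrow> 0) (at x)" by simp
  have "((\<lambda>y. norm (a y *\<^sub>R b y) / norm (y - x)) \<longlongrightarrow> 0) (at x)"
  proof (rule tendsto_sandwich[OF _ _ tendsto_const lim])
    show "\<forall>\<^sub>F y in at x. norm (a y *\<^sub>R b y) / norm (y - x) \<le> \<bar>a y\<bar> * (?o y + K)"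
    proof (rule eventually_mono[OF eventually_at_ball'[of 1 x UNIV]])
      fix y assume "y \<in> ball x 1 \<and> y \<noteq> x \<and> y \<in> UNIV"
      then have n: "norm (y - x) > 0" by simp
      have "norm (b y) \<le> norm (b y - b x - b' (y - x)) + norm (b' (y - x))"
        using norm_triangle_ineq[of "b y - b' (y - x)" "b' (y - x)"] assms(4) by simp
      also have "\<dots> \<le> norm (b y - b x - b' (y - x)) + norm (y - x) * K" using K by simp
      finally have "norm (b y) / norm (y - x) \<le> (norm (b y - b x - b' (y - x)) + norm (y - x) * K) / norm (y - x)"
        using n by (intro divide_right_mono) auto
      also have "\<dots> = ?o y + K" using n by (simp add: add_divide_distrib)
      finally have "\<bar>a y\<bar> * (norm (b y) / norm (y - x)) \<le> \<bar>a y\<bar> * (?o y + K)"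
        by (rule mult_left_mono) simp
      then show "norm (a y *\<^sub>R b y) / norm (y - x) \<le> \<bar>a y\<bar> * (?o y + K)" by simp
    qed simp
  qed auto
  then show ?thesis using assms by (simp add: has_derivative_iff_norm)
qed

text \<open>Let \<open>L\<close> be a left inverse of \<open>A x0\<close>. Applying \<open>L\<close>
  to the system writes the increment of \<open>w\<close> as \<open>r x\<close>, which inherits the
  regularity of \<open>z\<close>, plus an error in which the increment of \<open>w\<close> is
  multiplied by coefficients vanishing at \<open>x0\<close>. Continuity follows by absorbing the
  error; differentiability follows because the error then has derivative 0.\<close>

lemma linear_system_solution_regular:
  fixes A :: "'a::euclidean_space \<Rightarrow> 'm::euclidean_space \<Rightarrow> 'n::euclidean_space"
  assumes S: "open S" "x0 \<in> S"
    and A: "\<And>x. x \<in> S \<Longrightarrow> linear (A x)" "inj (A x0)" "\<And>u. smooth_on S (\<lambda>x. A x u)"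
    and z: "\<And>x. x \<in> S \<Longrightarrow> A x (w x) = z x"
  shows "isCont z x0 \<Longrightarrow> isCont w x0"
    and "z differentiable (at x0) \<Longrightarrow> w differentiable (at x0)"
proof -
  obtain L where L: "linear L" "L \<circ> A x0 = id"
    using linear_injective_left_inverse A(1,2) S(2) by blast
  then have bL: "bounded_linear L" by (simp add: linear_conv_bounded_linear)
  have L_inv: "L (A x0 u) = u" for u using L(2) by (metis comp_apply id_apply)
  have A_diff: "(\<lambda>x. A x u) differentiable (at x0)" for u
    using A(3) S(2) smooth_on_differentiable by blast
  then have A_cont: "isCont (\<lambda>x. A x u) x0" for u
    by (rule differentiable_imp_continuous_within)
  define r where "r x = L (z x) - L (A x (w x0))" for x
  define e where "e x = (\<Sum>i\<in>Basis. norm (i - L (A x i)))" for x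
  have r0: "r x0 = 0" using z[OF S(2)] by (simp add: r_def)
  have expand: "w x - w x0 = r x + (\<Sum>i\<in>Basis. ((w x - w x0) \<bullet> i) *\<^sub>R (i - L (A x i)))"
    if "x \<in> S" for x
  proof -
    have l: "linear (\<lambda>u. L (A x u))" using linear_compose[OF A(1)[OF that] L(1)] by (simp add: o_def)
    have "(\<Sum>i\<in>Basis. ((w x - w x0) \<bullet> i) *\<^sub>R (i - L (A x i))) = (w x - w x0) - L (A x (w x - w x0))"
      by (simp add: scaleR_diff_right sum_subtractf euclidean_representation
          linear_basis_expand[OF l, of "w x - w x0", symmetric])
    moreover have "L (A x (w x - w x0)) = r x"
      using that by (simp add: r_def linear_diff[OF l] z)
    ultimately show ?thesis by simp
  qed
  have cont: "isCont w x0" if zc: "isCont z x0"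
  proof -
    have "isCont e x0" unfolding e_def
      by (intro continuous_intros bounded_linear.isCont[OF bL] A_cont)
    moreover have "e x0 = 0" by (simp add: e_def L_inv)
    ultimately have "(e \<longlongrightarrow> 0) (at x0)" by (simp add: isCont_def)
    \<comment> \<open>Below 1/2 the error is at most half the norm of the increment of
      \<open>w\<close>, so it can be moved to the left; this produces the factor 2 in front of
      \<open>norm (r x)\<close>.\<close>
    then have ev: "\<forall>\<^sub>F x in at x0. e x < 1/2" by (rule order_tendstoD) simp
    have "isCont r x0" unfolding r_def
      by (intro continuous_intros bounded_linear.isCont[OF bL] A_cont zc)
    then have "((\<lambda>x. 2 * norm (r x)) \<longlongrightarrow> 2 * 0) (at x0)"
      using r0 by (intro tendsto_mult tendsto_const tendsto_norm_zero) (simp add: isCont_def)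
    then have lim: "((\<lambda>x. 2 * norm (r x)) \<longlongrightarrow> 0) (at x0)" by simp
    have "\<forall>\<^sub>F x in at x0. norm (w x - w x0) \<le> 2 * norm (r x)"
      using ev eventually_at_in_open'[OF S]
    proof eventually_elim
      case (elim x)
      have "norm (\<Sum>i\<in>Basis. ((w x - w x0) \<bullet> i) *\<^sub>R (i - L (A x i))) \<le>
          (\<Sum>i\<in>Basis. norm (w x - w x0) * norm (i - L (A x i)))"
        by (rule sum_norm_le) (auto intro!: mult_right_mono simp: Basis_le_norm)
      also have "\<dots> = norm (w x - w x0) * e x" by (simp add: e_def sum_distrib_left)
      also have "\<dots> \<le> norm (w x - w x0) * (1/2)" using elim by (intro mult_left_mono) auto
      finally show ?case
        using expand[OF elim(2)] norm_triangle_ineq[of "r x" "\<Sum>i\<in>Basis. ((w x - w x0) \<bullet> i) *\<^sub>R (i - L (A x i))"]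
        by simp
    qed
    then have "((\<lambda>x. w x - w x0) \<longlongrightarrow> 0) (at x0)" by (rule Lim_null_comparison[OF _ lim])
    then show ?thesis unfolding isCont_def using LIM_zero_cancel by blast
  qed
  then show "isCont z x0 \<Longrightarrow> isCont w x0" .
  assume zd: "z differentiable (at x0)"
  then have wc: "isCont w x0" by (intro cont differentiable_imp_continuous_within)
  have Ld: "(\<lambda>x. L (h x)) differentiable (at x0)" if "h differentiable (at x0)" for h
    using that bounded_linear.has_derivative[OF bL] unfolding differentiable_def by blast
  have rd: "r differentiable (at x0)"
    unfolding r_def by (intro differentiable_diff Ld zd A_diff)
  \<comment> \<open>Both factors vanish at \<open>x0\<close>; the first is continuous by the part
    just shown, the second differentiable.\<close>
  have "((\<lambda>x. ((w x - w x0) \<bullet> i) *\<^sub>R (i - L (A x i))) has_derivative (\<lambda>_. 0)) (at x0)" for i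
  proof -
    have "(\<lambda>x. i - L (A x i)) differentiable (at x0)" by (intro derivative_intros Ld A_diff)
    then obtain b' where "((\<lambda>x. i - L (A x i)) has_derivative b') (at x0)"
      unfolding differentiable_def by blast
    then show ?thesis
      by (rule has_derivative_scaleR_vanishing[rotated 2]) (auto intro!: continuous_intros wc simp: L_inv)
  qed
  then have "(\<lambda>x. w x0 + (r x + (\<Sum>i\<in>Basis. ((w x - w x0) \<bullet> i) *\<^sub>R (i - L (A x i))))) differentiable (at x0)"
    by (intro differentiable_add rd differentiable_const differentiable_sum) (auto intro: differentiableI)
  then obtain D where "((\<lambda>x. w x0 + (r x + (\<Sum>i\<in>Basis. ((w x - w x0) \<bullet> i) *\<^sub>R (i - L (A x i))))) has_derivative D) (at x0)"
    unfolding differentiable_def by blast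
  then have "(w has_derivative D) (at x0)"
    by (rule has_derivative_transform_within_open[OF _ S]) (simp add: expand[symmetric])
  then show "w differentiable (at x0)" by (rule differentiableI)
qed

text \<open>Differentiating \<open>A x (w x) = z x\<close> shows that each directional derivative of
  \<open>w\<close> solves a system with the same coefficients and right-hand side
  \<open>z1 v\<close>. That side involves \<open>w\<close> itself but no derivative of it, so it is
  of class \<open>k\<close> and the induction closes.\<close>

lemma Ck_on_linear_solve:
  fixes A :: "'a::euclidean_space \<Rightarrow> 'm::euclidean_space \<Rightarrow> 'n::euclidean_space"
  assumes S: "open S"
    and A: "\<And>x. x \<in> S \<Longrightarrow> linear (A x)" "\<And>x. x \<in> S \<Longrightarrow> inj (A x)" "\<And>u. smooth_on S (\<lambda>x. A x u)"
    and "\<And>x. x \<in> S \<Longrightarrow> A x (w x) = z x" "Ck_on k S z"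
  shows "Ck_on k S w"
  using assms(5,6)
proof (induction k arbitrary: w z)
  case 0
  have "isCont w x" if "x \<in> S" for x
  proof (rule linear_system_solution_regular(1)[OF S that A(1) A(2)[OF that] A(3) 0(1)])
    show "isCont z x" using 0(2) that S by (simp add: continuous_on_eq_continuous_at)
  qed
  then show ?case by (simp add: continuous_at_imp_continuous_on)
next
  case (Suc k)
  have wk: "Ck_on k S w" using Suc Ck_on_SucD by blast
  have zd: "(z has_derivative frechet_derivative z (at x)) (at x)" if "x \<in> S" for x
    using Suc.prems(2) that by (simp add: frechet_derivative_works[symmetric])
  have wd: "(w has_derivative frechet_derivative w (at x)) (at x)" if "x \<in> S" for x
  proof -
    have "w differentiable (at x)"
      by (rule linear_system_solution_regular(2)[OF S that A(1) A(2)[OF that] A(3) Suc.prems(1)])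
        (use zd[OF that] differentiableI in blast)+
    then show ?thesis by (simp add: frechet_derivative_works[symmetric])
  qed
  define z1 where "z1 v x = frechet_derivative z (at x) v -
    (\<Sum>i\<in>Basis. (w x \<bullet> i) *\<^sub>R frechet_derivative (\<lambda>y. A y i) (at x) v)" for v x
  have eq: "A x (frechet_derivative w (at x) v) = z1 v x" if "x \<in> S" for x v
  proof -
    have "((\<lambda>y. \<Sum>i\<in>Basis. (w y \<bullet> i) *\<^sub>R A y i) has_derivative
        (\<lambda>v. \<Sum>i\<in>Basis. (w x \<bullet> i) *\<^sub>R frechet_derivative (\<lambda>y. A y i) (at x) v +
           (frechet_derivative w (at x) v \<bullet> i) *\<^sub>R A x i)) (at x)"
      by (intro has_derivative_sum has_derivative_scaleR has_derivative_inner_left wd that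
          smooth_on_has_derivative[OF A(3)])
    then have "(z has_derivative
        (\<lambda>v. \<Sum>i\<in>Basis. (w x \<bullet> i) *\<^sub>R frechet_derivative (\<lambda>y. A y i) (at x) v +
           (frechet_derivative w (at x) v \<bullet> i) *\<^sub>R A x i)) (at x)"
      by (rule has_derivative_transform_within_open[OF _ S that])
        (simp add: Suc.prems(1)[symmetric] linear_basis_expand[OF A(1)])
    from frechet_derivative_eq[OF this] show ?thesis
      by (simp add: z1_def sum.distrib linear_basis_expand[OF A(1)[OF that], of "frechet_derivative w (at x) v"])
  qed
  have "Ck_on k S (\<lambda>x. - 1 *\<^sub>R (\<Sum>i\<in>Basis. (w x \<bullet> i) *\<^sub>R frechet_derivative (\<lambda>y. A y i) (at x) v))" for v
    using smooth_on_frechet_derivative[OF A(3)]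
    by (intro Ck_on_linear[OF bounded_linear_scaleR_right] Ck_on_sum S wk
        Ck_on_bilinear[OF bounded_bilinear_scaleR] Ck_on_linear[OF bounded_linear_inner_left])
      (simp add: smooth_on_def)
  from Ck_on_add[OF S _ this] have "Ck_on k S (z1 v)" for v
    using Suc.prems(2) by (simp add: z1_def[abs_def])
  then show ?case
    by (intro Ck_on_SucI[OF S wd] Suc.IH[OF eq])
qed

lemma smooth_on_linear_solve:
  fixes A :: "'a::euclidean_space \<Rightarrow> 'm::euclidean_space \<Rightarrow> 'n::euclidean_space"
  assumes "open S" "\<And>x. x \<in> S \<Longrightarrow> linear (A x)" "\<And>x. x \<in> S \<Longrightarrow> inj (A x)"
    "\<And>u. smooth_on S (\<lambda>x. A x u)" "\<And>x. x \<in> S \<Longrightarrow> A x (w x) = z x" "smooth_on S z"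
  shows "smooth_on S w"
  using Ck_on_linear_solve[OF assms(1-5)] assms(6) by (simp add: smooth_on_def)

section \<open>Calculus on manifolds\<close>

locale manifold =
  fixes A :: "('p::{t2_space,second_countable_topology}, 'e::euclidean_space) chart set"
  assumes atlas: "smooth_atlas A"
begin

section \<open>Charts and smooth functions\<close>

lemma chart_at: "chart_at A p \<in> A" "p \<in> fst (chart_at A p)"
proof -
  have "\<exists>c. c \<in> A \<and> p \<in> fst c" using atlas unfolding smooth_atlas_def by blast
  from someI_ex[OF this] show "chart_at A p \<in> A" "p \<in> fst (chart_at A p)"
    unfolding chart_at_def by auto
qed

lemma open_chart: "c \<in> A \<Longrightarrow> open (fst c)"
  using atlas by (auto simp: smooth_atlas_def)

lemma homeomorphism_chart:
  "c \<in> A \<Longrightarrow> homeomorphism (fst c) (snd c ` fst c) (snd c) (chart_inv c)"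
  using atlas by (auto simp: smooth_atlas_def)

lemma chart_inv_chart [simp]: "c \<in> A \<Longrightarrow> p \<in> fst c \<Longrightarrow> chart_inv c (snd c p) = p"
  using homeomorphism_chart by (metis homeomorphism_apply1)

lemma open_chart_image:
  assumes "c \<in> A" "open U"
  shows "open (snd c ` (U \<inter> fst c))"
proof -
  have "openin (top_of_set (fst c)) (U \<inter> fst c)" using assms(2) by (metis inf_commute openin_open)
  then have "openin (top_of_set (snd c ` fst c)) (snd c ` (U \<inter> fst c))"
    using homeomorphism_imp_open_map[OF homeomorphism_chart[OF assms(1)]] by blast
  then show ?thesis
    using assms(1) atlas unfolding smooth_atlas_def by (meson openin_open_trans)
qed

lemma open_chart_image_subset:
  assumes "c \<in> A" "open U" "U \<subseteq> fst c"
  shows "open (snd c ` U)"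
  using open_chart_image[OF assms(1,2)] assms(3) by (simp add: inf_absorb1)

lemma smooth_transition:
  "c \<in> A \<Longrightarrow> d \<in> A \<Longrightarrow> smooth_on (snd c ` (fst c \<inter> fst d)) (snd d \<circ> chart_inv c)"
  using atlas by (auto simp: smooth_atlas_def)

text \<open>Another chart reads \<open>h\<close> as its expression in \<open>c\<close> composed with
  a smooth transition map.\<close>

lemma smooth_fun_on_in_chart:
  assumes "c \<in> A" "open U" "U \<subseteq> fst c" "smooth_on (snd c ` U) (h \<circ> chart_inv c)"
  shows "smooth_fun_on A U h"
  unfolding smooth_fun_on_def
proof
  fix d assume d: "d \<in> A"
  have o: "open (snd d ` (U \<inter> fst d))" using d assms(2) by (rule open_chart_image)
  have "smooth_on (snd d ` (U \<inter> fst d)) (\<lambda>x. (h \<circ> chart_inv c) ((snd c \<circ> chart_inv d) x))"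
  proof (rule smooth_on_compose[OF o open_chart_image_subset[OF assms(1-3)]])
    show "(snd c \<circ> chart_inv d) ` snd d ` (U \<inter> fst d) \<subseteq> snd c ` U" using d by auto
    show "smooth_on (snd d ` (U \<inter> fst d)) (snd c \<circ> chart_inv d)"
      by (rule smooth_on_subset[OF smooth_transition[OF d assms(1)]]) (use assms(3) in auto)
  qed (rule assms(4))
  then show "smooth_on (snd d ` (U \<inter> fst d)) (h \<circ> chart_inv d)"
    by (rule smooth_on_cong_imp[OF o, rotated]) (use d assms(1,3) in auto)
qed

lemma smooth_fun_onD:
  "smooth_fun_on A U h \<Longrightarrow> c \<in> A \<Longrightarrow> smooth_on (snd c ` (U \<inter> fst c)) (h \<circ> chart_inv c)"
  by (simp add: smooth_fun_on_def)

lemma smooth_fun_on_subset: "smooth_fun_on A U h \<Longrightarrow> V \<subseteq> U \<Longrightarrow> smooth_fun_on A V h"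
  unfolding smooth_fun_on_def using smooth_on_subset by (metis Int_mono image_mono subset_refl)

lemma smooth_fun_on_local:
  assumes "\<And>p. p \<in> U \<Longrightarrow> \<exists>V. open V \<and> p \<in> V \<and> smooth_fun_on A V h"
  shows "smooth_fun_on A U h"
  unfolding smooth_fun_on_def
proof (intro ballI smooth_on_local)
  fix c x assume c: "c \<in> A" and "x \<in> snd c ` (U \<inter> fst c)"
  then obtain p where p: "p \<in> U" "p \<in> fst c" "x = snd c p" by auto
  obtain V where V: "open V" "p \<in> V" "smooth_fun_on A V h" using assms p(1) by blast
  show "\<exists>T. open T \<and> x \<in> T \<and> smooth_on T (h \<circ> chart_inv c)"
    using open_chart_image[OF c V(1)] smooth_fun_onD[OF V(3) c] p V(2) by blast
qed

lemma smooth_fun_on_cong: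
  assumes "open U" "smooth_fun_on A U h" "\<And>q. q \<in> U \<Longrightarrow> h q = k q"
  shows "smooth_fun_on A U k"
  unfolding smooth_fun_on_def
proof
  fix c assume c: "c \<in> A"
  show "smooth_on (snd c ` (U \<inter> fst c)) (k \<circ> chart_inv c)"
    by (rule smooth_on_cong_imp[OF open_chart_image[OF c assms(1)] _ smooth_fun_onD[OF assms(2) c]])
      (use c assms(3) in auto)
qed

lemma smooth_fun_on_const: "smooth_fun_on A U (\<lambda>q. a)"
  by (simp add: smooth_fun_on_def o_def smooth_on_const)

lemma smooth_fun_on_add:
  "open U \<Longrightarrow> smooth_fun_on A U h \<Longrightarrow> smooth_fun_on A U k \<Longrightarrow> smooth_fun_on A U (\<lambda>q. h q + k q)"
  by (simp add: smooth_fun_on_def o_def smooth_on_add open_chart_image)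

lemma smooth_fun_on_mult:
  "open U \<Longrightarrow> smooth_fun_on A U h \<Longrightarrow> smooth_fun_on A U k \<Longrightarrow> smooth_fun_on A U (\<lambda>q. h q * k q)"
  by (simp add: smooth_fun_on_def o_def smooth_on_mult open_chart_image)

lemma smooth_fun_on_sum:
  "open U \<Longrightarrow> (\<And>i. i \<in> I \<Longrightarrow> smooth_fun_on A U (h i)) \<Longrightarrow> smooth_fun_on A U (\<lambda>q. \<Sum>i\<in>I. h i q)"
  by (simp add: smooth_fun_on_def o_def smooth_on_sum open_chart_image)

text \<open>Differentiating these functions along a vector recovers its components in
  \<open>c\<close>, whatever the preferred chart at the point. They replace
  \<open>components_in\<close> in most of what follows.\<close>

definition coord :: "('p, 'e) chart \<Rightarrow> 'e \<Rightarrow> 'p \<Rightarrow> real" where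
  "coord c i q = snd c q \<bullet> i"

lemma smooth_coord:
  assumes "c \<in> A"
  shows "smooth_fun_on A (fst c) (coord c i)"
proof (rule smooth_fun_on_in_chart[OF assms open_chart[OF assms] order_refl])
  have o: "open (snd c ` fst c)" by (rule open_chart_image_subset[OF assms open_chart[OF assms] order_refl])
  have "smooth_on (snd c ` fst c) (\<lambda>x. (snd c \<circ> chart_inv c) x \<bullet> i)"
    using smooth_transition[OF assms assms]
    by (intro smooth_on_linear[OF bounded_linear_inner_left] o) (simp add: o_def)
  then show "smooth_on (snd c ` fst c) (coord c i \<circ> chart_inv c)"
    by (simp add: coord_def o_def)
qed

section \<open>Tangent vectors as derivations\<close>

lemma smooth_fun_differentiable:
  "smooth_fun_on A U h \<Longrightarrow> c \<in> A \<Longrightarrow> p \<in> U \<Longrightarrow> p \<in> fst c \<Longrightarrow>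
    (h \<circ> chart_inv c) differentiable (at (snd c p))"
  by (rule smooth_on_differentiable[OF smooth_fun_onD]) auto

lemma components_in_has_derivative:
  assumes "c \<in> A" "p \<in> fst c"
  shows "(snd c \<circ> chart_inv (chart_at A p) has_derivative components_in A c p) (at (snd (chart_at A p) p))"
  unfolding components_in_def using assms chart_at
  by (intro smooth_on_has_derivative[OF smooth_transition]) auto

lemma linear_components_in: "c \<in> A \<Longrightarrow> p \<in> fst c \<Longrightarrow> linear (components_in A c p)"
  using components_in_has_derivative has_derivative_linear by blast

text \<open>The derivative of the reverse transition map is a left inverse, and an injective linear
  endomorphism of a finite-dimensional space is surjective.\<close>

lemma bij_components_in:
  assumes "c \<in> A" "p \<in> fst c"
  shows "bij (components_in A c p)"
proof -
  let ?d = "chart_at A p"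
  have d: "?d \<in> A" "p \<in> fst ?d" by (rule chart_at)+
  have 1: "(snd ?d \<circ> chart_inv c has_derivative frechet_derivative (snd ?d \<circ> chart_inv c) (at (snd c p)))
      (at ((snd c \<circ> chart_inv ?d) (snd ?d p)))"
    using assms d by (auto intro!: smooth_on_has_derivative[OF smooth_transition])
  have 2: "((snd ?d \<circ> chart_inv c) \<circ> (snd c \<circ> chart_inv ?d) has_derivative
      frechet_derivative (snd ?d \<circ> chart_inv c) (at (snd c p)) \<circ> components_in A c p) (at (snd ?d p))"
    by (rule diff_chain_at[OF components_in_has_derivative[OF assms] 1])
  have "((\<lambda>x. x) has_derivative
      frechet_derivative (snd ?d \<circ> chart_inv c) (at (snd c p)) \<circ> components_in A c p) (at (snd ?d p))"
    by (rule has_derivative_transform_within_open[OF 2 open_chart_image[OF d(1) open_chart[OF assms(1)]]])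
      (use d assms in auto)
  then have "frechet_derivative (snd ?d \<circ> chart_inv c) (at (snd c p)) \<circ> components_in A c p = (\<lambda>x. x)"
    using has_derivative_unique has_derivative_ident by blast
  then have "inj (components_in A c p)" by (metis comp_apply injI)
  then show ?thesis
    using linear_components_in[OF assms] linear_injective_imp_surjective by (auto simp: bij_def)
qed

text \<open>\<open>components_in\<close> is the Jacobian of the change from the preferred chart to
  \<open>c\<close>, so this is the chain rule. It frees \<open>vderiv\<close> from the preferred
  chart of its definition.\<close>

lemma vderiv_in_chart:
  assumes "c \<in> A" "p \<in> fst c" "(h \<circ> chart_inv c) differentiable (at (snd c p))"
  shows "vderiv A p v h =
    frechet_derivative (h \<circ> chart_inv c) (at (snd c p)) (components_in A c p v)"
proof -
  let ?d = "chart_at A p"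
  have d: "?d \<in> A" "p \<in> fst ?d" by (rule chart_at)+
  have 1: "(h \<circ> chart_inv c has_derivative frechet_derivative (h \<circ> chart_inv c) (at (snd c p)))
      (at ((snd c \<circ> chart_inv ?d) (snd ?d p)))"
    using assms d by (simp add: frechet_derivative_works[symmetric])
  have 2: "((h \<circ> chart_inv c) \<circ> (snd c \<circ> chart_inv ?d) has_derivative
      frechet_derivative (h \<circ> chart_inv c) (at (snd c p)) \<circ> components_in A c p) (at (snd ?d p))"
    by (rule diff_chain_at[OF components_in_has_derivative[OF assms(1,2)] 1])
  have "(h \<circ> chart_inv ?d has_derivative
      frechet_derivative (h \<circ> chart_inv c) (at (snd c p)) \<circ> components_in A c p) (at (snd ?d p))"
    by (rule has_derivative_transform_within_open[OF 2 open_chart_image[OF d(1) open_chart[OF assms(1)]]])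
      (use d assms in auto)
  from frechet_derivative_eq[OF this] show ?thesis by (simp add: vderiv_def)
qed

lemma vderiv_has_derivative:
  assumes "smooth_fun_on A U h" "p \<in> U"
  shows "(h \<circ> chart_inv (chart_at A p) has_derivative (\<lambda>v. vderiv A p v h)) (at (snd (chart_at A p) p))"
  unfolding vderiv_def frechet_derivative_works[symmetric]
  by (rule smooth_fun_differentiable[OF assms(1) chart_at(1) assms(2) chart_at(2)])

lemma vderiv_eqI:
  assumes "(h \<circ> chart_inv (chart_at A p) has_derivative D) (at (snd (chart_at A p) p))"
  shows "vderiv A p v h = D v"
  using frechet_derivative_eq[OF assms] by (simp add: vderiv_def)

lemma linear_vderiv: "smooth_fun_on A U h \<Longrightarrow> p \<in> U \<Longrightarrow> linear (\<lambda>v. vderiv A p v h)"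
  using vderiv_has_derivative has_derivative_linear by blast

lemma vderiv_cong:
  assumes "open U" "p \<in> U" "smooth_fun_on A U h" "\<And>q. q \<in> U \<Longrightarrow> h q = k q"
  shows "vderiv A p v k = vderiv A p v h"
  by (rule vderiv_eqI, rule has_derivative_transform_within_open
      [OF vderiv_has_derivative[OF assms(3,2)] open_chart_image[OF chart_at(1) assms(1)]])
    (use assms chart_at in auto)

lemma vderiv_const [simp]: "vderiv A p v (\<lambda>q. a) = 0"
  by (simp add: vderiv_def o_def)

lemma vderiv_add:
  assumes "p \<in> U" "smooth_fun_on A U h" "smooth_fun_on A U k"
  shows "vderiv A p v (\<lambda>q. h q + k q) = vderiv A p v h + vderiv A p v k"
  by (rule vderiv_eqI) (use has_derivative_add[OF vderiv_has_derivative[OF assms(2,1)]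
      vderiv_has_derivative[OF assms(3,1)]] in \<open>simp add: o_def\<close>)

lemma vderiv_mult:
  assumes "p \<in> U" "smooth_fun_on A U h" "smooth_fun_on A U k"
  shows "vderiv A p v (\<lambda>q. h q * k q) = vderiv A p v h * k p + h p * vderiv A p v k"
proof -
  have "((\<lambda>q. h q * k q) \<circ> chart_inv (chart_at A p) has_derivative
      (\<lambda>v. h p * vderiv A p v k + vderiv A p v h * k p)) (at (snd (chart_at A p) p))"
    using has_derivative_mult[OF vderiv_has_derivative[OF assms(2,1)] vderiv_has_derivative[OF assms(3,1)]]
    by (simp add: o_def chart_at)
  from vderiv_eqI[OF this] show ?thesis by simp
qed

lemma vderiv_sum:
  assumes "p \<in> U" "\<And>i. i \<in> I \<Longrightarrow> smooth_fun_on A U (h i)"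
  shows "vderiv A p v (\<lambda>q. \<Sum>i\<in>I. h i q) = (\<Sum>i\<in>I. vderiv A p v (h i))"
  by (rule vderiv_eqI) (use has_derivative_sum[OF vderiv_has_derivative[OF assms(2) assms(1)], of I "\<lambda>i. i"] in \<open>simp add: o_def\<close>)

lemma components_in_coord:
  assumes "c \<in> A" "p \<in> fst c"
  shows "components_in A c p v \<bullet> i = vderiv A p v (coord c i)"
proof -
  have "((\<lambda>x. (snd c \<circ> chart_inv (chart_at A p)) x \<bullet> i) has_derivative (\<lambda>v. components_in A c p v \<bullet> i))
      (at (snd (chart_at A p) p))"
    by (intro has_derivative_inner_left components_in_has_derivative assms)
  then have "(coord c i \<circ> chart_inv (chart_at A p) has_derivative (\<lambda>v. components_in A c p v \<bullet> i))
      (at (snd (chart_at A p) p))"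
    by (simp add: coord_def o_def)
  from vderiv_eqI[OF this, of v] show ?thesis by simp
qed

lemma tangent_vector_eqI:
  assumes "c \<in> A" "p \<in> fst c" "\<And>i. i \<in> Basis \<Longrightarrow> vderiv A p v (coord c i) = vderiv A p w (coord c i)"
  shows "v = w"
proof -
  have "components_in A c p v = components_in A c p w"
    by (rule euclidean_eqI) (simp add: components_in_coord assms)
  then show ?thesis using bij_components_in[OF assms(1,2)] by (simp add: bij_def inj_eq)
qed

text \<open>The coordinate vector field of \<open>c\<close> in the constant direction
  \<open>w\<close>, written in the identification of the tangent space at \<open>q\<close> by the
  preferred chart. Basis vectors \<open>w\<close> give the coordinate frame of
  \<open>c\<close>.\<close>

definition frame :: "('p, 'e) chart \<Rightarrow> 'e \<Rightarrow> 'p \<Rightarrow> 'e" where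
  "frame c w q = inv (components_in A c q) w"

lemma components_in_frame: "c \<in> A \<Longrightarrow> p \<in> fst c \<Longrightarrow> components_in A c p (frame c w p) = w"
  unfolding frame_def using bij_components_in by (metis bij_def surj_f_inv_f)

lemma vderiv_frame:
  assumes "c \<in> A" "smooth_fun_on A U h" "p \<in> fst c" "p \<in> U"
  shows "vderiv A p (frame c w p) h = frechet_derivative (h \<circ> chart_inv c) (at (snd c p)) w"
  using vderiv_in_chart[OF assms(1,3) smooth_fun_differentiable[OF assms(2,1,4,3)]]
  by (simp add: components_in_frame assms)

lemma vderiv_frame_coord:
  "c \<in> A \<Longrightarrow> p \<in> fst c \<Longrightarrow> vderiv A p (frame c w p) (coord c i) = w \<bullet> i"
  by (simp add: components_in_coord[symmetric] components_in_frame)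

lemma frame_expand:
  assumes "c \<in> A" "p \<in> fst c"
  shows "v = (\<Sum>i\<in>Basis. vderiv A p v (coord c i) *\<^sub>R frame c i p)"
proof -
  have l: "linear (components_in A c p)" using assms by (rule linear_components_in)
  have "components_in A c p v = components_in A c p (\<Sum>i\<in>Basis. vderiv A p v (coord c i) *\<^sub>R frame c i p)"
    using assms
    by (simp add: linear_sum[OF l] linear_scale[OF l] o_def components_in_frame
        components_in_coord[symmetric] euclidean_representation)
  then show ?thesis using bij_components_in[OF assms(1,2)] by (simp add: bij_def inj_eq)
qed

lemma vderiv_expand:
  assumes "c \<in> A" "p \<in> fst c" "smooth_fun_on A U h" "p \<in> U"
  shows "vderiv A p v h = (\<Sum>i\<in>Basis. vderiv A p v (coord c i) * vderiv A p (frame c i p) h)"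
proof -
  have l: "linear (\<lambda>v. vderiv A p v h)" using assms(3,4) by (rule linear_vderiv)
  show ?thesis
    by (subst frame_expand[OF assms(1,2), of v]) (simp add: linear_sum[OF l] linear_scale[OF l])
qed

lemma smooth_vderiv_frame:
  assumes "c \<in> A" "open U" "U \<subseteq> fst c" "smooth_fun_on A U h"
  shows "smooth_fun_on A U (\<lambda>q. vderiv A q (frame c w q) h)"
proof (rule smooth_fun_on_in_chart[OF assms(1-3)])
  have "smooth_on (snd c ` U) (\<lambda>x. frechet_derivative (h \<circ> chart_inv c) (at x) w)"
    using smooth_fun_onD[OF assms(4,1)] assms(3) by (intro smooth_on_frechet_derivative) (simp add: inf_absorb1)
  then show "smooth_on (snd c ` U) ((\<lambda>q. vderiv A q (frame c w q) h) \<circ> chart_inv c)"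
    by (rule smooth_on_cong_imp[OF open_chart_image_subset[OF assms(1-3)], rotated])
      (use assms(3) in \<open>auto simp: vderiv_frame[OF assms(1,4)] assms(1) subset_iff\<close>)
qed

text \<open>Reduces smoothness of vector fields to that of real functions, to which the product and
  sum rules apply.\<close>

lemma smooth_vector_field_iff:
  assumes "open U"
  shows "smooth_vector_field_on A U X \<longleftrightarrow>
    (\<forall>c\<in>A. \<forall>i\<in>Basis. smooth_fun_on A (U \<inter> fst c) (\<lambda>q. vderiv A q (X q) (coord c i)))"
proof -
  have "smooth_on (snd c ` (U \<inter> fst c)) (\<lambda>x. components_in A c (chart_inv c x) (X (chart_inv c x))) \<longleftrightarrow>
      (\<forall>i\<in>Basis. smooth_fun_on A (U \<inter> fst c) (\<lambda>q. vderiv A q (X q) (coord c i)))"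
    if c: "c \<in> A" for c
  proof -
    have o: "open (snd c ` (U \<inter> fst c))" using c assms by (rule open_chart_image)
    have o': "open (U \<inter> fst c)" using open_chart[OF c] assms by blast
    have "smooth_on (snd c ` (U \<inter> fst c)) (\<lambda>x. components_in A c (chart_inv c x) (X (chart_inv c x)) \<bullet> i) \<longleftrightarrow>
      smooth_on (snd c ` (U \<inter> fst c)) ((\<lambda>q. vderiv A q (X q) (coord c i)) \<circ> chart_inv c)" for i
      unfolding smooth_on_def
      by (rule all_cong1, rule Ck_on_cong[OF o]) (use c in \<open>auto simp: components_in_coord\<close>)
    moreover have "smooth_on (snd c ` (U \<inter> fst c)) (h \<circ> chart_inv c) \<longleftrightarrow> smooth_fun_on A (U \<inter> fst c) h" for h
      using smooth_fun_on_in_chart[OF c o'] smooth_fun_onD[OF _ c, of "U \<inter> fst c"] by auto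
    ultimately show ?thesis by (subst smooth_on_componentwise[OF o]) simp
  qed
  then show ?thesis by (simp add: smooth_vector_field_on_def)
qed

text \<open>The components in another chart \<open>d\<close> are combinations of those in
  \<open>c\<close>, with the smooth coefficients
  \<open>vderiv A q (frame c i q) (coord d j)\<close>.\<close>

lemma smooth_vector_field_in_chart:
  assumes c: "c \<in> A" and U: "open U" "U \<subseteq> fst c"
    and X: "\<And>i. i \<in> Basis \<Longrightarrow> smooth_fun_on A U (\<lambda>q. vderiv A q (X q) (coord c i))"
  shows "smooth_vector_field_on A U X"
  unfolding smooth_vector_field_iff[OF U(1)]
proof (intro ballI)
  fix d and j :: 'e assume d: "d \<in> A" and "j \<in> Basis"
  have o: "open (U \<inter> fst d)" using open_chart[OF d] U by blast
  have "smooth_fun_on A (U \<inter> fst d)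
      (\<lambda>q. \<Sum>i\<in>Basis. vderiv A q (X q) (coord c i) * vderiv A q (frame c i q) (coord d j))"
    using U by (intro smooth_fun_on_sum o smooth_fun_on_mult smooth_vderiv_frame[OF c]
        smooth_fun_on_subset[OF smooth_coord[OF d]] smooth_fun_on_subset[OF X]) auto
  then show "smooth_fun_on A (U \<inter> fst d) (\<lambda>q. vderiv A q (X q) (coord d j))"
    by (rule smooth_fun_on_cong[OF o], intro vderiv_expand[OF c _ smooth_coord[OF d], symmetric])
      (use U in auto)
qed

lemma smooth_vector_field_subset:
  "smooth_vector_field_on A U X \<Longrightarrow> V \<subseteq> U \<Longrightarrow> smooth_vector_field_on A V X"
  unfolding smooth_vector_field_on_def
  by (rule ballI, rule smooth_on_subset, erule bspec, assumption) auto

lemma smooth_vector_field_local: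
  assumes "open U" "\<And>p. p \<in> U \<Longrightarrow> \<exists>V. open V \<and> p \<in> V \<and> smooth_vector_field_on A V X"
  shows "smooth_vector_field_on A U X"
  unfolding smooth_vector_field_iff[OF assms(1)]
proof (intro ballI smooth_fun_on_local)
  fix c p and i :: 'e assume c: "c \<in> A" and i: "i \<in> Basis" and p: "p \<in> U \<inter> fst c"
  then obtain V where V: "open V" "p \<in> V" "smooth_vector_field_on A V X" using assms(2) by blast
  then have "smooth_fun_on A (V \<inter> fst c) (\<lambda>q. vderiv A q (X q) (coord c i))"
    using c i by (simp add: smooth_vector_field_iff)
  then show "\<exists>V. open V \<and> p \<in> V \<and> smooth_fun_on A V (\<lambda>q. vderiv A q (X q) (coord c i))"
    using V p open_chart[OF c] by (intro exI[of _ "V \<inter> fst c"]) auto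
qed

text \<open>Near each point \<open>X\<close> applied to \<open>h\<close> is the sum of the
  components of \<open>X\<close> times the partial derivatives of \<open>h\<close>.\<close>

lemma smooth_vderiv:
  assumes U: "open U" and X: "smooth_vector_field_on A U X" and h: "smooth_fun_on A U h"
  shows "smooth_fun_on A U (\<lambda>q. vderiv A q (X q) h)"
proof (rule smooth_fun_on_local)
  fix p assume p: "p \<in> U"
  let ?c = "chart_at A p"
  let ?V = "U \<inter> fst ?c"
  note c = chart_at[of p]
  have o: "open ?V" using open_chart c U by blast
  have "smooth_fun_on A ?V (\<lambda>q. \<Sum>i\<in>Basis. vderiv A q (X q) (coord ?c i) * vderiv A q (frame ?c i q) h)"
    using X c by (intro smooth_fun_on_sum o smooth_fun_on_mult smooth_vderiv_frame smooth_fun_on_subset[OF h])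
      (auto simp: smooth_vector_field_iff[OF U])
  then have "smooth_fun_on A ?V (\<lambda>q. vderiv A q (X q) h)"
    by (rule smooth_fun_on_cong[OF o], intro vderiv_expand[OF c(1) _ h, symmetric]) auto
  then show "\<exists>V. open V \<and> p \<in> V \<and> smooth_fun_on A V (\<lambda>q. vderiv A q (X q) h)"
    using o p c by blast
qed

lemma smooth_frame: "c \<in> A \<Longrightarrow> smooth_vector_field_on A (fst c) (frame c w)"
  by (rule smooth_vector_field_in_chart[of c])
    (simp_all add: smooth_vderiv_frame[of c "fst c"] smooth_coord open_chart)

lemma smooth_vector_field_combination:
  assumes U: "open U" and "\<And>i. i \<in> I \<Longrightarrow> smooth_fun_on A U (a i)" "\<And>i. i \<in> I \<Longrightarrow> smooth_vector_field_on A U (X i)"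
  shows "smooth_vector_field_on A U (\<lambda>q. \<Sum>i\<in>I. a i q *\<^sub>R X i q)"
  unfolding smooth_vector_field_iff[OF U]
proof (intro ballI)
  fix c and j :: 'e assume c: "c \<in> A" and j: "j \<in> Basis"
  have o: "open (U \<inter> fst c)" using open_chart[OF c] U by blast
  have "smooth_fun_on A (U \<inter> fst c) (\<lambda>q. \<Sum>i\<in>I. a i q * vderiv A q (X i q) (coord c j))"
    using assms c j
    by (intro smooth_fun_on_sum o smooth_fun_on_mult) (auto intro: smooth_fun_on_subset simp: smooth_vector_field_iff)
  then show "smooth_fun_on A (U \<inter> fst c) (\<lambda>q. vderiv A q (\<Sum>i\<in>I. a i q *\<^sub>R X i q) (coord c j))"
  proof (rule smooth_fun_on_cong[OF o])
    fix q assume "q \<in> U \<inter> fst c"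
    then have l: "linear (\<lambda>v. vderiv A q v (coord c j))" using c by (intro linear_vderiv[OF smooth_coord]) auto
    show "(\<Sum>i\<in>I. a i q * vderiv A q (X i q) (coord c j)) = vderiv A q (\<Sum>i\<in>I. a i q *\<^sub>R X i q) (coord c j)"
      by (simp add: linear_sum[OF l] linear_scale[OF l])
  qed
qed

text \<open>The second order terms of \<open>X(Y h) - Y(X h)\<close> cancel by symmetry of second derivatives.\<close>

lemma lie_bracket_exists:
  assumes U: "open U" "p \<in> U" and X: "smooth_vector_field_on A U X" and Y: "smooth_vector_field_on A U Y"
  shows "\<exists>L. \<forall>h V. open V \<longrightarrow> p \<in> V \<longrightarrow> smooth_fun_on A V h \<longrightarrow> vderiv A p L h =
    vderiv A p (X p) (\<lambda>q. vderiv A q (Y q) h) - vderiv A p (Y p) (\<lambda>q. vderiv A q (X q) h)"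
proof -
  let ?c = "chart_at A p"
  note c = chart_at[of p]
  let ?t = "snd ?c p"
  define comp where "comp Z x = components_in A ?c (chart_inv ?c x) (Z (chart_inv ?c x))" for Z x
  have comp_p: "comp Z ?t = components_in A ?c p (Z p)" for Z using c by (simp add: comp_def)
  \<comment> \<open>The coordinate formula for the bracket: derivative of \<open>Y\<close> along
    \<open>X\<close> minus derivative of \<open>X\<close> along \<open>Y\<close>. It does not
    involve \<open>h\<close>, so one vector serves all functions and neighbourhoods.\<close>
  define L where "L = frame ?c (frechet_derivative (comp Y) (at ?t) (comp X ?t) -
    frechet_derivative (comp X) (at ?t) (comp Y ?t)) p"
  \<comment> \<open>The first summand differentiates the components of \<open>W\<close>; the second
    is the Hessian of \<open>h\<close> on \<open>Z\<close> and \<open>W\<close>.\<close>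
  have second: "vderiv A p (Z p) (\<lambda>q. vderiv A q (W q) h) =
      frechet_derivative (h \<circ> chart_inv ?c) (at ?t) (frechet_derivative (comp W) (at ?t) (comp Z ?t)) +
      frechet_derivative (\<lambda>x. frechet_derivative (h \<circ> chart_inv ?c) (at x) (comp Z ?t)) (at ?t) (comp W ?t)"
    if V: "open V" "p \<in> V" and h: "smooth_fun_on A V h" and W: "smooth_vector_field_on A U W"
    for V h Z W
  proof -
    let ?H = "h \<circ> chart_inv ?c"
    let ?S = "snd ?c ` ((U \<inter> V) \<inter> fst ?c)"
    have S: "open ?S" "?t \<in> ?S" using open_chart_image c V U by blast+
    have H: "smooth_on ?S ?H" by (rule smooth_on_subset[OF smooth_fun_onD[OF h c(1)]]) auto
    have w: "smooth_on ?S (comp W)"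
      unfolding comp_def[abs_def]
      by (rule smooth_on_subset[OF W[unfolded smooth_vector_field_on_def, rule_format, OF c(1)]]) auto
    have hUV: "smooth_fun_on A (U \<inter> V) h" by (rule smooth_fun_on_subset[OF h]) auto
    have Wh: "smooth_fun_on A (U \<inter> V) (\<lambda>q. vderiv A q (W q) h)"
      using U V by (intro smooth_vderiv hUV smooth_vector_field_subset[OF W]) auto
    have *: "((\<lambda>q. vderiv A q (W q) h) \<circ> chart_inv ?c) x =
        (\<Sum>i\<in>Basis. (comp W x \<bullet> i) *\<^sub>R frechet_derivative ?H (at x) i)" if "x \<in> ?S" for x
    proof -
      have q: "chart_inv ?c x \<in> fst ?c" "chart_inv ?c x \<in> V" "snd ?c (chart_inv ?c x) = x"
        using that c by auto
      have "vderiv A (chart_inv ?c x) (W (chart_inv ?c x)) h = frechet_derivative ?H (at x) (comp W x)"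
        using vderiv_in_chart[OF c(1) q(1) smooth_fun_differentiable[OF h c(1) q(2,1)]] q(3)
        by (simp add: comp_def)
      then show ?thesis
        by (simp only: comp_apply frechet_derivative_basis_expand[OF smooth_on_differentiable[OF H that], symmetric])
    qed
    have D: "((\<lambda>x. \<Sum>i\<in>Basis. (comp W x \<bullet> i) *\<^sub>R frechet_derivative ?H (at x) i) has_derivative
        (\<lambda>v. \<Sum>i\<in>Basis. (comp W ?t \<bullet> i) *\<^sub>R frechet_derivative (\<lambda>x. frechet_derivative ?H (at x) i) (at ?t) v +
           (frechet_derivative (comp W) (at ?t) v \<bullet> i) *\<^sub>R frechet_derivative ?H (at ?t) i)) (at ?t)"
      by (intro has_derivative_sum has_derivative_scaleR has_derivative_inner_left
          smooth_on_has_derivative[OF w S(2)] smooth_on_has_derivative[OF smooth_on_frechet_derivative[OF H] S(2)])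
    have "((\<lambda>q. vderiv A q (W q) h) \<circ> chart_inv ?c has_derivative
        (\<lambda>v. \<Sum>i\<in>Basis. (comp W ?t \<bullet> i) *\<^sub>R frechet_derivative (\<lambda>x. frechet_derivative ?H (at x) i) (at ?t) v +
           (frechet_derivative (comp W) (at ?t) v \<bullet> i) *\<^sub>R frechet_derivative ?H (at ?t) i)) (at ?t)"
      by (rule has_derivative_transform_within_open[OF D S]) (rule *[symmetric])
    from frechet_derivative_eq[OF this]
    have "vderiv A p (Z p) (\<lambda>q. vderiv A q (W q) h) =
        (\<Sum>i\<in>Basis. (comp W ?t \<bullet> i) *\<^sub>R frechet_derivative (\<lambda>x. frechet_derivative ?H (at x) i) (at ?t) (comp Z ?t)) +
        (\<Sum>i\<in>Basis. (frechet_derivative (comp W) (at ?t) (comp Z ?t) \<bullet> i) *\<^sub>R frechet_derivative ?H (at ?t) i)"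
      using vderiv_in_chart[OF c smooth_fun_differentiable[OF Wh c(1) _ c(2)]] U V
      by (simp add: comp_p sum.distrib)
    also have "(\<Sum>i\<in>Basis. (comp W ?t \<bullet> i) *\<^sub>R frechet_derivative (\<lambda>x. frechet_derivative ?H (at x) i) (at ?t) (comp Z ?t)) =
      frechet_derivative (\<lambda>x. frechet_derivative ?H (at x) (comp Z ?t)) (at ?t) (comp W ?t)"
      by (subst symmetric_second_derivative[OF S H])
        (rule frechet_derivative_basis_expand[symmetric, OF smooth_on_differentiable[OF smooth_on_frechet_derivative[OF H] S(2)]])
    also have "(\<Sum>i\<in>Basis. (frechet_derivative (comp W) (at ?t) (comp Z ?t) \<bullet> i) *\<^sub>R frechet_derivative ?H (at ?t) i) =
      frechet_derivative ?H (at ?t) (frechet_derivative (comp W) (at ?t) (comp Z ?t))"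
      by (rule frechet_derivative_basis_expand[symmetric, OF smooth_on_differentiable[OF H S(2)]])
    finally show ?thesis by (simp only: add.commute)
  qed
  have "vderiv A p L h = vderiv A p (X p) (\<lambda>q. vderiv A q (Y q) h) - vderiv A p (Y p) (\<lambda>q. vderiv A q (X q) h)"
    if V: "open V" "p \<in> V" and h: "smooth_fun_on A V h" for V h
  proof -
    have H: "smooth_on (snd ?c ` (V \<inter> fst ?c)) (h \<circ> chart_inv ?c)" "?t \<in> snd ?c ` (V \<inter> fst ?c)"
      "open (snd ?c ` (V \<inter> fst ?c))"
      using smooth_fun_onD[OF h c(1)] c V open_chart_image by auto
    have l: "linear (frechet_derivative (h \<circ> chart_inv ?c) (at ?t))"
      using smooth_on_has_derivative[OF H(1,2)] has_derivative_linear by blast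
    show ?thesis
      unfolding second[OF V h X] second[OF V h Y] L_def vderiv_frame[OF c(1) h c(2) V(2)]
      using symmetric_second_derivative[OF H(3,2,1)] by (simp add: linear_diff[OF l])
  qed
  then show ?thesis by blast
qed

end

section \<open>Smooth maps\<close>

locale manifold_map = dom: manifold M + cod: manifold N
  for M :: "('p::{t2_space,second_countable_topology}, 'm::euclidean_space) chart set"
    and N :: "('q::{t2_space,second_countable_topology}, 'n::euclidean_space) chart set" +
  fixes f :: "'p \<Rightarrow> 'q"
  assumes smooth_map: "smooth_map M N f"
begin

abbreviation df :: "'p \<Rightarrow> 'm \<Rightarrow> 'n" where
  "df \<equiv> tangent_map M N f"

abbreviation fcoord :: "('q, 'n) chart \<Rightarrow> 'n \<Rightarrow> 'p \<Rightarrow> real" where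
  "fcoord d i \<equiv> (\<lambda>q. cod.coord d i (f q))"

lemma open_preimage: "open W \<Longrightarrow> open (f -` W)"
  using smooth_map by (simp add: smooth_map_def open_vimage)

lemma smooth_map_in_charts:
  "c \<in> M \<Longrightarrow> d \<in> N \<Longrightarrow> smooth_on (snd c ` (fst c \<inter> f -` fst d)) (snd d \<circ> f \<circ> chart_inv c)"
  using smooth_map unfolding smooth_map_def by blast

lemma df_has_derivative:
  "(snd (chart_at N (f p)) \<circ> f \<circ> chart_inv (chart_at M p) has_derivative df p) (at (snd (chart_at M p) p))"
  unfolding tangent_map_def
  by (rule smooth_on_has_derivative[OF smooth_map_in_charts])
    (auto simp: dom.chart_at cod.chart_at)

lemma linear_df: "linear (df p)"
  using df_has_derivative has_derivative_linear by blast

text \<open>The chain rule in the preferred charts. Through it \<open>df\<close> is handled as a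
  push-forward of derivations, without reference to those charts.\<close>

lemma vderiv_compose:
  assumes "smooth_fun_on N W h" "f p \<in> W"
  shows "vderiv M p v (\<lambda>q. h (f q)) = vderiv N (f p) (df p v) h"
proof -
  let ?c = "chart_at M p" and ?d = "chart_at N (f p)"
  note c = dom.chart_at[of p] and d = cod.chart_at[of "f p"]
  have 1: "(h \<circ> chart_inv ?d has_derivative (\<lambda>v. vderiv N (f p) v h)) (at ((snd ?d \<circ> f \<circ> chart_inv ?c) (snd ?c p)))"
    using cod.vderiv_has_derivative[OF assms] c by simp
  have 2: "((h \<circ> chart_inv ?d) \<circ> (snd ?d \<circ> f \<circ> chart_inv ?c) has_derivative
      (\<lambda>v. vderiv N (f p) v h) \<circ> df p) (at (snd ?c p))"
    by (rule diff_chain_at[OF df_has_derivative 1])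
  have "((\<lambda>q. h (f q)) \<circ> chart_inv ?c has_derivative (\<lambda>v. vderiv N (f p) v h) \<circ> df p) (at (snd ?c p))"
    by (rule has_derivative_transform_within_open[OF 2
          dom.open_chart_image[OF c(1) open_preimage[OF cod.open_chart[OF d(1)]]]])
      (use c d in auto)
  from dom.vderiv_eqI[OF this] show ?thesis by simp
qed

lemma smooth_fun_compose:
  assumes "open W" "smooth_fun_on N W h"
  shows "smooth_fun_on M (f -` W) (\<lambda>q. h (f q))"
proof (rule dom.smooth_fun_on_local)
  fix p assume p: "p \<in> f -` W"
  let ?c = "chart_at M p" and ?d = "chart_at N (f p)"
  note c = dom.chart_at[of p] and d = cod.chart_at[of "f p"]
  let ?V = "f -` (W \<inter> fst ?d) \<inter> fst ?c"
  have V: "open ?V" "?V \<subseteq> fst ?c"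
    using open_preimage[of "W \<inter> fst ?d"] assms(1) cod.open_chart[OF d(1)] dom.open_chart[OF c(1)] by auto
  have o: "open (snd ?c ` ?V)" using dom.open_chart_image_subset[OF c(1) V] .
  have "smooth_fun_on M ?V (\<lambda>q. h (f q))"
  proof (rule dom.smooth_fun_on_in_chart[OF c(1) V])
    have "smooth_on (snd ?c ` ?V) (\<lambda>x. (h \<circ> chart_inv ?d) ((snd ?d \<circ> f \<circ> chart_inv ?c) x))"
    proof (rule smooth_on_compose[OF o cod.open_chart_image[OF d(1) assms(1)]])
      show "(snd ?d \<circ> f \<circ> chart_inv ?c) ` snd ?c ` ?V \<subseteq> snd ?d ` (W \<inter> fst ?d)" using c by auto
      show "smooth_on (snd ?c ` ?V) (snd ?d \<circ> f \<circ> chart_inv ?c)"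
        by (rule smooth_on_subset[OF smooth_map_in_charts[OF c(1) d(1)]]) auto
      show "smooth_on (snd ?d ` (W \<inter> fst ?d)) (h \<circ> chart_inv ?d)"
        by (rule cod.smooth_fun_onD[OF assms(2) d(1)])
    qed
    then show "smooth_on (snd ?c ` ?V) ((\<lambda>q. h (f q)) \<circ> chart_inv ?c)"
      by (rule smooth_on_cong_imp[OF o, rotated]) (use c d in auto)
  qed
  then show "\<exists>V. open V \<and> p \<in> V \<and> smooth_fun_on M V (\<lambda>q. h (f q))"
    using V(1) p c d by (intro exI[of _ ?V]) auto
qed

lemma smooth_fcoord: "d \<in> N \<Longrightarrow> smooth_fun_on M (f -` fst d) (fcoord d i)"
  by (rule smooth_fun_compose[OF cod.open_chart cod.smooth_coord])

lemma vderiv_df_coord: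
  "d \<in> N \<Longrightarrow> f p \<in> fst d \<Longrightarrow> vderiv N (f p) (df p v) (cod.coord d i) = vderiv M p v (fcoord d i)"
  using vderiv_compose[OF cod.smooth_coord] by simp

lemma df_expand:
  assumes "d \<in> N" "f p \<in> fst d"
  shows "df p v = (\<Sum>i\<in>Basis. vderiv M p v (fcoord d i) *\<^sub>R cod.frame d i (f p))"
  using cod.frame_expand[OF assms, of "df p v"] by (simp add: vderiv_df_coord[OF assms])

text \<open>The matrix of \<open>df\<close> in preferred charts need not vary smoothly. The Jacobian
  in fixed charts does, and this identity connects the two.\<close>

lemma df_in_charts:
  assumes c: "c \<in> M" "p \<in> fst c" and d: "d \<in> N" "f p \<in> fst d"
  shows "frechet_derivative (snd d \<circ> f \<circ> chart_inv c) (at (snd c p)) (components_in M c p v) =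
    components_in N d (f p) (df p v)"
proof (rule euclidean_eqI)
  fix i :: 'n assume "i \<in> Basis"
  let ?F = "snd d \<circ> f \<circ> chart_inv c"
  have F: "(?F has_derivative frechet_derivative ?F (at (snd c p))) (at (snd c p))"
    by (rule smooth_on_has_derivative[OF smooth_map_in_charts]) (use c d in auto)
  have "((\<lambda>x. ?F x \<bullet> i) has_derivative (\<lambda>v. frechet_derivative ?F (at (snd c p)) v \<bullet> i)) (at (snd c p))"
    by (rule has_derivative_inner_left[OF F])
  then have *: "(fcoord d i \<circ> chart_inv c has_derivative (\<lambda>v. frechet_derivative ?F (at (snd c p)) v \<bullet> i)) (at (snd c p))"
    by (simp add: o_def cod.coord_def)
  have "vderiv M p v (fcoord d i) = frechet_derivative ?F (at (snd c p)) (components_in M c p v) \<bullet> i"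
    using dom.vderiv_in_chart[OF c differentiableI[OF *]] frechet_derivative_eq[OF *] by simp
  then show "frechet_derivative ?F (at (snd c p)) (components_in M c p v) \<bullet> i =
      components_in N d (f p) (df p v) \<bullet> i"
    by (simp add: cod.components_in_coord[OF d] vderiv_df_coord[OF d])
qed

text \<open>In charts the components of \<open>X\<close> solve a linear system whose coefficients are the smooth
  and pointwise injective Jacobian of \<open>f\<close>.\<close>

lemma smooth_vector_field_immersion:
  assumes inj: "\<And>p. inj (df p)" and U: "open U" "U \<subseteq> f -` fst d" and d: "d \<in> N"
    and X: "\<And>i. i \<in> Basis \<Longrightarrow> smooth_fun_on M U (\<lambda>q. vderiv N (f q) (df q (X q)) (cod.coord d i))"
  shows "smooth_vector_field_on M U X"
proof (rule dom.smooth_vector_field_local[OF U(1)])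
  fix p assume p: "p \<in> U"
  let ?c = "chart_at M p"
  note c = dom.chart_at[of p]
  let ?V = "U \<inter> fst ?c"
  let ?S = "snd ?c ` ?V"
  let ?F = "snd d \<circ> f \<circ> chart_inv ?c"
  have V: "open ?V" "?V \<subseteq> fst ?c" using U dom.open_chart[OF c(1)] by auto
  have S: "open ?S" by (rule dom.open_chart_image[OF c(1) U(1)])
  have F: "smooth_on ?S ?F"
    by (rule smooth_on_subset[OF smooth_map_in_charts[OF c(1) d]]) (use U in auto)
  define w where "w x = components_in M ?c (chart_inv ?c x) (X (chart_inv ?c x))" for x
  define z where "z x = components_in N d (f (chart_inv ?c x)) (df (chart_inv ?c x) (X (chart_inv ?c x)))" for x
  have "smooth_on ?S w"
  proof (rule smooth_on_linear_solve[OF S, where A = "\<lambda>x. frechet_derivative ?F (at x)"])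
    fix x assume x: "x \<in> ?S"
    then obtain q where q: "q \<in> U" "q \<in> fst ?c" "x = snd ?c q" by auto
    then have fq: "f q \<in> fst d" using U by auto
    show l: "linear (frechet_derivative ?F (at x))"
      using smooth_on_has_derivative[OF F x] has_derivative_linear by blast
    show "frechet_derivative ?F (at x) (w x) = z x"
      using df_in_charts[OF c(1) q(2) d fq, of "X q"] q c by (simp add: w_def z_def)
    show "inj (frechet_derivative ?F (at x))"
      unfolding linear_injective_0[OF l]
    proof (intro allI impI)
      \<comment> \<open>A kernel vector of the Jacobian is the component vector of
        \<open>dom.frame ?c u q\<close>, which \<open>df q\<close> must send to 0.\<close>
      fix u assume u: "frechet_derivative ?F (at x) u = 0"
      have "components_in N d (f q) (df q (dom.frame ?c u q)) = 0"
        using df_in_charts[OF c(1) q(2) d fq, of "dom.frame ?c u q"] u q(3)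
        by (simp add: dom.components_in_frame[OF c(1) q(2)])
      then have "df q (dom.frame ?c u q) = 0"
        using cod.bij_components_in[OF d fq] linear_0[OF cod.linear_components_in[OF d fq]]
        by (metis bij_def injD)
      then have "dom.frame ?c u q = 0" using inj[of q] linear_0[OF linear_df] by (metis injD)
      then show "u = 0"
        using dom.components_in_frame[OF c(1) q(2), of u] linear_0[OF dom.linear_components_in[OF c(1) q(2)]]
        by simp
    qed
  next
    show "smooth_on ?S (\<lambda>x. frechet_derivative ?F (at x) u)" for u
      by (rule smooth_on_frechet_derivative[OF F])
    have "smooth_on ?S (\<lambda>x. z x \<bullet> i)" if "i \<in> Basis" for i
    proof -
      have "smooth_on ?S ((\<lambda>q. vderiv N (f q) (df q (X q)) (cod.coord d i)) \<circ> chart_inv ?c)"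
        by (rule dom.smooth_fun_onD[OF X[OF that] c(1)])
      then show ?thesis
        by (rule smooth_on_cong_imp[OF S, rotated])
          (use U c d in \<open>auto simp: z_def cod.components_in_coord\<close>)
    qed
    then show "smooth_on ?S z" by (subst smooth_on_componentwise[OF S]) blast
  qed
  then have w: "smooth_on ?S (\<lambda>x. w x \<bullet> i)" if "i \<in> Basis" for i
    using that by (subst (asm) smooth_on_componentwise[OF S]) blast
  have "smooth_fun_on M ?V (\<lambda>q. vderiv M q (X q) (dom.coord ?c i))" if "i \<in> Basis" for i
    by (rule dom.smooth_fun_on_in_chart[OF c(1) V], rule smooth_on_cong_imp[OF S, of "\<lambda>x. w x \<bullet> i"])
      (use c w[OF that] in \<open>auto simp: w_def dom.components_in_coord\<close>)
  then have "smooth_vector_field_on M ?V X" by (rule dom.smooth_vector_field_in_chart[OF c(1) V])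
  then show "\<exists>V. open V \<and> p \<in> V \<and> smooth_vector_field_on M V X" using V p c by blast
qed

end

section \<open>The pullback connection\<close>

locale connection_along_map = manifold_map M N f
  for M :: "('p::{t2_space,second_countable_topology}, 'm::euclidean_space) chart set"
    and N :: "('q::{t2_space,second_countable_topology}, 'n::euclidean_space) chart set"
    and f :: "'p \<Rightarrow> 'q" +
  fixes nabla :: "('q, 'n) connection"
  assumes affine: "affine_connection N nabla"
begin

lemmas affine_at = affine[unfolded affine_connection_def, THEN spec, THEN spec, THEN mp, THEN mp]

lemma linear_nabla:
  "open W \<Longrightarrow> smooth_vector_field_on N W Y \<Longrightarrow> y \<in> W \<Longrightarrow> linear (\<lambda>v. nabla y v Y)"
  by (rule affine_at[THEN conjunct1, rule_format])

lemma nabla_add: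
  "open W \<Longrightarrow> smooth_vector_field_on N W Y \<Longrightarrow> smooth_vector_field_on N W Z \<Longrightarrow> y \<in> W \<Longrightarrow>
    nabla y v (\<lambda>q. Y q + Z q) = nabla y v Y + nabla y v Z"
  by (rule affine_at[THEN conjunct2, THEN conjunct1, rule_format])

lemma nabla_scale:
  "open W \<Longrightarrow> smooth_vector_field_on N W Y \<Longrightarrow> smooth_fun_on N W h \<Longrightarrow> y \<in> W \<Longrightarrow>
    nabla y v (\<lambda>q. h q *\<^sub>R Y q) = vderiv N y v h *\<^sub>R Y y + h y *\<^sub>R nabla y v Y"
  by (rule affine_at[THEN conjunct2, THEN conjunct2, THEN conjunct1, rule_format])

lemma nabla_cong:
  "open W \<Longrightarrow> smooth_vector_field_on N W Y \<Longrightarrow> (\<And>q. q \<in> W \<Longrightarrow> Z q = Y q) \<Longrightarrow> y \<in> W \<Longrightarrow>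
    nabla y v Z = nabla y v Y"
  by (rule affine_at[THEN conjunct2, THEN conjunct2, THEN conjunct2, THEN conjunct1, rule_format])

lemma smooth_nabla:
  "open W \<Longrightarrow> smooth_vector_field_on N W Y \<Longrightarrow> smooth_vector_field_on N W X \<Longrightarrow>
    smooth_vector_field_on N W (\<lambda>p. nabla p (X p) Y)"
  by (rule affine_at[THEN conjunct2, THEN conjunct2, THEN conjunct2, THEN conjunct2, rule_format])

lemma nabla_combination:
  assumes W: "open W" "y \<in> W" and "finite I"
    and "\<And>i. i \<in> I \<Longrightarrow> smooth_fun_on N W (a i)" "\<And>i. i \<in> I \<Longrightarrow> smooth_vector_field_on N W (X i)"
  shows "nabla y v (\<lambda>q. \<Sum>i\<in>I. a i q *\<^sub>R X i q) =
    (\<Sum>i\<in>I. vderiv N y v (a i) *\<^sub>R X i y + a i y *\<^sub>R nabla y v (X i))"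
  using assms(3-5)
proof (induction I rule: finite_induct)
  case empty
  have "smooth_vector_field_on N W (\<lambda>q. 0)"
    using cod.smooth_vector_field_combination[OF W(1), of "{}"] by simp
  \<comment> \<open>The zero field is 0 times itself, so the Leibniz rule gives it derivative
    0.\<close>
  from nabla_scale[OF W(1) this cod.smooth_fun_on_const W(2), of v 0] show ?case by simp
next
  case (insert j I)
  have 1: "smooth_vector_field_on N W (\<lambda>q. a j q *\<^sub>R X j q)"
    using cod.smooth_vector_field_combination[OF W(1), of "{j}" a X] insert.prems by simp
  have 2: "smooth_vector_field_on N W (\<lambda>q. \<Sum>i\<in>I. a i q *\<^sub>R X i q)"
    using insert.prems by (intro cod.smooth_vector_field_combination W(1)) auto
  have "nabla y v (\<lambda>q. \<Sum>i\<in>insert j I. a i q *\<^sub>R X i q) =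
      nabla y v (\<lambda>q. a j q *\<^sub>R X j q + (\<Sum>i\<in>I. a i q *\<^sub>R X i q))"
    using insert.hyps by simp
  also have "\<dots> = nabla y v (\<lambda>q. a j q *\<^sub>R X j q) + nabla y v (\<lambda>q. \<Sum>i\<in>I. a i q *\<^sub>R X i q)"
    by (rule nabla_add[OF W(1) 1 2 W(2)])
  also have "nabla y v (\<lambda>q. a j q *\<^sub>R X j q) = vderiv N y v (a j) *\<^sub>R X j y + a j y *\<^sub>R nabla y v (X j)"
    using insert.prems by (intro nabla_scale[OF W(1) _ _ W(2)]) auto
  finally show ?case using insert by simp
qed

text \<open>Covariant derivative of a vector field \<open>Z\<close> along \<open>f\<close>, that is \<open>Z q\<close> is a tangent vector of
  \<open>N\<close> at \<open>f q\<close>.\<close>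

definition cov :: "'p \<Rightarrow> 'm \<Rightarrow> ('p \<Rightarrow> 'n) \<Rightarrow> 'n" where
  "cov p v Z = (let d = chart_at N (f p) in
     \<Sum>i\<in>Basis. vderiv M p v (\<lambda>q. vderiv N (f q) (Z q) (cod.coord d i)) *\<^sub>R cod.frame d i (f p) +
       vderiv N (f p) (Z p) (cod.coord d i) *\<^sub>R nabla (f p) (df p v) (cod.frame d i))"

text \<open>Well-definedness of the pullback connection: \<open>cov\<close> may be computed from any
  finite expansion of \<open>Z\<close> by ambient fields. Each \<open>X j\<close> is rewritten in
  the coordinate frame used by \<open>cov\<close>, and the product rule on \<open>M\<close> is
  matched with the Leibniz rule on \<open>N\<close>.\<close>

lemma cov_combination:
  assumes U: "open U" "p \<in> U" and W: "open W" "f ` U \<subseteq> W" and J: "finite J"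
    and a: "\<And>j. j \<in> J \<Longrightarrow> smooth_fun_on M U (a j)"
    and X: "\<And>j. j \<in> J \<Longrightarrow> smooth_vector_field_on N W (X j)"
    and Z: "\<And>q. q \<in> U \<Longrightarrow> Z q = (\<Sum>j\<in>J. a j q *\<^sub>R X j (f q))"
  shows "cov p v Z = (\<Sum>j\<in>J. vderiv M p v (a j) *\<^sub>R X j (f p) + a j p *\<^sub>R nabla (f p) (df p v) (X j))"
proof -
  let ?d = "chart_at N (f p)"
  note d = cod.chart_at[of "f p"]
  define W' where "W' = W \<inter> fst ?d"
  define U' where "U' = U \<inter> f -` W'"
  have W': "open W'" "f p \<in> W'" "W' \<subseteq> fst ?d" using W U d cod.open_chart[OF d(1)] by (auto simp: W'_def)
  have U': "open U'" "p \<in> U'" "U' \<subseteq> U" "U' \<subseteq> f -` W'" using U W' open_preimage[OF W'(1)] by (auto simp: U'_def)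
  define x where "x j i r = vderiv N r (X j r) (cod.coord ?d i)" for j i r
  define E where "E i = cod.frame ?d i" for i
  have E: "smooth_vector_field_on N W' (E i)" for i
    unfolding E_def by (rule cod.smooth_vector_field_subset[OF cod.smooth_frame[OF d(1)] W'(3)])
  have XW': "smooth_vector_field_on N W' (X j)" if "j \<in> J" for j
    by (rule cod.smooth_vector_field_subset[OF X[OF that]]) (simp add: W'_def)
  have x: "smooth_fun_on N W' (x j i)" if "j \<in> J" for j i
    unfolding x_def[abs_def] using that
    by (intro cod.smooth_vderiv W' XW' cod.smooth_fun_on_subset[OF cod.smooth_coord[OF d(1)] W'(3)])
  have xf: "smooth_fun_on M U' (\<lambda>q. x j i (f q))" if "j \<in> J" for j i
    by (rule dom.smooth_fun_on_subset[OF smooth_fun_compose[OF W'(1) x[OF that]] U'(4)])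
  have aU': "smooth_fun_on M U' (a j)" if "j \<in> J" for j
    by (rule dom.smooth_fun_on_subset[OF a[OF that] U'(3)])
  have comp: "vderiv N (f q) (Z q) (cod.coord ?d i) = (\<Sum>j\<in>J. a j q * x j i (f q))" if "q \<in> U'" for q i
  proof -
    have "f q \<in> fst ?d" using that U' W' by auto
    then have l: "linear (\<lambda>v. vderiv N (f q) v (cod.coord ?d i))"
      by (rule cod.linear_vderiv[OF cod.smooth_coord[OF d(1)]])
    show ?thesis using that U'(3) by (subst Z) (auto simp: linear_sum[OF l] linear_scale[OF l] x_def)
  qed
  have dcomp: "vderiv M p v (\<lambda>q. vderiv N (f q) (Z q) (cod.coord ?d i)) =
      (\<Sum>j\<in>J. vderiv M p v (a j) * x j i (f p) + a j p * vderiv N (f p) (df p v) (x j i))" for i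
  proof -
    have "vderiv M p v (\<lambda>q. vderiv N (f q) (Z q) (cod.coord ?d i)) =
        vderiv M p v (\<lambda>q. \<Sum>j\<in>J. a j q * x j i (f q))"
      by (rule dom.vderiv_cong[OF U'(1,2)])
        (use comp in \<open>auto intro!: dom.smooth_fun_on_sum dom.smooth_fun_on_mult U' aU' xf\<close>)
    also have "\<dots> = (\<Sum>j\<in>J. vderiv M p v (\<lambda>q. a j q * x j i (f q)))"
      by (rule dom.vderiv_sum[OF U'(2)]) (intro dom.smooth_fun_on_mult U' aU' xf)
    also have "\<dots> = (\<Sum>j\<in>J. vderiv M p v (a j) * x j i (f p) + a j p * vderiv N (f p) (df p v) (x j i))"
      by (rule sum.cong[OF refl])
        (simp add: dom.vderiv_mult[OF U'(2) aU' xf] vderiv_compose[OF x W'(2)])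
    finally show ?thesis .
  qed
  have Xp: "X j r = (\<Sum>i\<in>Basis. x j i r *\<^sub>R E i r)" if "r \<in> W'" for j r
    unfolding x_def E_def using that W'(3) by (intro cod.frame_expand[OF d(1)]) auto
  \<comment> \<open>The derivatives of the components \<open>x j i\<close> appear here and, by the
    chain rule, in \<open>dcomp\<close>; after exchanging the sums the terms correspond one to
    one.\<close>
  have nX: "nabla (f p) u (X j) = (\<Sum>i\<in>Basis. vderiv N (f p) u (x j i) *\<^sub>R E i (f p) + x j i (f p) *\<^sub>R nabla (f p) u (E i))"
    if "j \<in> J" for j u
  proof -
    have "nabla (f p) u (X j) = nabla (f p) u (\<lambda>r. \<Sum>i\<in>Basis. x j i r *\<^sub>R E i r)"
      by (rule nabla_cong[OF W'(1)])
        (auto intro!: cod.smooth_vector_field_combination W' x that E simp: Xp)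
    also have "\<dots> = (\<Sum>i\<in>Basis. vderiv N (f p) u (x j i) *\<^sub>R E i (f p) + x j i (f p) *\<^sub>R nabla (f p) u (E i))"
      by (rule nabla_combination[OF W'(1,2)]) (auto intro: x that E)
    finally show ?thesis .
  qed
  let ?u = "df p v"
  have "cov p v Z = (\<Sum>i\<in>Basis. \<Sum>j\<in>J.
      (vderiv M p v (a j) * x j i (f p) + a j p * vderiv N (f p) ?u (x j i)) *\<^sub>R E i (f p) +
      (a j p * x j i (f p)) *\<^sub>R nabla (f p) ?u (E i))"
    unfolding cov_def Let_def dcomp comp[OF U'(2)] E_def[symmetric]
    by (simp add: scaleR_left.sum scaleR_add_left sum.distrib)
  also have "\<dots> = (\<Sum>j\<in>J. \<Sum>i\<in>Basis.
      (vderiv M p v (a j) * x j i (f p) + a j p * vderiv N (f p) ?u (x j i)) *\<^sub>R E i (f p) +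
      (a j p * x j i (f p)) *\<^sub>R nabla (f p) ?u (E i))"
    by (rule sum.swap)
  also have "\<dots> = (\<Sum>j\<in>J. vderiv M p v (a j) *\<^sub>R X j (f p) + a j p *\<^sub>R nabla (f p) ?u (X j))"
  proof (rule sum.cong[OF refl])
    fix j assume j: "j \<in> J"
    show "(\<Sum>i\<in>Basis. (vderiv M p v (a j) * x j i (f p) + a j p * vderiv N (f p) ?u (x j i)) *\<^sub>R E i (f p) +
        (a j p * x j i (f p)) *\<^sub>R nabla (f p) ?u (E i)) =
      vderiv M p v (a j) *\<^sub>R X j (f p) + a j p *\<^sub>R nabla (f p) ?u (X j)"
      unfolding nX[OF j] Xp[OF W'(2), of j]
      by (simp add: scaleR_right.sum sum.distrib[symmetric] scaleR_add_left scaleR_add_right add.assoc)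
  qed
  finally show ?thesis .
qed

text \<open>The expansion by a single field with coefficient 1. It links \<open>cov\<close> to
  derivatives of local extensions.\<close>

lemma cov_restriction:
  assumes "open U" "p \<in> U" "open W" "f ` U \<subseteq> W" "smooth_vector_field_on N W X" "\<And>q. q \<in> U \<Longrightarrow> Z q = X (f q)"
  shows "cov p v Z = nabla (f p) (df p v) X"
  using cov_combination[OF assms(1-4), of "{()}" "\<lambda>_ _. 1" "\<lambda>_. X" Z v] assms(5,6)
  by (simp add: dom.smooth_fun_on_const)

context
  fixes d assumes d: "d \<in> N"
begin

text \<open>The working formula for tangent fields. It allows any ambient chart \<open>d\<close>
  around \<open>f p\<close>, so \<open>d\<close> can be kept fixed while \<open>p\<close>
  varies.\<close>

lemma cov_df:
  assumes U: "open U" "p \<in> U" "f p \<in> fst d" and Y: "smooth_vector_field_on M U Y"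
    and Z: "\<And>q. q \<in> U \<Longrightarrow> Z q = df q (Y q)"
  shows "cov p v Z = (\<Sum>i\<in>Basis. vderiv M p v (\<lambda>q. vderiv M q (Y q) (fcoord d i)) *\<^sub>R cod.frame d i (f p) +
    vderiv M p (Y p) (fcoord d i) *\<^sub>R nabla (f p) (df p v) (cod.frame d i))"
proof (rule cov_combination)
  let ?U = "U \<inter> f -` fst d"
  show o: "open ?U" using U open_preimage[OF cod.open_chart[OF d]] by blast
  show "p \<in> ?U" "open (fst d)" "f ` ?U \<subseteq> fst d" using U cod.open_chart[OF d] by auto
  show "smooth_fun_on M ?U (\<lambda>q. vderiv M q (Y q) (fcoord d i))" for i
    by (intro dom.smooth_vderiv o dom.smooth_vector_field_subset[OF Y] dom.smooth_fun_on_subset[OF smooth_fcoord[OF d]]) auto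
  show "smooth_vector_field_on N (fst d) (cod.frame d i)" for i by (rule cod.smooth_frame[OF d])
  show "Z q = (\<Sum>i\<in>Basis. vderiv M q (Y q) (fcoord d i) *\<^sub>R cod.frame d i (f q))" if "q \<in> ?U" for q
    using that by (subst df_expand[OF d, symmetric]) (auto simp: Z)
qed simp

lemma smooth_vderiv_fcoord:
  assumes "open U" "U \<subseteq> f -` fst d" "smooth_vector_field_on M U Y"
  shows "smooth_fun_on M U (\<lambda>q. vderiv M q (Y q) (fcoord d i))"
  by (rule dom.smooth_vderiv[OF assms(1,3) dom.smooth_fun_on_subset[OF smooth_fcoord[OF d] assms(2)]])

lemma nabla_df_frame:
  assumes "f p \<in> fst d"
  shows "nabla (f p) (df p v) (cod.frame d i) =
    (\<Sum>j\<in>Basis. vderiv M p v (fcoord d j) *\<^sub>R nabla (f p) (cod.frame d j (f p)) (cod.frame d i))"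
proof -
  have l: "linear (\<lambda>u. nabla (f p) u (cod.frame d i))"
    by (rule linear_nabla[OF cod.open_chart[OF d] cod.smooth_frame[OF d] assms])
  show ?thesis
    by (subst df_expand[OF d assms]) (simp add: linear_sum[OF l] linear_scale[OF l])
qed

lemma smooth_cov_df:
  assumes U: "open U" "U \<subseteq> f -` fst d" and X: "smooth_vector_field_on M U X" and Y: "smooth_vector_field_on M U Y"
  shows "smooth_fun_on M U (\<lambda>q. vderiv N (f q) (cov q (X q) (\<lambda>r. df r (Y r))) (cod.coord d k))"
proof -
  note E = cod.smooth_frame[OF d] and od = cod.open_chart[OF d]
  let ?x = "\<lambda>i q. vderiv M q (X q) (fcoord d i)" and ?y = "\<lambda>i q. vderiv M q (Y q) (fcoord d i)"
  \<comment> \<open>These are the Christoffel symbols of \<open>nabla\<close> in the chart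
    \<open>d\<close>.\<close>
  let ?G = "\<lambda>i j r. vderiv N r (nabla r (cod.frame d j r) (cod.frame d i)) (cod.coord d k)"
  have x: "smooth_fun_on M U (?x i)" and y: "smooth_fun_on M U (?y i)" for i
    by (rule smooth_vderiv_fcoord[OF U X] smooth_vderiv_fcoord[OF U Y])+
  have xy: "smooth_fun_on M U (\<lambda>q. vderiv M q (X q) (?y i))" for i
    by (rule dom.smooth_vderiv[OF U(1) X y])
  have "smooth_fun_on N (fst d) (?G i j)" for i j
    by (rule cod.smooth_vderiv[OF od smooth_nabla[OF od E E] cod.smooth_coord[OF d]])
  from smooth_fun_compose[OF od this] have G: "smooth_fun_on M U (\<lambda>q. ?G i j (f q))" for i j
    using U(2) by (rule dom.smooth_fun_on_subset)
  have "smooth_fun_on M U (\<lambda>q. \<Sum>i\<in>Basis. vderiv M q (X q) (?y i) * (i \<bullet> k) +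
      ?y i q * (\<Sum>j\<in>Basis. ?x j q * ?G i j (f q)))"
    by (intro dom.smooth_fun_on_sum dom.smooth_fun_on_add dom.smooth_fun_on_mult U(1) x y xy G dom.smooth_fun_on_const)
  then show ?thesis
  proof (rule dom.smooth_fun_on_cong[OF U(1)])
    fix q assume q: "q \<in> U"
    then have fq: "f q \<in> fst d" using U by auto
    have l: "linear (\<lambda>v. vderiv N (f q) v (cod.coord d k))"
      by (rule cod.linear_vderiv[OF cod.smooth_coord[OF d] fq])
    show "(\<Sum>i\<in>Basis. vderiv M q (X q) (?y i) * (i \<bullet> k) + ?y i q * (\<Sum>j\<in>Basis. ?x j q * ?G i j (f q))) =
        vderiv N (f q) (cov q (X q) (\<lambda>r. df r (Y r))) (cod.coord d k)"
      unfolding cov_df[OF U(1) q fq Y refl] nabla_df_frame[OF fq]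
      by (simp add: linear_sum[OF l] linear_scale[OF l] linear_add[OF l] cod.vderiv_frame_coord[OF d fq])
  qed
qed

text \<open>Coordinate fields have constant components, so the bracket terms of the torsion identity
  vanish on coordinate functions. This is the symmetry of the Christoffel symbols in their lower
  indices.\<close>

lemma frame_nabla_commute:
  assumes "torsion_free N nabla" "y \<in> fst d"
  shows "nabla y (cod.frame d i y) (cod.frame d j) = nabla y (cod.frame d j y) (cod.frame d i)"
proof (rule cod.tangent_vector_eqI[OF d assms(2)])
  note E = cod.smooth_frame[OF d] and od = cod.open_chart[OF d]
  fix k
  have const: "vderiv N y u (\<lambda>q. vderiv N q (cod.frame d w q) (cod.coord d k)) = 0" for u w
    using cod.vderiv_cong[OF od assms(2) cod.smooth_fun_on_const, of "w \<bullet> k" _ u]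
    by (simp add: cod.vderiv_frame_coord[OF d])
  have l: "linear (\<lambda>v. vderiv N y v (cod.coord d k))"
    by (rule cod.linear_vderiv[OF cod.smooth_coord[OF d] assms(2)])
  have "vderiv N y (nabla y (cod.frame d i y) (cod.frame d j) - nabla y (cod.frame d j y) (cod.frame d i)) (cod.coord d k) = 0"
    using assms(1)[unfolded torsion_free_def, rule_format, OF od E E cod.smooth_coord[OF d] assms(2)]
    by (simp add: const)
  then show "vderiv N y (nabla y (cod.frame d i y) (cod.frame d j)) (cod.coord d k) =
      vderiv N y (nabla y (cod.frame d j y) (cod.frame d i)) (cod.coord d k)"
    by (simp add: linear_diff[OF l])
qed

end

text \<open>Symmetry of the Christoffel symbols cancels the connection terms. What remains is the
  commutator of \<open>X\<close> and \<open>Y\<close> on the coordinates of \<open>f\<close>, which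
  the hypothesis identifies with the action of \<open>L\<close>.\<close>

lemma cov_df_bracket:
  assumes tf: "torsion_free N nabla" and U: "open U" "p \<in> U"
    and X: "smooth_vector_field_on M U X" and Y: "smooth_vector_field_on M U Y"
    and L: "\<And>h V. open V \<Longrightarrow> p \<in> V \<Longrightarrow> smooth_fun_on M V h \<Longrightarrow> vderiv M p L h =
      vderiv M p (X p) (\<lambda>q. vderiv M q (Y q) h) - vderiv M p (Y p) (\<lambda>q. vderiv M q (X q) h)"
  shows "cov p (X p) (\<lambda>q. df q (Y q)) - cov p (Y p) (\<lambda>q. df q (X q)) = df p L"
proof -
  let ?d = "chart_at N (f p)"
  note d = cod.chart_at[of "f p"]
  let ?E = "\<lambda>i. cod.frame ?d i" and ?x = "\<lambda>i. vderiv M p (X p) (fcoord ?d i)" and ?y = "\<lambda>i. vderiv M p (Y p) (fcoord ?d i)"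
  have sym: "(\<Sum>i\<in>Basis. ?y i *\<^sub>R nabla (f p) (df p (X p)) (?E i)) = (\<Sum>i\<in>Basis. ?x i *\<^sub>R nabla (f p) (df p (Y p)) (?E i))"
  proof -
    have "(\<Sum>i\<in>Basis. ?y i *\<^sub>R nabla (f p) (df p (X p)) (?E i)) =
        (\<Sum>i\<in>Basis. \<Sum>j\<in>Basis. (?y i * ?x j) *\<^sub>R nabla (f p) (?E j (f p)) (?E i))"
      by (simp add: nabla_df_frame[OF d] scaleR_right.sum)
    also have "\<dots> = (\<Sum>j\<in>Basis. \<Sum>i\<in>Basis. (?y i * ?x j) *\<^sub>R nabla (f p) (?E j (f p)) (?E i))"
      by (rule sum.swap)
    also have "\<dots> = (\<Sum>j\<in>Basis. \<Sum>i\<in>Basis. (?x j * ?y i) *\<^sub>R nabla (f p) (?E i (f p)) (?E j))"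
      by (intro sum.cong refl) (metis frame_nabla_commute[OF d(1) tf d(2)] mult.commute)
    also have "\<dots> = (\<Sum>i\<in>Basis. ?x i *\<^sub>R nabla (f p) (df p (Y p)) (?E i))"
      by (simp add: nabla_df_frame[OF d] scaleR_right.sum)
    finally show ?thesis .
  qed
  have "cov p (X p) (\<lambda>q. df q (Y q)) - cov p (Y p) (\<lambda>q. df q (X q)) =
      (\<Sum>i\<in>Basis. (vderiv M p (X p) (\<lambda>q. vderiv M q (Y q) (fcoord ?d i)) -
         vderiv M p (Y p) (\<lambda>q. vderiv M q (X q) (fcoord ?d i))) *\<^sub>R ?E i (f p))"
    unfolding cov_df[OF d(1) U d(2) X refl] cov_df[OF d(1) U d(2) Y refl]
    by (simp add: sum.distrib sym scaleR_diff_left sum_subtractf)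
  also have "\<dots> = df p L"
    unfolding df_expand[OF d]
    using L[OF open_preimage[OF cod.open_chart[OF d(1)]] _ smooth_fcoord[OF d(1)]] d(2) by simp
  finally show ?thesis .
qed

text \<open>\<open>Z\<close> is expanded by the images of the coordinate fields under
  \<open>\<phi>\<close>, with the same coefficients as \<open>df q (Y q)\<close>. As
  \<open>\<phi>\<close> is parallel, it can be pulled out of every term.\<close>

lemma cov_parallel_endo:
  assumes phi: "endo_field N \<phi>" "parallel_endo N nabla \<phi>" and U: "open U" "p \<in> U"
    and Y: "smooth_vector_field_on M U Y"
    and Z: "\<And>q. q \<in> U \<Longrightarrow> Z q = \<phi> (f q) (df q (Y q))"
  shows "cov p v Z = \<phi> (f p) (cov p v (\<lambda>q. df q (Y q)))"
proof -
  let ?d = "chart_at N (f p)"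
  note d = cod.chart_at[of "f p"]
  let ?U = "U \<inter> f -` fst ?d"
  note E = cod.smooth_frame[OF d(1)] and od = cod.open_chart[OF d(1)]
  have o: "open ?U" "p \<in> ?U" "f ` ?U \<subseteq> fst ?d" using U d open_preimage[OF od] by auto
  have l: "linear (\<phi> y)" for y using phi(1) by (simp add: endo_field_def)
  have par: "nabla (f p) u (\<lambda>q. \<phi> q (cod.frame ?d i q)) = \<phi> (f p) (nabla (f p) u (cod.frame ?d i))" for u i
    using phi(2) od E d(2) unfolding parallel_endo_def cov_deriv_endo_def by (metis eq_iff_diff_eq_0)
  have "cov p v Z = (\<Sum>i\<in>Basis. vderiv M p v (\<lambda>q. vderiv M q (Y q) (fcoord ?d i)) *\<^sub>R \<phi> (f p) (cod.frame ?d i (f p)) +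
    vderiv M p (Y p) (fcoord ?d i) *\<^sub>R nabla (f p) (df p v) (\<lambda>r. \<phi> r (cod.frame ?d i r)))"
  proof (rule cov_combination[OF o(1,2) od o(3)])
    show "smooth_fun_on M ?U (\<lambda>q. vderiv M q (Y q) (fcoord ?d i))" for i
      by (rule smooth_vderiv_fcoord[OF d(1) o(1) _ dom.smooth_vector_field_subset[OF Y]]) auto
    show "smooth_vector_field_on N (fst ?d) (\<lambda>r. \<phi> r (cod.frame ?d i r))" for i
      using phi(1) od E unfolding endo_field_def by blast
    show "Z q = (\<Sum>i\<in>Basis. vderiv M q (Y q) (fcoord ?d i) *\<^sub>R \<phi> (f q) (cod.frame ?d i (f q)))" if "q \<in> ?U" for q
      using that by (simp add: Z df_expand[OF d(1), of q "Y q"] linear_sum[OF l] linear_scale[OF l])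
  qed simp
  also have "\<dots> = \<phi> (f p) (cov p v (\<lambda>q. df q (Y q)))"
    unfolding cov_df[OF d(1) U d(2) Y refl]
    by (simp add: par linear_sum[OF l] linear_scale[OF l] linear_add[OF l])
  finally show ?thesis .
qed

lemma linear_cov_df:
  assumes U: "open U" "p \<in> U" and Y: "smooth_vector_field_on M U Y"
  shows "linear (\<lambda>v. cov p v (\<lambda>q. df q (Y q)))"
proof -
  let ?d = "chart_at N (f p)"
  note d = cod.chart_at[of "f p"]
  let ?U = "U \<inter> f -` fst ?d"
  have o: "open ?U" "p \<in> ?U" using U d open_preimage[OF cod.open_chart[OF d(1)]] by auto
  have "smooth_fun_on M ?U (\<lambda>q. vderiv M q (Y q) (fcoord ?d i))" for i
    by (rule smooth_vderiv_fcoord[OF d(1) o(1) _ dom.smooth_vector_field_subset[OF Y]]) auto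
  from dom.linear_vderiv[OF this o(2)]
  have 1: "linear (\<lambda>v. vderiv M p v (\<lambda>q. vderiv M q (Y q) (fcoord ?d i)))" for i .
  have "linear (\<lambda>u. nabla (f p) u (cod.frame ?d i))" for i
    by (rule linear_nabla[OF cod.open_chart[OF d(1)] cod.smooth_frame[OF d(1)] d(2)])
  from linear_compose[OF linear_df this]
  have 2: "linear (\<lambda>v. nabla (f p) (df p v) (cod.frame ?d i))" for i by (simp add: o_def)
  show ?thesis
    unfolding cov_df[OF d(1) U d(2) Y refl]
    by (rule linearI) (simp_all add: linear_add[OF 1] linear_add[OF 2] linear_scale[OF 1] linear_scale[OF 2]
        algebra_simps sum.distrib scaleR_right.sum)
qed

lemma cov_df_add:
  assumes U: "open U" "p \<in> U" and Y: "smooth_vector_field_on M U Y" and Z: "smooth_vector_field_on M U Z"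
  shows "cov p v (\<lambda>q. df q (Y q + Z q)) = cov p v (\<lambda>q. df q (Y q)) + cov p v (\<lambda>q. df q (Z q))"
proof -
  let ?d = "chart_at N (f p)"
  note d = cod.chart_at[of "f p"]
  let ?U = "U \<inter> f -` fst ?d"
  have o: "open ?U" "p \<in> ?U" using U d open_preimage[OF cod.open_chart[OF d(1)]] by auto
  have s: "smooth_fun_on M ?U (\<lambda>q. vderiv M q (Y q) (fcoord ?d i))"
    "smooth_fun_on M ?U (\<lambda>q. vderiv M q (Z q) (fcoord ?d i))" for i
    by (rule smooth_vderiv_fcoord[OF d(1) o(1) _ dom.smooth_vector_field_subset[OF Y]]
        smooth_vderiv_fcoord[OF d(1) o(1) _ dom.smooth_vector_field_subset[OF Z]]; auto)+
  have l: "vderiv M q (Y q + Z q) (fcoord ?d i) = vderiv M q (Y q) (fcoord ?d i) + vderiv M q (Z q) (fcoord ?d i)"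
    if "q \<in> ?U" for q i
    using that by (intro linear_add[OF dom.linear_vderiv[OF smooth_fcoord[OF d(1)]]]) auto
  have "vderiv M p v (\<lambda>q. vderiv M q (Y q + Z q) (fcoord ?d i)) =
      vderiv M p v (\<lambda>q. vderiv M q (Y q) (fcoord ?d i)) + vderiv M p v (\<lambda>q. vderiv M q (Z q) (fcoord ?d i))" for i
    by (subst dom.vderiv_add[OF o(2) s, symmetric], rule dom.vderiv_cong[OF o])
      (auto intro!: dom.smooth_fun_on_add o s simp: l)
  \<comment> \<open>The sum of two fields is a combination indexed by the booleans, with both
    coefficients 1.\<close>
  moreover have "smooth_vector_field_on M U (\<lambda>q. Y q + Z q)"
    using dom.smooth_vector_field_combination[OF U(1), of "{True, False}" "\<lambda>_ _. 1" "\<lambda>b. if b then Y else Z"] Y Z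
    by (simp add: dom.smooth_fun_on_const)
  ultimately show ?thesis
    unfolding cov_df[OF d(1) U d(2) Y refl] cov_df[OF d(1) U d(2) Z refl]
    by (subst cov_df[OF d(1) U d(2)]) (auto simp: l[OF o(2)] scaleR_add_left sum.distrib)
qed

lemma cov_df_scale:
  assumes U: "open U" "p \<in> U" and Y: "smooth_vector_field_on M U Y" and h: "smooth_fun_on M U h"
  shows "cov p v (\<lambda>q. df q (h q *\<^sub>R Y q)) = vderiv M p v h *\<^sub>R df p (Y p) + h p *\<^sub>R cov p v (\<lambda>q. df q (Y q))"
proof -
  let ?d = "chart_at N (f p)"
  note d = cod.chart_at[of "f p"]
  let ?U = "U \<inter> f -` fst ?d"
  have o: "open ?U" "p \<in> ?U" using U d open_preimage[OF cod.open_chart[OF d(1)]] by auto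
  have s: "smooth_fun_on M ?U (\<lambda>q. vderiv M q (Y q) (fcoord ?d i))" for i
    by (rule smooth_vderiv_fcoord[OF d(1) o(1) _ dom.smooth_vector_field_subset[OF Y]]) auto
  have h': "smooth_fun_on M ?U h" by (rule dom.smooth_fun_on_subset[OF h]) auto
  have l: "vderiv M q (h q *\<^sub>R Y q) (fcoord ?d i) = h q * vderiv M q (Y q) (fcoord ?d i)"
    if "q \<in> ?U" for q i
    using that linear_scale[OF dom.linear_vderiv[OF smooth_fcoord[OF d(1)]], of q] by auto
  have "vderiv M p v (\<lambda>q. vderiv M q (h q *\<^sub>R Y q) (fcoord ?d i)) =
      vderiv M p v h * vderiv M p (Y p) (fcoord ?d i) + h p * vderiv M p v (\<lambda>q. vderiv M q (Y q) (fcoord ?d i))" for i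
    by (subst dom.vderiv_mult[OF o(2) h' s, symmetric], rule dom.vderiv_cong[OF o])
      (auto intro!: dom.smooth_fun_on_mult o s h' simp: l)
  moreover have "smooth_vector_field_on M U (\<lambda>q. h q *\<^sub>R Y q)"
    using dom.smooth_vector_field_combination[OF U(1), of "{()}" "\<lambda>_. h" "\<lambda>_. Y"] Y h by simp
  ultimately show ?thesis
    unfolding cov_df[OF d(1) U d(2) Y refl] df_expand[OF d, of "Y p"]
    by (subst cov_df[OF d(1) U d(2)])
      (auto simp: l[OF o(2)] scaleR_add_left scaleR_add_right sum.distrib scaleR_right.sum)
qed

text \<open>The inner product is expanded by components and the Gram functions \<open>G i j\<close>
  of the coordinate frame. Metricity of \<open>nabla\<close>, in the direction
  \<open>df p v\<close>, differentiates the Gram functions, and the terms regroup by the two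
  arguments.\<close>

lemma cov_metric:
  assumes g: "semi_riemannian_metric N g" "metric_connection N g nabla" and U: "open U" "p \<in> U"
    and Y: "smooth_vector_field_on M U Y" and Z: "smooth_vector_field_on M U Z"
  shows "vderiv M p v (\<lambda>q. g (f q) (df q (Y q)) (df q (Z q))) =
    g (f p) (cov p v (\<lambda>q. df q (Y q))) (df p (Z p)) + g (f p) (df p (Y p)) (cov p v (\<lambda>q. df q (Z q)))"
proof -
  let ?d = "chart_at N (f p)"
  note d = cod.chart_at[of "f p"]
  let ?U = "U \<inter> f -` fst ?d"
  note E = cod.smooth_frame[OF d(1)] and od = cod.open_chart[OF d(1)]
  have o: "open ?U" "p \<in> ?U" using U d open_preimage[OF od] by auto
  define y where "y i q = vderiv M q (Y q) (fcoord ?d i)" for i q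
  define z where "z i q = vderiv M q (Z q) (fcoord ?d i)" for i q
  define G where "G i j r = g r (cod.frame ?d i r) (cod.frame ?d j r)" for i j r
  have y: "smooth_fun_on M ?U (y i)" and z: "smooth_fun_on M ?U (z i)" for i
    unfolding y_def[abs_def] z_def[abs_def]
    by (rule smooth_vderiv_fcoord[OF d(1) o(1) _ dom.smooth_vector_field_subset[OF Y]]
        smooth_vderiv_fcoord[OF d(1) o(1) _ dom.smooth_vector_field_subset[OF Z]]; auto)+
  have G: "smooth_fun_on N (fst ?d) (G i j)" for i j
    using g(1) od E unfolding semi_riemannian_metric_def G_def[abs_def] by blast
  have Gf: "smooth_fun_on M ?U (\<lambda>q. G i j (f q))" for i j
    by (rule dom.smooth_fun_on_subset[OF smooth_fun_compose[OF od G]]) auto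
  have bl: "bilinear (g q)" for q using g(1) by (simp add: semi_riemannian_metric_def)
  have l1: "linear (\<lambda>u. g q u w)" and l2: "linear (\<lambda>u. g q w u)" for q w
    using bl by (auto simp: bilinear_def)
  have gY: "g (f q) (df q (Y q)) w = (\<Sum>i\<in>Basis. y i q * g (f q) (cod.frame ?d i (f q)) w)"
    and gZ: "g (f q) w (df q (Z q)) = (\<Sum>j\<in>Basis. z j q * g (f q) w (cod.frame ?d j (f q)))"
    if "q \<in> ?U" for q w
    using that unfolding y_def z_def
    by (simp_all add: df_expand[OF d(1)] linear_sum[OF l1] linear_scale[OF l1] linear_sum[OF l2] linear_scale[OF l2])
  have cY: "g (f p) (cov p v (\<lambda>q. df q (Y q))) w = (\<Sum>i\<in>Basis. vderiv M p v (y i) * g (f p) (cod.frame ?d i (f p)) w +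
      y i p * g (f p) (nabla (f p) (df p v) (cod.frame ?d i)) w)"
    and cZ: "g (f p) w (cov p v (\<lambda>q. df q (Z q))) = (\<Sum>j\<in>Basis. vderiv M p v (z j) * g (f p) w (cod.frame ?d j (f p)) +
      z j p * g (f p) w (nabla (f p) (df p v) (cod.frame ?d j)))" for w
    unfolding cov_df[OF d(1) U d(2) Y refl] cov_df[OF d(1) U d(2) Z refl] y_def[abs_def] z_def[abs_def]
    by (simp_all add: linear_sum[OF l1] linear_scale[OF l1] linear_add[OF l1]
        linear_sum[OF l2] linear_scale[OF l2] linear_add[OF l2])
  have expand: "g (f q) (df q (Y q)) (df q (Z q)) = (\<Sum>i\<in>Basis. \<Sum>j\<in>Basis. y i q * (z j q * G i j (f q)))"
    if "q \<in> ?U" for q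
    unfolding gY[OF that] unfolding gZ[OF that] G_def by (simp add: sum_distrib_left)
  have dG: "vderiv M p v (\<lambda>q. G i j (f q)) = g (f p) (nabla (f p) (df p v) (cod.frame ?d i)) (cod.frame ?d j (f p)) +
      g (f p) (cod.frame ?d i (f p)) (nabla (f p) (df p v) (cod.frame ?d j))" for i j
    using vderiv_compose[OF G d(2)] g(2)[unfolded metric_connection_def, rule_format, OF od E E d(2)]
    by (simp add: G_def[abs_def])
  have s: "smooth_fun_on M ?U (\<lambda>q. z j q * G i j (f q))" "smooth_fun_on M ?U (\<lambda>q. y i q * (z j q * G i j (f q)))"
    "smooth_fun_on M ?U (\<lambda>q. \<Sum>j\<in>Basis. y i q * (z j q * G i j (f q)))" for i j
    by (intro dom.smooth_fun_on_sum dom.smooth_fun_on_mult o y z Gf)+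
  have "vderiv M p v (\<lambda>q. g (f q) (df q (Y q)) (df q (Z q))) =
      vderiv M p v (\<lambda>q. \<Sum>i\<in>Basis. \<Sum>j\<in>Basis. y i q * (z j q * G i j (f q)))"
    by (rule dom.vderiv_cong[OF o dom.smooth_fun_on_sum[OF o(1) s(3)]]) (simp add: expand)
  also have "\<dots> = (\<Sum>i\<in>Basis. \<Sum>j\<in>Basis. vderiv M p v (\<lambda>q. y i q * (z j q * G i j (f q))))"
    by (simp add: dom.vderiv_sum[OF o(2) s(3)] dom.vderiv_sum[OF o(2) s(2)])
  also have "\<dots> = (\<Sum>i\<in>Basis. \<Sum>j\<in>Basis. vderiv M p v (y i) * (z j p * G i j (f p)) +
      y i p * (vderiv M p v (z j) * G i j (f p) + z j p * vderiv M p v (\<lambda>q. G i j (f q))))"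
    by (simp add: dom.vderiv_mult[OF o(2) y s(1)] dom.vderiv_mult[OF o(2) z Gf])
  also have "\<dots> = (\<Sum>i\<in>Basis. \<Sum>j\<in>Basis. vderiv M p v (y i) * (z j p * G i j (f p)) +
      y i p * (z j p * g (f p) (nabla (f p) (df p v) (cod.frame ?d i)) (cod.frame ?d j (f p)))) +
     (\<Sum>i\<in>Basis. \<Sum>j\<in>Basis. y i p * (vderiv M p v (z j) * G i j (f p)) +
      y i p * (z j p * g (f p) (cod.frame ?d i (f p)) (nabla (f p) (df p v) (cod.frame ?d j))))"
    unfolding dG sum.distrib[symmetric] by (intro sum.cong refl) (simp add: algebra_simps)
  also have "\<dots> = g (f p) (cov p v (\<lambda>q. df q (Y q))) (df p (Z p)) + g (f p) (df p (Y p)) (cov p v (\<lambda>q. df q (Z q)))"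
    unfolding cY gY[OF o(2)] unfolding cZ gZ[OF o(2)] G_def
    by (simp add: sum_distrib_left sum.distrib distrib_left)
  finally show ?thesis .
qed

end

section \<open>The index of a form with an anti-isometry\<close>

text \<open>A negative subspace \<open>V\<close> of maximal dimension meets its positive image under
  \<open>J\<close> only in 0, so twice its dimension is at most that of the space. Its
  \<open>b\<close>-orthogonal complement \<open>N\<close> is positive definite, so \<open>J\<close>
  makes it negative and \<open>dim N\<close> is at most \<open>dim V\<close>; counting dimensions
  gives equality. Knowing the index pointwise yields its constancy even if the manifold is
  disconnected.\<close>

lemma form_index_anti_isometry:
  fixes b :: "'e::euclidean_space \<Rightarrow> 'e \<Rightarrow> real"
  assumes bl: "bilinear b" and sym: "\<And>v w. b v w = b w v" and nd: "nondegenerate_form b"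
    and J: "linear J" and anti: "\<And>v w. b (J v) (J w) = - b v w"
  shows "2 * form_index b = DIM('e)"
proof -
  have l1: "linear (\<lambda>u. b u w)" and l2: "linear (\<lambda>u. b w u)" for w
    using bl by (auto simp: bilinear_def)
  have zero: "v = 0" if "\<And>w. b v w = 0" for v using nd that by (auto simp: nondegenerate_form_def)
  have inj: "inj J"
    unfolding linear_injective_0[OF J]
  proof (intro allI impI)
    fix v assume "J v = 0"
    then have "b v w = 0" for w using anti[of v w] linear_0[OF l1] by simp
    then show "v = 0" by (rule zero)
  qed
  let ?neg = "\<lambda>V. subspace V \<and> (\<forall>v\<in>V. v \<noteq> 0 \<longrightarrow> b v v < 0)"
  let ?D = "{dim V |V. ?neg V}"
  have "?D \<subseteq> {..DIM('e)}" by (auto simp: dim_subset_UNIV)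
  then have fin: "finite ?D" using finite_subset by blast
  have "?neg {0}" by simp
  then have "?D \<noteq> {}" by blast
  then have "form_index b \<in> ?D" unfolding form_index_def by (rule Max_in[OF fin])
  then obtain V where V: "?neg V" "form_index b = dim V" by blast
  have max: "dim V' \<le> dim V" if "?neg V'" for V'
    unfolding V(2)[symmetric] form_index_def by (rule Max_ge[OF fin]) (use that in blast)
  have dimJ: "dim (J ` S) = dim S" for S
    using dim_image_eq[OF J inj_on_subset[OF inj subset_UNIV]] .
  have sums: "dim S + dim T \<le> DIM('e)" if "subspace S" "subspace T" "S \<inter> T \<subseteq> {0}" for S T :: "'e set"
  proof -
    have "dim (S \<inter> T) = 0" using that(3) by (simp add: dim_eq_0)
    then show ?thesis using dim_sums_Int[OF that(1,2)] dim_subset_UNIV[of "{x + y |x y. x \<in> S \<and> y \<in> T}"]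
      by linarith
  qed
  have upper: "dim V + dim (J ` V) \<le> DIM('e)"
  proof (rule sums)
    show "subspace V" "subspace (J ` V)" using V(1) linear_subspace_image[OF J] by auto
    show "V \<inter> J ` V \<subseteq> {0}"
    proof
      fix x assume "x \<in> V \<inter> J ` V"
      then obtain v where v: "x \<in> V" "v \<in> V" "x = J v" by blast
      have "b v v \<le> 0" using V(1) v(2) linear_0[OF l1] by (cases "v = 0") (auto intro: less_imp_le)
      then have "b x x \<ge> 0" using anti[of v v] v(3) by simp
      then show "x \<in> {0}" using V(1) v(1) by fastforce
    qed
  qed
  \<comment> \<open>\<open>L\<close> represents \<open>b\<close> by the inner product, so that the
    dimension formula for Euclidean orthogonal complements applies to \<open>N\<close>.\<close>
  define L where "L v = (\<Sum>i\<in>Basis. b i v *\<^sub>R i)" for v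
  have L: "linear L" unfolding L_def
    by (rule linearI) (simp_all add: linear_add[OF l2] linear_scale[OF l2] scaleR_add_left sum.distrib scaleR_right.sum)
  have bL: "b x v = L v \<bullet> x" for x v
    unfolding L_def linear_basis_expand[OF l1, of x v] by (simp add: inner_sum_right inner_commute[of _ x] mult.commute)
  define N where "N = {x. \<forall>v\<in>V. b x v = 0}"
  have subN: "subspace N"
    unfolding N_def subspace_def using linear_0[OF l1] linear_add[OF l1] linear_scale[OF l1] by auto
  have "N = {y \<in> UNIV. \<forall>u\<in>L ` V. orthogonal u y}" by (auto simp: N_def bL orthogonal_def)
  then have "dim N + dim (L ` V) = DIM('e)"
    using dim_subspace_orthogonal_to_vectors[of "L ` V" UNIV] V(1) linear_subspace_image[OF L] by simp
  then have dimN: "DIM('e) \<le> dim N + dim V" using dim_image_le[OF L, of V] by linarith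
  have spanV: "span V = V" using V(1) span_eq_iff by blast
  have VN: "x = 0" if "x \<in> V" "x \<in> N" for x using V(1) that by (force simp: N_def)
  have nonneg: "b x x \<ge> 0" if x: "x \<in> N" for x
  proof (rule ccontr)
    assume neg: "\<not> b x x \<ge> 0"
    have "x \<notin> V" using VN[of x] x neg linear_0[OF l1] by auto
    then have "dim (insert x V) = dim V + 1" by (simp add: dim_insert spanV)
    \<comment> \<open>A negative vector orthogonal to \<open>V\<close> would enlarge
      \<open>V\<close>, against maximality.\<close>
    moreover have "?neg (span (insert x V))"
    proof (intro conjI ballI impI subspace_span)
      fix u assume "u \<in> span (insert x V)" and u: "u \<noteq> 0"
      then obtain t where t: "u - t *\<^sub>R x \<in> V" by (auto simp: span_breakdown_eq spanV)
      define v where "v = u - t *\<^sub>R x"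
      have v: "v \<in> V" "u = v + t *\<^sub>R x" using t by (auto simp: v_def)
      have "b x v = 0" "b v x = 0" using x v(1) sym[of v x] by (auto simp: N_def)
      then have e: "b u u = b v v + t * t * b x x"
        unfolding v(2) by (simp add: linear_add[OF l1] linear_add[OF l2] linear_scale[OF l1] linear_scale[OF l2])
      show "b u u < 0"
      proof (cases "v = 0")
        case True
        then have "t \<noteq> 0" using u v(2) by auto
        then have "t * t > 0" by (simp add: zero_less_mult_iff) linarith
        then have "t * t * b x x < 0" using neg by (intro mult_pos_neg) auto
        then show ?thesis using e True linear_0[OF l1] by simp
      next
        case False
        have "t * t * b x x \<le> 0" using neg by (intro mult_nonneg_nonpos) auto
        moreover have "b v v < 0" using V(1) v(1) False by blast
        ultimately show ?thesis using e by linarith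
      qed
    qed
    ultimately show False using max[of "span (insert x V)"] by simp
  qed
  have pos: "b x x > 0" if x: "x \<in> N" "x \<noteq> 0" for x
  proof (rule ccontr)
    assume "\<not> b x x > 0"
    then have xx: "b x x = 0" using nonneg[OF x(1)] by simp
    \<comment> \<open>A null vector of a nonnegative form is orthogonal to everything, as in the
      Cauchy-Schwarz argument: otherwise the form is negative at a suitable
      \<open>x + t *\<^sub>R y\<close>.\<close>
    have xN: "b x y = 0" if y: "y \<in> N" for y
    proof (rule ccontr)
      define c e where "c = b x y" and "e = b y y"
      assume "b x y \<noteq> 0"
      then have c: "c \<noteq> 0" by (simp add: c_def)
      have e: "e \<ge> 0" using nonneg[OF y] by (simp add: e_def)
      have quad: "b (x + t *\<^sub>R y) (x + t *\<^sub>R y) = 2 * t * c + t * t * e" for t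
        using xx sym[of y x]
        by (simp add: linear_add[OF l1] linear_add[OF l2] linear_scale[OF l1] linear_scale[OF l2] c_def e_def distrib_left)
      \<comment> \<open>This turns \<open>2 * t * c + t * t * e\<close> into
        \<open>- (t * t * (e + 2))\<close>; the summand 1 covers the case
        \<open>e = 0\<close>.\<close>
      define t where "t = - c / (e + 1)"
      have "x + t *\<^sub>R y \<in> N" using x(1) y subN by (intro subspace_add subspace_scale)
      then have "0 \<le> b (x + t *\<^sub>R y) (x + t *\<^sub>R y)" by (rule nonneg)
      moreover have ct: "c = - t * (e + 1)" using e by (simp add: t_def)
      have "2 * t * c + t * t * e = - (t * t * (e + 2))" unfolding ct by (simp add: algebra_simps)
      ultimately have "t * t * (e + 2) \<le> 0" unfolding quad by simp
      then have "t * t \<le> 0" using e by (simp add: mult_le_0_iff)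
      then have "t = 0" by (auto simp: mult_le_0_iff)
      then show False using ct c by simp
    qed
    \<comment> \<open>\<open>V\<close> and \<open>N\<close> together span the space, and
      \<open>x\<close> is orthogonal to both, against nondegeneracy.\<close>
    let ?T = "{v + n |v n. v \<in> V \<and> n \<in> N}"
    have "V \<inter> N \<subseteq> {0}" using VN by blast
    then have "dim (V \<inter> N) = 0" by (simp add: dim_eq_0)
    then have "dim ?T \<ge> DIM('e)" using dim_sums_Int[of V N] V(1) subN dimN by linarith
    then have "dim ?T = DIM('e)" using dim_subset_UNIV[of ?T] by simp
    then have "span ?T = UNIV" by (simp add: dim_eq_full)
    moreover have "subspace ?T" using V(1) subN by (intro subspace_sums) auto
    then have "span ?T = ?T" by (rule span_eq_iff[THEN iffD2])
    ultimately have T: "?T = UNIV" by (simp only:)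
    have "b x w = 0" for w
    proof -
      have "w \<in> ?T" using T by simp
      then obtain v n where w: "w = v + n" "v \<in> V" "n \<in> N" by blast
      then show ?thesis using x(1) xN by (simp add: linear_add[OF l2] N_def)
    qed
    then show False using zero x(2) by blast
  qed
  have "?neg (J ` N)"
  proof (intro conjI ballI impI)
    show "subspace (J ` N)" using linear_subspace_image[OF J subN] .
    fix y assume "y \<in> J ` N" "y \<noteq> 0"
    then obtain n where "n \<in> N" "y = J n" "n \<noteq> 0" using linear_0[OF J] by auto
    then show "b y y < 0" using pos[of n] by (simp add: anti)
  qed
  from max[OF this] have "dim N \<le> dim V" by (simp add: dimJ)
  then show ?thesis using upper dimN by (simp add: V(2) dimJ)
qed

section \<open>Invariant submanifolds\<close>

lemma mixed_3_structure_at: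
  assumes "mixed_3_structure A \<phi> \<xi> \<eta>" "\<alpha> \<in> {1, 2, 3}"
  shows "\<phi> \<alpha> p (\<phi> \<alpha> p v) = tau \<alpha> *\<^sub>R (- v + \<eta> \<alpha> p v *\<^sub>R \<xi> \<alpha> p)" "\<eta> \<alpha> p (\<xi> \<alpha> p) = 1"
    "endo_field A (\<phi> \<alpha>)" "linear (\<phi> \<alpha> p)" "linear (\<eta> \<alpha> p)"
  using bspec[OF conjunct1[OF assms(1)[unfolded mixed_3_structure_def]] assms(2)]
  by (simp_all add: endo_field_def one_form_def)

lemma tau_simps [simp]: "tau 1 = -1" "tau (Suc 0) = -1" "tau 2 = -1" "tau 3 = 1"
  by (simp_all add: tau_def)

text \<open>The formula for the square of \<open>\<phi> \<alpha>\<close> kills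
  \<open>\<xi> \<alpha>\<close>. Applied again to the image \<open>?w\<close> of
  \<open>\<xi> \<alpha>\<close>, it makes \<open>?w\<close> a multiple of
  \<open>\<xi> \<alpha>\<close>; applying \<open>\<phi> \<alpha>\<close> once more shows that the
  factor or \<open>?w\<close> is 0.\<close>

lemma phi_xi_eq_0:
  assumes m: "mixed_3_structure A \<phi> \<xi> \<eta>" and a: "\<alpha> \<in> {1, 2, 3}"
  shows "\<phi> \<alpha> p (\<xi> \<alpha> p) = 0"
proof -
  note s = mixed_3_structure_at(1,2,4)[OF m a, of p]
  let ?w = "\<phi> \<alpha> p (\<xi> \<alpha> p)"
  have t: "tau \<alpha> \<noteq> 0" by (simp add: tau_def)
  have z: "\<phi> \<alpha> p ?w = 0" using s(1)[of "\<xi> \<alpha> p"] s(2) by simp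
  then have "tau \<alpha> *\<^sub>R (- ?w + \<eta> \<alpha> p ?w *\<^sub>R \<xi> \<alpha> p) = 0"
    using s(1)[of ?w] linear_0[OF s(3)] by simp
  then have w: "?w = \<eta> \<alpha> p ?w *\<^sub>R \<xi> \<alpha> p" using t by simp
  then have "\<phi> \<alpha> p ?w = \<eta> \<alpha> p ?w *\<^sub>R ?w" using linear_scale[OF s(3)] by metis
  then have "\<eta> \<alpha> p ?w = 0 \<or> ?w = 0" using z by simp
  then show ?thesis using w by (metis scaleR_zero_left)
qed

lemma metric_phi:
  assumes "metric_mixed_3_structure A \<phi> \<xi> \<eta> g" "\<alpha> \<in> {1, 2, 3}"
  shows "g p (\<phi> \<alpha> p v) (\<phi> \<alpha> p w) = tau \<alpha> * (g p v w - g p (\<xi> \<alpha> p) (\<xi> \<alpha> p) * \<eta> \<alpha> p v * \<eta> \<alpha> p w)"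
    and "g p (\<xi> \<alpha> p) (\<xi> \<alpha> p) \<noteq> 0"
  using bspec[OF conjunct2[OF conjunct2[OF assms(1)[unfolded metric_mixed_3_structure_def]]] assms(2), THEN spec, of p]
  by auto

text \<open>Compatibility of the metric with \<open>w\<close> equal to
  \<open>\<xi> \<alpha> p\<close>, where the left-hand side vanishes.\<close>

lemma metric_xi_eq_eta:
  assumes m: "metric_mixed_3_structure A \<phi> \<xi> \<eta> g" and a: "\<alpha> \<in> {1, 2, 3}"
  shows "g p v (\<xi> \<alpha> p) = g p (\<xi> \<alpha> p) (\<xi> \<alpha> p) * \<eta> \<alpha> p v"
proof -
  have m3: "mixed_3_structure A \<phi> \<xi> \<eta>" using m by (simp add: metric_mixed_3_structure_def)
  have bl: "bilinear (g p)" using m by (simp add: metric_mixed_3_structure_def semi_riemannian_metric_def)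
  have "tau \<alpha> * (g p v (\<xi> \<alpha> p) - g p (\<xi> \<alpha> p) (\<xi> \<alpha> p) * \<eta> \<alpha> p v * \<eta> \<alpha> p (\<xi> \<alpha> p)) =
      g p (\<phi> \<alpha> p v) (\<phi> \<alpha> p (\<xi> \<alpha> p))"
    by (rule metric_phi(1)[OF m a, symmetric])
  also have "\<dots> = 0" using phi_xi_eq_0[OF m3 a] bilinear_rzero[OF bl] by simp
  finally show ?thesis using mixed_3_structure_at(2)[OF m3 a] by (simp add: tau_def split: if_splits)
qed

locale invariant_cosymplectic = connection_along_map M N f nabla
  for M :: "('p::{t2_space,second_countable_topology}, 'm::euclidean_space) chart set"
    and N :: "('q::{t2_space,second_countable_topology}, 'n::euclidean_space) chart set"
    and f :: "'p \<Rightarrow> 'q" and nabla :: "('q, 'n) connection" +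
  fixes \<phi> :: "nat \<Rightarrow> 'q \<Rightarrow> 'n \<Rightarrow> 'n" and \<xi> :: "nat \<Rightarrow> 'q \<Rightarrow> 'n" and \<eta> :: "nat \<Rightarrow> 'q \<Rightarrow> 'n \<Rightarrow> real"
    and g :: "'q \<Rightarrow> 'n \<Rightarrow> 'n \<Rightarrow> real"
  assumes nondeg: "nondegenerate_submanifold M N f g"
    and invariant: "invariant_submanifold M N f \<phi>"
    and normal: "structure_fields_normal M N f \<xi> g"
    and cosymplectic: "mixed_3_cosymplectic N \<phi> \<xi> \<eta> g nabla"
begin

section \<open>The induced structure and metric on the submanifold\<close>

abbreviation J :: "nat \<Rightarrow> 'p \<Rightarrow> 'm \<Rightarrow> 'm" where
  "J \<alpha> \<equiv> restrict_endo M N f (\<phi> \<alpha>)"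

abbreviation gM :: "'p \<Rightarrow> 'm \<Rightarrow> 'm \<Rightarrow> real" where
  "gM \<equiv> induced_metric M N f g"

lemma metric_structure: "metric_mixed_3_structure N \<phi> \<xi> \<eta> g"
  using cosymplectic by (simp add: mixed_3_cosymplectic_def)

lemma mixed_structure: "mixed_3_structure N \<phi> \<xi> \<eta>"
  using metric_structure by (simp add: metric_mixed_3_structure_def)

lemma metric: "semi_riemannian_metric N g"
  using metric_structure by (simp add: metric_mixed_3_structure_def)

lemma bilinear_g: "bilinear (g y)" and g_sym: "g y u w = g y w u"
  using metric by (simp_all add: semi_riemannian_metric_def)

lemma torsion_free: "torsion_free N nabla" and metric_conn: "metric_connection N g nabla"
  using cosymplectic by (simp_all add: mixed_3_cosymplectic_def levi_civita_def)

lemma parallel_phi: "\<alpha> \<in> {1, 2, 3} \<Longrightarrow> parallel_endo N nabla (\<phi> \<alpha>)"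
  using cosymplectic unfolding mixed_3_cosymplectic_def by blast

lemma inj_df: "inj (df p)"
  using nondeg by (simp add: nondegenerate_submanifold_def immersion_def)

lemma df_eq_iff: "df p v = df p w \<longleftrightarrow> v = w"
  using inj_df by (rule inj_eq)

lemma inv_df [simp]: "inv (df p) (df p v) = v"
  using inj_df by (rule inv_f_f)

lemma phi_in_range:
  assumes "\<alpha> \<in> {1, 2, 3}" "w \<in> range (df p)"
  shows "\<phi> \<alpha> (f p) w \<in> range (df p)"
  using invariant assms unfolding invariant_submanifold_def tangent_image_def by blast

text \<open>Invariance places the right-hand side in the range of \<open>df p\<close>, where
  \<open>inv\<close> returns a true preimage.\<close>

lemma df_J: "\<alpha> \<in> {1, 2, 3} \<Longrightarrow> df p (J \<alpha> p v) = \<phi> \<alpha> (f p) (df p v)"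
  unfolding restrict_endo_def by (rule f_inv_into_f[OF phi_in_range]) auto

text \<open>\<open>\<eta> \<alpha>\<close> is a nonzero multiple of the metric product with the
  normal vector \<open>\<xi> \<alpha>\<close>.\<close>

lemma eta_tangent:
  assumes "\<alpha> \<in> {1, 2, 3}"
  shows "\<eta> \<alpha> (f p) (df p v) = 0"
proof -
  have "\<xi> \<alpha> (f p) \<in> normal_space M N f g p"
    using normal assms unfolding structure_fields_normal_def by blast
  then have "g (f p) (df p v) (\<xi> \<alpha> (f p)) = 0"
    using g_sym by (auto simp: normal_space_def tangent_image_def)
  moreover have "g (f p) (\<xi> \<alpha> (f p)) (\<xi> \<alpha> (f p)) \<noteq> 0"
    by (rule metric_phi(2)[OF metric_structure assms])
  ultimately show ?thesis using metric_xi_eq_eta[OF metric_structure assms, of "f p" "df p v"] by simp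
qed

text \<open>On tangent vectors the term with \<open>\<eta> \<alpha>\<close> drops out; the signs of
  \<open>tau\<close> then make \<open>J 1\<close> and \<open>J 2\<close> involutions and
  \<open>J 3\<close> a complex structure.\<close>

lemma J_J: "\<alpha> \<in> {1, 2, 3} \<Longrightarrow> J \<alpha> p (J \<alpha> p v) = (- tau \<alpha>) *\<^sub>R v"
  by (subst df_eq_iff[of p, symmetric])
    (simp add: df_J mixed_3_structure_at(1)[OF mixed_structure] eta_tangent linear_scale[OF linear_df] linear_neg[OF linear_df])

lemma phi_1_2:
  "\<phi> 1 y (\<phi> 2 y v) = \<phi> 3 y v - \<eta> 2 y v *\<^sub>R \<xi> 1 y"
  "\<phi> 2 y (\<phi> 1 y v) = - \<phi> 3 y v - \<eta> 1 y v *\<^sub>R \<xi> 2 y"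
proof -
  have "\<forall>(\<alpha>, \<beta>, \<gamma>)\<in>even_triples. \<forall>p v.
      \<phi> \<alpha> p (\<phi> \<beta> p v) - (tau \<alpha> * \<eta> \<beta> p v) *\<^sub>R \<xi> \<alpha> p = tau \<gamma> *\<^sub>R \<phi> \<gamma> p v \<and>
      - \<phi> \<beta> p (\<phi> \<alpha> p v) + (tau \<beta> * \<eta> \<alpha> p v) *\<^sub>R \<xi> \<beta> p = tau \<gamma> *\<^sub>R \<phi> \<gamma> p v"
    using conjunct2[OF mixed_structure[unfolded mixed_3_structure_def]] by fast
  then have *: "\<phi> 1 y (\<phi> 2 y v) - (tau 1 * \<eta> 2 y v) *\<^sub>R \<xi> 1 y = tau 3 *\<^sub>R \<phi> 3 y v \<and>
      - \<phi> 2 y (\<phi> 1 y v) + (tau 2 * \<eta> 1 y v) *\<^sub>R \<xi> 2 y = tau 3 *\<^sub>R \<phi> 3 y v"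
    unfolding even_triples_def by fast
  then show "\<phi> 1 y (\<phi> 2 y v) = \<phi> 3 y v - \<eta> 2 y v *\<^sub>R \<xi> 1 y"
    by (auto simp: algebra_simps)
  have "- \<phi> 3 y v = - (- \<phi> 2 y (\<phi> 1 y v) + (tau 2 * \<eta> 1 y v) *\<^sub>R \<xi> 2 y)"
    using * by simp
  then show "\<phi> 2 y (\<phi> 1 y v) = - \<phi> 3 y v - \<eta> 1 y v *\<^sub>R \<xi> 2 y"
    by simp
qed

lemma J_1_2: "J 1 p (J 2 p v) = J 3 p v" "J 2 p (J 1 p v) = - J 3 p v"
  by (subst df_eq_iff[of p, symmetric], simp add: df_J phi_1_2[simplified] eta_tangent[simplified] linear_neg[OF linear_df])+

lemma gM_J: "\<alpha> \<in> {1, 2, 3} \<Longrightarrow> gM p (J \<alpha> p v) (J \<alpha> p w) = tau \<alpha> * gM p v w"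
  unfolding induced_metric_def df_J by (simp only: metric_phi(1)[OF metric_structure] eta_tangent) simp

lemma bilinear_gM: "bilinear (gM p)"
proof -
  have "linear (\<lambda>u. g (f p) u w)" "linear (\<lambda>u. g (f p) w u)" for w
    using bilinear_g[of "f p"] by (auto simp: bilinear_def)
  from linear_compose[OF linear_df[of p] this(1)] linear_compose[OF linear_df[of p] this(2)]
  show ?thesis by (simp add: bilinear_def induced_metric_def o_def)
qed

lemma linear_J: "\<alpha> \<in> {1, 2, 3} \<Longrightarrow> linear (J \<alpha> p)"
  by (rule linearI; subst df_eq_iff[of p, symmetric])
    (simp_all add: df_J linear_add[OF linear_df] linear_scale[OF linear_df]
      linear_add[OF mixed_3_structure_at(4)[OF mixed_structure]]
      linear_scale[OF mixed_3_structure_at(4)[OF mixed_structure]])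

text \<open>The inverse of \<open>df\<close> in the definition of \<open>J\<close> says nothing
  about smoothness. But \<open>df\<close> of the field has smooth components, and
  \<open>smooth_vector_field_immersion\<close> carries this back to \<open>M\<close>.\<close>

lemma smooth_J:
  assumes a: "\<alpha> \<in> {1, 2, 3}" and U: "open U" and X: "smooth_vector_field_on M U X"
  shows "smooth_vector_field_on M U (\<lambda>q. J \<alpha> q (X q))"
proof (rule dom.smooth_vector_field_local[OF U])
  fix p assume p: "p \<in> U"
  let ?d = "chart_at N (f p)"
  note d = cod.chart_at[of "f p"]
  note od = cod.open_chart[OF d(1)]
  let ?V = "U \<inter> f -` fst ?d"
  have V: "open ?V" "?V \<subseteq> f -` fst ?d" "p \<in> ?V" using U p d open_preimage[OF od] by auto
  have "smooth_vector_field_on M ?V (\<lambda>q. J \<alpha> q (X q))"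
  proof (rule smooth_vector_field_immersion[OF inj_df V(1,2) d(1)])
    fix i :: 'n assume "i \<in> Basis"
    let ?G = "\<lambda>j r. vderiv N r (\<phi> \<alpha> r (cod.frame ?d j r)) (cod.coord ?d i)"
    have "smooth_vector_field_on N (fst ?d) (\<lambda>r. \<phi> \<alpha> r (cod.frame ?d j r))" for j
      using mixed_3_structure_at(3)[OF mixed_structure a] od cod.smooth_frame[OF d(1)]
      unfolding endo_field_def by blast
    then have "smooth_fun_on N (fst ?d) (?G j)" for j
      by (intro cod.smooth_vderiv od cod.smooth_coord d)
    then have G: "smooth_fun_on M ?V (\<lambda>q. ?G j (f q))" for j
      by (intro dom.smooth_fun_on_subset[OF smooth_fun_compose[OF od] V(2)])
    have "smooth_fun_on M ?V (\<lambda>q. \<Sum>j\<in>Basis. vderiv M q (X q) (fcoord ?d j) * ?G j (f q))"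
      by (intro dom.smooth_fun_on_sum dom.smooth_fun_on_mult V(1) G smooth_vderiv_fcoord[OF d(1) V(1,2)]
          dom.smooth_vector_field_subset[OF X]) auto
    then show "smooth_fun_on M ?V (\<lambda>q. vderiv N (f q) (df q (J \<alpha> q (X q))) (cod.coord ?d i))"
    proof (rule dom.smooth_fun_on_cong[OF V(1)])
      fix q assume "q \<in> ?V"
      then have fq: "f q \<in> fst ?d" by auto
      have l: "linear (\<lambda>v. vderiv N (f q) (\<phi> \<alpha> (f q) v) (cod.coord ?d i))"
        using linear_compose[OF mixed_3_structure_at(4)[OF mixed_structure a]
            cod.linear_vderiv[OF cod.smooth_coord[OF d(1)] fq]] by (simp add: o_def)
      show "(\<Sum>j\<in>Basis. vderiv M q (X q) (fcoord ?d j) * ?G j (f q)) =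
          vderiv N (f q) (df q (J \<alpha> q (X q))) (cod.coord ?d i)"
        unfolding df_J[OF a] df_expand[OF d(1) fq]
        by (simp add: linear_sum[OF l] linear_scale[OF l])
    qed
  qed
  then show "\<exists>V. open V \<and> p \<in> V \<and> smooth_vector_field_on M V (\<lambda>q. J \<alpha> q (X q))" using V by blast
qed

lemma almost_para_hypercomplex: "almost_para_hypercomplex M J"
proof -
  \<comment> \<open>The cases \<open>c = 1\<close> and \<open>c = - 1\<close> together: a multiple
    of the identity by such a \<open>c\<close> preserves \<open>gM\<close> while
    \<open>J \<alpha>\<close> reverses its sign, so \<open>gM\<close> would vanish, contradicting
    nondegeneracy.\<close>
  have "J \<alpha> \<noteq> (\<lambda>p v. c *\<^sub>R v)" if a: "\<alpha> \<in> {1, 2}" and c: "c * c = 1" for \<alpha> c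
  proof
    assume J: "J \<alpha> = (\<lambda>p v. c *\<^sub>R v)"
    fix p
    have "gM p v w = 0" for v w
    proof -
      have "gM p (c *\<^sub>R v) (c *\<^sub>R w) = c * c * gM p v w"
        by (simp add: bilinear_lmul[OF bilinear_gM] bilinear_rmul[OF bilinear_gM])
      moreover have "gM p (c *\<^sub>R v) (c *\<^sub>R w) = - gM p v w" using gM_J[of \<alpha> p v w] a J by (auto simp: tau_def)
      ultimately show ?thesis using c by simp
    qed
    then have "v = 0" for v :: 'm
      using nondeg unfolding nondegenerate_submanifold_def nondegenerate_form_def by blast
    then show False using nonzero_Basis[OF SOME_Basis] by blast
  qed
  from this[of _ 1] this[of _ "-1"] show ?thesis
    unfolding almost_para_hypercomplex_def endo_field_def
    using J_J[of 1] J_J[of 2] J_J[of 3] J_1_2 linear_J smooth_J by auto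
qed

lemma semi_riemannian_induced: "semi_riemannian_metric M gM"
proof -
  have nd: "nondegenerate_form (gM p)" for p using nondeg by (simp add: nondegenerate_submanifold_def)
  have sym: "gM p v w = gM p w v" for p v w by (simp add: induced_metric_def g_sym)
  \<comment> \<open>\<open>J 1\<close> is an anti-isometry of \<open>gM p\<close> at every
    point.\<close>
  have "2 * form_index (gM p) = DIM('m)" for p
    by (rule form_index_anti_isometry[OF bilinear_gM sym nd linear_J[of 1 p]]) (simp_all add: gM_J[of 1 p, simplified])
  then have index: "form_index (gM p) = DIM('m) div 2" for p by (metis nonzero_mult_div_cancel_left zero_neq_numeral)
  have smooth: "smooth_fun_on M U (\<lambda>q. gM q (X q) (Y q))"
    if U: "open U" and X: "smooth_vector_field_on M U X" and Y: "smooth_vector_field_on M U Y" for U X Y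
  proof (rule dom.smooth_fun_on_local)
    fix p assume p: "p \<in> U"
    let ?d = "chart_at N (f p)"
    note d = cod.chart_at[of "f p"]
    note od = cod.open_chart[OF d(1)]
    let ?V = "U \<inter> f -` fst ?d"
    have V: "open ?V" "?V \<subseteq> f -` fst ?d" "p \<in> ?V" using U p d open_preimage[OF od] by auto
    let ?G = "\<lambda>i j r. g r (cod.frame ?d i r) (cod.frame ?d j r)"
    have "smooth_fun_on N (fst ?d) (?G i j)" for i j
      using metric od cod.smooth_frame[OF d(1)] unfolding semi_riemannian_metric_def by blast
    then have G: "smooth_fun_on M ?V (\<lambda>q. ?G i j (f q))" for i j
      by (intro dom.smooth_fun_on_subset[OF smooth_fun_compose[OF od] V(2)])
    have "smooth_fun_on M ?V (\<lambda>q. \<Sum>i\<in>Basis. vderiv M q (X q) (fcoord ?d i) *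
        (\<Sum>j\<in>Basis. vderiv M q (Y q) (fcoord ?d j) * ?G i j (f q)))"
      by (intro dom.smooth_fun_on_sum dom.smooth_fun_on_mult V(1) G smooth_vderiv_fcoord[OF d(1) V(1,2)]
          dom.smooth_vector_field_subset[OF X] dom.smooth_vector_field_subset[OF Y]) auto
    then have "smooth_fun_on M ?V (\<lambda>q. gM q (X q) (Y q))"
    proof (rule dom.smooth_fun_on_cong[OF V(1)])
      fix q assume "q \<in> ?V"
      then have fq: "f q \<in> fst ?d" by auto
      have l1: "linear (\<lambda>u. g (f q) u w)" and l2: "linear (\<lambda>u. g (f q) w u)" for w
        using bilinear_g[of "f q"] by (auto simp: bilinear_def)
      show "(\<Sum>i\<in>Basis. vderiv M q (X q) (fcoord ?d i) *
          (\<Sum>j\<in>Basis. vderiv M q (Y q) (fcoord ?d j) * ?G i j (f q))) = gM q (X q) (Y q)"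
      proof -
        have X: "g (f q) (df q (X q)) w =
            (\<Sum>i\<in>Basis. vderiv M q (X q) (fcoord ?d i) * g (f q) (cod.frame ?d i (f q)) w)" for w
          by (subst df_expand[OF d(1) fq]) (simp add: linear_sum[OF l1] linear_scale[OF l1])
        have Y: "g (f q) w (df q (Y q)) =
            (\<Sum>j\<in>Basis. vderiv M q (Y q) (fcoord ?d j) * g (f q) w (cod.frame ?d j (f q)))" for w
          by (subst df_expand[OF d(1) fq]) (simp add: linear_sum[OF l2] linear_scale[OF l2])
        show ?thesis unfolding induced_metric_def X unfolding Y ..
      qed
    qed
    then show "\<exists>V. open V \<and> p \<in> V \<and> smooth_fun_on M V (\<lambda>q. gM q (X q) (Y q))" using V by blast
  qed
  show ?thesis
    unfolding semi_riemannian_metric_def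
    by (intro conjI allI impI exI[of _ "DIM('m) div 2"]) (rule bilinear_gM sym nd index smooth; assumption)+
qed

section \<open>Derivatives of tangent fields along the immersion\<close>

lemma cov_J:
  assumes "\<alpha> \<in> {1, 2, 3}" "open U" "p \<in> U" "smooth_vector_field_on M U Y"
  shows "cov p v (\<lambda>q. df q (J \<alpha> q (Y q))) = \<phi> \<alpha> (f p) (cov p v (\<lambda>q. df q (Y q)))"
  by (rule cov_parallel_endo[OF mixed_3_structure_at(3)[OF mixed_structure assms(1)] parallel_phi[OF assms(1)] assms(2-4)])
    (rule df_J[OF assms(1)])

lemma subspace_range_df: "subspace (range (df p))"
  using linear_subspace_image[OF linear_df subspace_UNIV] .

text \<open>Applying \<open>\<phi> \<alpha>\<close> twice to \<open>?b\<close> gives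
  \<open>(- tau \<alpha>) *\<^sub>R ?b\<close>, because on the field it amounts to
  \<open>J \<alpha>\<close> applied twice. The structure equation has an additional multiple of
  \<open>\<xi> \<alpha>\<close> with factor \<open>\<eta> \<alpha>\<close> of \<open>?b\<close>, and
  \<open>\<xi> \<alpha>\<close> is nonzero.\<close>

lemma eta_cov:
  assumes a: "\<alpha> \<in> {1, 2, 3}" and U: "open U" "p \<in> U" and Y: "smooth_vector_field_on M U Y"
  shows "\<eta> \<alpha> (f p) (cov p v (\<lambda>q. df q (Y q))) = 0"
proof -
  let ?b = "cov p v (\<lambda>q. df q (Y q))"
  have "\<phi> \<alpha> (f p) (\<phi> \<alpha> (f p) ?b) = cov p v (\<lambda>q. df q ((- tau \<alpha>) *\<^sub>R Y q))"
    unfolding cov_J[OF a U Y, symmetric] cov_J[OF a U smooth_J[OF a U(1) Y], symmetric] J_J[OF a] ..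
  also have "\<dots> = (- tau \<alpha>) *\<^sub>R ?b"
    using cov_df_scale[OF U Y dom.smooth_fun_on_const, of v "- tau \<alpha>"] by simp
  finally have "tau \<alpha> *\<^sub>R (\<eta> \<alpha> (f p) ?b *\<^sub>R \<xi> \<alpha> (f p)) = 0"
    using mixed_3_structure_at(1)[OF mixed_structure a, of "f p" ?b] by (simp add: algebra_simps)
  moreover have "\<xi> \<alpha> (f p) \<noteq> 0"
    using mixed_3_structure_at(2)[OF mixed_structure a, of "f p"]
      linear_0[OF mixed_3_structure_at(5)[OF mixed_structure a]] by (metis zero_neq_one)
  ultimately show ?thesis by (simp add: tau_def split: if_splits)
qed

text \<open>This is the vanishing of the second fundamental form. Modulo \<open>?T\<close>, moving
  \<open>J 1\<close> and \<open>J 2\<close> out of \<open>B ?X1 ?Y2\<close> by symmetry and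
  parallelism in two different orders gives both products of \<open>\<phi> 1\<close> and
  \<open>\<phi> 2\<close> on \<open>b\<close>.\<close>

lemma cov_df_tangent:
  assumes U: "open U" "p \<in> U" and Y: "smooth_vector_field_on M U Y"
  shows "cov p v (\<lambda>q. df q (Y q)) \<in> range (df p)"
proof -
  let ?c = "chart_at M p" and ?T = "range (df p)"
  note c = dom.chart_at[of p]
  define V where "V = U \<inter> fst ?c"
  have V: "open V" "p \<in> V" using U c dom.open_chart[OF c(1)] by (auto simp: V_def)
  \<comment> \<open>Symmetry concerns two fields, so \<open>v\<close> is extended to the field with
    constant components in the preferred chart.\<close>
  define X where "X = dom.frame ?c (components_in M ?c p v)"
  have Xp: "X p = v" using dom.bij_components_in[OF c] by (simp add: X_def dom.frame_def bij_def)
  have X: "smooth_vector_field_on M V X"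
    unfolding X_def by (rule dom.smooth_vector_field_subset[OF dom.smooth_frame[OF c(1)]]) (simp add: V_def)
  have YV: "smooth_vector_field_on M V Y" by (rule dom.smooth_vector_field_subset[OF Y]) (simp add: V_def)
  note T = subspace_range_df[of p]
  \<comment> \<open>\<open>B\<close> is the full derivative, with its tangential part; only
    differences modulo \<open>?T\<close> are compared.\<close>
  define B where "B X Y = cov p (X p) (\<lambda>q. df q (Y q))" for X Y
  have sym: "B X Y - B Y X \<in> ?T" if X: "smooth_vector_field_on M V X" and Y: "smooth_vector_field_on M V Y" for X Y
  proof -
    obtain L where "\<And>h W. open W \<Longrightarrow> p \<in> W \<Longrightarrow> smooth_fun_on M W h \<Longrightarrow> vderiv M p L h =
      vderiv M p (X p) (\<lambda>q. vderiv M q (Y q) h) - vderiv M p (Y p) (\<lambda>q. vderiv M q (X q) h)"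
      using dom.lie_bracket_exists[OF V X Y] by blast
    from cov_df_bracket[OF torsion_free V X Y this] show ?thesis unfolding B_def by simp
  qed
  have i: "1 \<in> {1, 2, 3 :: nat}" "2 \<in> {1, 2, 3 :: nat}" "3 \<in> {1, 2, 3 :: nat}" by auto
  have BJ: "B X (\<lambda>q. J \<alpha> q (Y q)) = \<phi> \<alpha> (f p) (B X Y)" if "\<alpha> \<in> {1, 2, 3}" "smooth_vector_field_on M V Y" for \<alpha> X Y
    unfolding B_def by (rule cov_J[OF that(1) V that(2)])
  have lin: "linear (\<phi> \<alpha> (f p))" if "\<alpha> \<in> {1, 2, 3}" for \<alpha> by (rule mixed_3_structure_at(4)[OF mixed_structure that])
  have swap: "\<phi> \<alpha> (f p) (B X Y) - \<phi> \<alpha> (f p) (B Y X) \<in> ?T"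
    if "\<alpha> \<in> {1, 2, 3}" "smooth_vector_field_on M V X" "smooth_vector_field_on M V Y" for \<alpha> X Y
    unfolding linear_diff[OF lin[OF that(1)], symmetric] by (rule phi_in_range[OF that(1) sym[OF that(2,3)]])
  let ?X1 = "\<lambda>q. J 1 q (X q)" and ?Y2 = "\<lambda>q. J 2 q (Y q)"
  have X1: "smooth_vector_field_on M V ?X1" and Y2: "smooth_vector_field_on M V ?Y2"
    by (rule smooth_J[OF i(1) V(1) X] smooth_J[OF i(2) V(1) YV])+
  define b where "b = B X Y"
  \<comment> \<open>Facts \<open>1\<close> and \<open>2\<close> reach \<open>\<phi> 2\<close> after
    \<open>\<phi> 1\<close> on \<open>b\<close>, facts \<open>3\<close> and \<open>4\<close> the
    opposite order, both from \<open>B ?X1 ?Y2\<close>.\<close>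
  have 1: "B ?X1 ?Y2 - \<phi> 2 (f p) (\<phi> 1 (f p) (B Y X)) \<in> ?T"
    using swap[OF i(2) X1 YV] by (simp only: BJ[OF i(2) YV] BJ[OF i(1) X])
  have "\<phi> 2 (f p) (\<phi> 1 (f p) (B Y X) - \<phi> 1 (f p) b) \<in> ?T"
    unfolding b_def by (rule phi_in_range[OF i(2) swap[OF i(1) YV X]])
  then have 2: "\<phi> 2 (f p) (\<phi> 1 (f p) (B Y X)) - \<phi> 2 (f p) (\<phi> 1 (f p) b) \<in> ?T"
    by (simp only: linear_diff[OF lin[OF i(2)]])
  have 3: "B ?X1 ?Y2 - \<phi> 1 (f p) (B ?Y2 X) \<in> ?T"
    using sym[OF X1 Y2] by (simp only: BJ[OF i(1) X])
  have 4: "\<phi> 1 (f p) (B ?Y2 X) - \<phi> 1 (f p) (\<phi> 2 (f p) b) \<in> ?T"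
    using swap[OF i(1) Y2 X] unfolding b_def by (simp only: BJ[OF i(2) YV])
  have "\<phi> 1 (f p) (\<phi> 2 (f p) b) - \<phi> 2 (f p) (\<phi> 1 (f p) b) \<in> ?T"
    using subspace_diff[OF T subspace_add[OF T 1 2] subspace_add[OF T 3 4]] by simp
  moreover have eta: "\<eta> \<alpha> (f p) b = 0" if "\<alpha> \<in> {1, 2, 3}" for \<alpha>
    unfolding b_def B_def by (rule eta_cov[OF that V YV])
  ultimately have "2 *\<^sub>R \<phi> 3 (f p) b \<in> ?T"
    unfolding phi_1_2 by (simp only: eta[OF i(1)] eta[OF i(2)]) (simp add: scaleR_2)
  \<comment> \<open>Since \<open>\<eta> 3\<close> kills \<open>b\<close>, applying
    \<open>\<phi> 3\<close> to \<open>2 *\<^sub>R \<phi> 3 (f p) b\<close> gives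
    \<open>- 2 *\<^sub>R b\<close>; the scalar undoes this.\<close>
  from subspace_scale[OF T phi_in_range[OF i(3) this], of "- 1 / 2"]
  have "b \<in> ?T"
    unfolding linear_scale[OF lin[OF i(3)]] mixed_3_structure_at(1)[OF mixed_structure i(3)] eta[OF i(3)] by simp
  then show ?thesis by (simp add: b_def B_def Xp)
qed

text \<open>The Gauss formula without a normal term: by \<open>cov_df_tangent\<close>, for
  \<open>Y\<close> smooth near \<open>p\<close>, the derivative lies in the range of
  \<open>df p\<close>, so no projection is taken.\<close>

definition nablaM :: "('p, 'm) connection" where
  "nablaM p v Y = inv (df p) (cov p v (\<lambda>q. df q (Y q)))"

lemma df_nablaM:
  "open U \<Longrightarrow> p \<in> U \<Longrightarrow> smooth_vector_field_on M U Y \<Longrightarrow> df p (nablaM p v Y) = cov p v (\<lambda>q. df q (Y q))"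
  unfolding nablaM_def by (rule f_inv_into_f[OF cov_df_tangent])

text \<open>As for \<open>smooth_J\<close>, smoothness is checked after applying \<open>df\<close>
  and carried back along the immersion.\<close>

lemma smooth_nablaM:
  assumes U: "open U" and X: "smooth_vector_field_on M U X" and Y: "smooth_vector_field_on M U Y"
  shows "smooth_vector_field_on M U (\<lambda>p. nablaM p (X p) Y)"
proof (rule dom.smooth_vector_field_local[OF U])
  fix p assume p: "p \<in> U"
  let ?d = "chart_at N (f p)"
  note d = cod.chart_at[of "f p"]
  let ?V = "U \<inter> f -` fst ?d"
  have V: "open ?V" "?V \<subseteq> f -` fst ?d" "p \<in> ?V" using U p d open_preimage[OF cod.open_chart[OF d(1)]] by auto
  have "smooth_vector_field_on M ?V (\<lambda>p. nablaM p (X p) Y)"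
  proof (rule smooth_vector_field_immersion[OF inj_df V(1,2) d(1)])
    fix i :: 'n assume "i \<in> Basis"
    have "smooth_fun_on M ?V (\<lambda>q. vderiv N (f q) (cov q (X q) (\<lambda>r. df r (Y r))) (cod.coord ?d i))"
      by (rule smooth_cov_df[OF d(1) V(1,2)]; rule dom.smooth_vector_field_subset[OF X] dom.smooth_vector_field_subset[OF Y]) auto
    then show "smooth_fun_on M ?V (\<lambda>q. vderiv N (f q) (df q (nablaM q (X q) Y)) (cod.coord ?d i))"
      by (rule dom.smooth_fun_on_cong[OF V(1)]) (simp add: df_nablaM[OF U _ Y])
  qed
  then show "\<exists>V. open V \<and> p \<in> V \<and> smooth_vector_field_on M V (\<lambda>p. nablaM p (X p) Y)" using V by blast
qed

lemma affine_nablaM: "affine_connection M nablaM"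
proof -
  have lin: "linear (\<lambda>v. nablaM p v Y)" if U: "open U" "p \<in> U" and Y: "smooth_vector_field_on M U Y" for U p Y
    by (rule linearI; subst df_eq_iff[of p, symmetric])
      (simp_all add: df_nablaM[OF U Y] linear_add[OF linear_df] linear_scale[OF linear_df]
        linear_add[OF linear_cov_df[OF U Y]] linear_scale[OF linear_cov_df[OF U Y]])
  have add: "nablaM p v (\<lambda>q. Y q + Z q) = nablaM p v Y + nablaM p v Z"
    if U: "open U" "p \<in> U" and Y: "smooth_vector_field_on M U Y" and Z: "smooth_vector_field_on M U Z" for U p Y Z v
    unfolding nablaM_def[of p v "\<lambda>q. Y q + Z q"] cov_df_add[OF U Y Z] df_nablaM[OF U Y, symmetric] df_nablaM[OF U Z, symmetric]
    by (simp add: linear_add[OF linear_df, symmetric])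
  have scale: "nablaM p v (\<lambda>q. h q *\<^sub>R Y q) = vderiv M p v h *\<^sub>R Y p + h p *\<^sub>R nablaM p v Y"
    if U: "open U" "p \<in> U" and Y: "smooth_vector_field_on M U Y" and h: "smooth_fun_on M U h" for U p Y h v
    unfolding nablaM_def[of p v "\<lambda>q. h q *\<^sub>R Y q"] cov_df_scale[OF U Y h] df_nablaM[OF U Y, symmetric]
    by (simp add: linear_add[OF linear_df, symmetric] linear_scale[OF linear_df, symmetric])
  \<comment> \<open>The formula \<open>cov_df\<close> sees \<open>Z\<close> only through its values
    on \<open>U\<close>.\<close>
  have cong: "nablaM p v Z = nablaM p v Y"
    if U: "open U" "p \<in> U" and Y: "smooth_vector_field_on M U Y" and Z: "\<forall>q\<in>U. Z q = Y q" for U p Y Z v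
    unfolding nablaM_def
    using cov_df[OF cod.chart_at(1) U cod.chart_at(2) Y, of "\<lambda>q. df q (Z q)" v]
      cov_df[OF cod.chart_at(1) U cod.chart_at(2) Y, of "\<lambda>q. df q (Y q)" v] Z by simp
  show ?thesis
    unfolding affine_connection_def
    by (intro allI impI conjI ballI) (rule lin add scale cong smooth_nablaM; assumption)+
qed

text \<open>\<open>df\<close> maps both the skew part of \<open>nablaM\<close> and the bracket
  vector \<open>L\<close> to the same ambient vector, and \<open>df\<close> is injective.\<close>

lemma torsion_free_nablaM: "torsion_free M nablaM"
  unfolding torsion_free_def
proof (intro allI impI ballI)
  fix U X Y h p
  assume U: "open U" and X: "smooth_vector_field_on M U X" and Y: "smooth_vector_field_on M U Y"
    and h: "smooth_fun_on M U h" and p: "p \<in> U"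
  obtain L where L: "\<And>h W. open W \<Longrightarrow> p \<in> W \<Longrightarrow> smooth_fun_on M W h \<Longrightarrow> vderiv M p L h =
      vderiv M p (X p) (\<lambda>q. vderiv M q (Y q) h) - vderiv M p (Y p) (\<lambda>q. vderiv M q (X q) h)"
    using dom.lie_bracket_exists[OF U p X Y] by blast
  have "df p (nablaM p (X p) Y - nablaM p (Y p) X) =
      cov p (X p) (\<lambda>q. df q (Y q)) - cov p (Y p) (\<lambda>q. df q (X q))"
    by (simp add: linear_diff[OF linear_df] df_nablaM[OF U p X] df_nablaM[OF U p Y])
  also have "\<dots> = df p L" by (rule cov_df_bracket[OF torsion_free U p X Y L])
  finally have "df p (nablaM p (X p) Y - nablaM p (Y p) X) = df p L" .
  then have "nablaM p (X p) Y - nablaM p (Y p) X = L" by (simp only: df_eq_iff)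
  then show "vderiv M p (nablaM p (X p) Y - nablaM p (Y p) X) h =
      vderiv M p (X p) (\<lambda>q. vderiv M q (Y q) h) - vderiv M p (Y p) (\<lambda>q. vderiv M q (X q) h)"
    using L[OF U p h] by simp
qed

lemma metric_connection_nablaM: "metric_connection M gM nablaM"
  unfolding metric_connection_def induced_metric_def
proof (intro allI impI ballI)
  fix U Y Z p v
  assume U: "open U" and Y: "smooth_vector_field_on M U Y" and Z: "smooth_vector_field_on M U Z" and p: "p \<in> U"
  show "vderiv M p v (\<lambda>q. g (f q) (df q (Y q)) (df q (Z q))) =
      g (f p) (df p (nablaM p v Y)) (df p (Z p)) + g (f p) (df p (Y p)) (df p (nablaM p v Z))"
    unfolding df_nablaM[OF U p Y] df_nablaM[OF U p Z] by (rule cov_metric[OF metric metric_conn U p Y Z])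
qed

lemma parallel_J: "\<alpha> \<in> {1, 2, 3} \<Longrightarrow> parallel_endo M nablaM (J \<alpha>)"
  unfolding parallel_endo_def cov_deriv_endo_def
proof (intro allI impI ballI)
  fix U Y p v
  assume a: "\<alpha> \<in> {1, 2, 3}" and U: "open U" and Y: "smooth_vector_field_on M U Y" and p: "p \<in> U"
  have "df p (nablaM p v (\<lambda>q. J \<alpha> q (Y q))) = df p (J \<alpha> p (nablaM p v Y))"
    unfolding df_nablaM[OF U p smooth_J[OF a U Y]] df_J[OF a, of p "nablaM p v Y"] df_nablaM[OF U p Y] by (rule cov_J[OF a U p Y])
  then show "nablaM p v (\<lambda>q. J \<alpha> q (Y q)) - J \<alpha> p (nablaM p v Y) = 0" by (simp only: df_eq_iff) simp
qed

lemma para_hyper_kaehler: "para_hyper_kaehler M gM J"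
proof -
  have "almost_para_hyperhermitian M gM J"
    unfolding almost_para_hyperhermitian_def
    using almost_para_hypercomplex semi_riemannian_induced gM_J[of 1] gM_J[of 2] gM_J[of 3] by simp
  moreover have "levi_civita M gM nablaM"
    unfolding levi_civita_def using affine_nablaM torsion_free_nablaM metric_connection_nablaM by blast
  ultimately show ?thesis unfolding para_hyper_kaehler_def using parallel_J by blast
qed

text \<open>The description by \<open>THE\<close> requires uniqueness: a vector both tangent and
  normal comes from the radical of \<open>gM p\<close>, which is zero.\<close>

lemma normal_part_tangent:
  assumes "w \<in> range (df p)"
  shows "normal_part M N f g p w = 0"
  unfolding normal_part_def
proof (rule the_equality)
  show "0 \<in> normal_space M N f g p \<and> w - 0 \<in> tangent_image M N f p"
    using assms by (simp add: normal_space_def tangent_image_def bilinear_lzero[OF bilinear_g])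
  fix n assume n: "n \<in> normal_space M N f g p \<and> w - n \<in> tangent_image M N f p"
  then have "w - n \<in> range (df p)" by (simp add: tangent_image_def)
  from subspace_diff[OF subspace_range_df assms this] have "n \<in> range (df p)" by simp
  then obtain u where u: "n = df p u" by auto
  then have "gM p u v = 0" for v
    using n by (auto simp: normal_space_def tangent_image_def induced_metric_def)
  then have "u = 0"
    using nondeg unfolding nondegenerate_submanifold_def nondegenerate_form_def by blast
  then show "n = 0" using u linear_0[OF linear_df] by simp
qed

text \<open>The derivative of a local extension is the derivative of \<open>df q (Y q)\<close> along
  \<open>f\<close>, hence tangent.\<close>

lemma totally_geodesic: "totally_geodesic M N f g nabla"
  unfolding totally_geodesic_def second_fundamental_form_def
proof (intro allI impI)
  fix p v Y Y' assume "local_extension M N f p Y Y'"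
  then obtain U W where U: "open U" "p \<in> U" and W: "open W" "f ` U \<subseteq> W"
    and Y: "smooth_vector_field_on M U Y" and Y': "smooth_vector_field_on N W Y'"
    and ext: "\<And>q. q \<in> U \<Longrightarrow> Y' (f q) = df q (Y q)"
    unfolding local_extension_def by blast
  have "nabla (f p) (df p v) Y' = cov p v (\<lambda>q. df q (Y q))"
    by (rule cov_restriction[OF U W Y', symmetric]) (simp add: ext)
  then show "normal_part M N f g p (nabla (f p) (df p v) Y') = 0"
    using cov_df_tangent[OF U Y] by (simp add: normal_part_tangent)
qed

end

theorem proposition6p5:
  fixes M :: "('p::{t2_space,second_countable_topology}, 'm::euclidean_space) chart set"
    and Mbar :: "('q::{t2_space,second_countable_topology}, 'n::euclidean_space) chart set"
    and f :: "'p \<Rightarrow> 'q"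
    and \<phi> :: "nat \<Rightarrow> 'q \<Rightarrow> 'n \<Rightarrow> 'n"
    and \<xi> :: "nat \<Rightarrow> 'q \<Rightarrow> 'n"
    and \<eta> :: "nat \<Rightarrow> 'q \<Rightarrow> 'n \<Rightarrow> real"
    and gbar :: "'q \<Rightarrow> 'n \<Rightarrow> 'n \<Rightarrow> real"
    and nablabar :: "('q, 'n) connection"
  assumes "smooth_atlas M"
    and "smooth_atlas Mbar"
    and "metric_mixed_3_structure Mbar \<phi> \<xi> \<eta> gbar"
    and "nondegenerate_submanifold M Mbar f gbar"
    and "invariant_submanifold M Mbar f \<phi>"
    and "structure_fields_normal M Mbar f \<xi> gbar"
    and "mixed_3_cosymplectic Mbar \<phi> \<xi> \<eta> gbar nablabar"
  shows "para_hyper_kaehler M (induced_metric M Mbar f gbar)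
           (\<lambda>\<alpha>. restrict_endo M Mbar f (\<phi> \<alpha>)) \<and>
         totally_geodesic M Mbar f gbar nablabar"
proof -
  interpret invariant_cosymplectic M Mbar f nablabar \<phi> \<xi> \<eta> gbar
  proof
    show "smooth_map M Mbar f"
      using assms(4) by (simp add: nondegenerate_submanifold_def immersion_def)
    show "affine_connection Mbar nablabar"
      using assms(7) by (simp add: mixed_3_cosymplectic_def levi_civita_def)
  qed (rule assms)+
  show ?thesis using para_hyper_kaehler totally_geodesic by blast
qed

end
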